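(* Let $\mathcal{K}$ be a field, $\Gamma\leq\mathbb{R}$ an additive subgroup, and $\Lambda=\Lambda^{\mathcal{K},\Gamma}$ the associated Novikov field. Two Floer-type complexes $(C_*,\partial_C,\ell_C)$ and $(D_*,\partial_D,\ell_D)$ over $\Lambda$ are filtered chain isomorphic to each other if and only if, for every $k\in\mathbb{Z}$, their degree-$k$ verbose barcodes are identical.
   Context: **Novikov field.** $\Lambda=\Lambda^{\mathcal{K},\Gamma}$ is the field of formal sums $\sum_{g\in\Gamma}a_gT^g$ with $a_g\in\mathcal{K}$ such that for every $C\in\mathbb{R}$ only finitely many $g<C$ have $a_g\neq 0$, with power-series addition and multiplication. Its valuation is $\nu(\sum a_gT^g)=\min\{g\mid a_g\neq 0\}$, $\nu(0)=\infty$. **Orthogonalizable spaces.** A non-Archimedean normed vector space over $\Lambda$ is a pair $(C,\ell)$ with $C$ a $\Lambda$-vector space and $\ell\colon C\to\mathbb{R}\cup\{-\infty\}$ (filtration function) satisfying: $\ell(x)=-\infty$ iff $x=0$; $\ell(\lambda x)=\ell(x)-\nu(\lambda)$; $\ell(x+y)\leq\max\{\ell(x),\ell(y)\}$. A finite ordered collection $(w_1,\dots,w_r)$ in $C$ is orthogonal if $\ell(\sum_i\lambda_iw_i)=\max_i\ell(\lambda_iw_i)$ for all $\lambda_i\in\Lambda$. An orthogonalizable $\Lambda$-space is a finite-dimensional non-Archimedean normed vector space admitting an orthogonal basis; subspaces of orthogonalizable spaces (with restricted $\ell$) are again orthogonalizable. **Singular value decomposition.** Let $A\colon C\to D$ be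 a $\Lambda$-linear map of rank $r$ between orthogonalizable $\Lambda$-spaces $(C,\ell_C)$, $(D,\ell_D)$. A singular value decomposition of $A$ is a choice of orthogonal ordered bases $(y_1,\dots,y_n)$ of $C$ and $(x_1,\dots,x_m)$ of $D$ such that: $(y_{r+1},\dots,y_n)$ is an orthogonal ordered basis of $\ker A$; $(x_1,\dots,x_r)$ is an orthogonal ordered basis of $\mathrm{Im}\,A$; $Ay_i=x_i$ for $1\leq i\leq r$; and $\ell_C(y_1)-\ell_D(x_1)\geq\cdots\geq\ell_C(y_r)-\ell_D(x_r)$. **Floer-type complex.** A Floer-type complex $(C_*,\partial,\ell)$ over $\Lambda$ is a chain complex $(C_*=\bigoplus_{k\in\mathbb{Z}}C_k,\partial)$ of $\Lambda$-vector spaces ($\partial$ is $\Lambda$-linear, $\partial C_k\subset C_{k-1}$, $\partial^2=0$) together with a function $\ell$ such that each $(C_k,\ell|_{C_k})$ is an orthogonalizable $\Lambda$-space and $\ell(\partial x)\leq\ell(x)$ for each $x\in C_k$. **Filtered chain isomorphism.** A chain isomorphism $\Phi\colon C_*\to D_*$ (over $\Lambda$, degree $0$) with $\ell_D(\Phi(x))=\ell_C(x)$ for all homogeneous $x\in C_*$. **Verbose barcode.** For $k\in\mathbb{Z}$ write $\partial_k=\partial|_{C_k}$, $Z_k=\ker\partial_k$. Choose a singular value decomposition $((y_1,\dots,y_n),(x_1,\dots,x_m))$ of $\partial_{k+1}\colon C_{k+1}\to Z_k$ and let $r$ be the rank of $\partial_{k+1}$. The degree-$k$ verbose barcode is the multiset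 of elements of $(\mathbb{R}/\Gamma)\times[0,\infty]$ consisting of $(\ell(x_i)\bmod\Gamma,\ \ell(y_i)-\ell(x_i))$ for $i=1,\dots,r$ and $(\ell(x_i)\bmod\Gamma,\ \infty)$ for $i=r+1,\dots,m$. Singular value decompositions always exist and this multiset does not depend on the chosen one. *)

theory Defs
  imports
    Complex_Main
    "HOL-Library.Extended_Real"
    "HOL-Library.Multiset"
    "HOL-Algebra.Coset"
    "HOL-Algebra.Module"
begin

definition real_add_group :: "real monoid" where
  "real_add_group = \<lparr>carrier = UNIV, monoid.mult = (+), one = 0\<rparr>"

text \<open>
  The formal sum of the terms \<open>a\<^sub>g T\<^sup>g\<close>, \<open>g \<in> \<Gamma>\<close>, is represented by its coefficient function,
  extended by zero outside \<open>\<Gamma>\<close>.  In the product, the index set is finite for all elements of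
  the carrier, because their supports are finite below every bound.
\<close>

definition novikov :: "('k, 'z) ring_scheme \<Rightarrow> real set \<Rightarrow> (real \<Rightarrow> 'k) ring" where
  "novikov K \<Gamma> =
    \<lparr>carrier = {a. (\<forall>g. a g \<in> carrier K) \<and> (\<forall>g. g \<notin> \<Gamma> \<longrightarrow> a g = \<zero>\<^bsub>K\<^esub>) \<and>
                   (\<forall>C. finite {g. g < C \<and> a g \<noteq> \<zero>\<^bsub>K\<^esub>})},
     monoid.mult = (\<lambda>a b g. \<Oplus>\<^bsub>K\<^esub>h \<in> {h. a h \<noteq> \<zero>\<^bsub>K\<^esub> \<and> b (g - h) \<noteq> \<zero>\<^bsub>K\<^esub>}. a h \<otimes>\<^bsub>K\<^esub> b (g - h)),
     one = (\<lambda>g. if g = 0 then \<one>\<^bsub>K\<^esub> else \<zero>\<^bsub>K\<^esub>),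
     zero = (\<lambda>g. \<zero>\<^bsub>K\<^esub>),
     add = (\<lambda>a b g. a g \<oplus>\<^bsub>K\<^esub> b g)\<rparr>"

definition novikov_val :: "('k, 'z) ring_scheme \<Rightarrow> (real \<Rightarrow> 'k) \<Rightarrow> ereal" where
  "novikov_val K a = (if \<forall>g. a g = \<zero>\<^bsub>K\<^esub> then \<infinity> else ereal (LEAST g. a g \<noteq> \<zero>\<^bsub>K\<^esub>))"

text \<open>
  A vector space over a field \<open>R\<close> is a module over \<open>R\<close>; a finite ordered collection of vectors
  is a list, indexed from 0.
\<close>

definition lincomb ::
    "('c, 'd) ring_scheme \<Rightarrow> ('c, 'v, 'e) module_scheme \<Rightarrow> (nat \<Rightarrow> 'c) \<Rightarrow> 'v list \<Rightarrow> 'v" where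
  "lincomb R M a ws = (\<Oplus>\<^bsub>M\<^esub>i \<in> {..<length ws}. a i \<odot>\<^bsub>M\<^esub> ws ! i)"

definition ordered_basis ::
    "('c, 'd) ring_scheme \<Rightarrow> ('c, 'v, 'e) module_scheme \<Rightarrow> 'v list \<Rightarrow> bool" where
  "ordered_basis R M ws \<longleftrightarrow>
     set ws \<subseteq> carrier M \<and>
     (\<forall>a \<in> {..<length ws} \<rightarrow> carrier R.
        lincomb R M a ws = \<zero>\<^bsub>M\<^esub> \<longrightarrow> (\<forall>i < length ws. a i = \<zero>\<^bsub>R\<^esub>)) \<and>
     (\<forall>v \<in> carrier M. \<exists>a \<in> {..<length ws} \<rightarrow> carrier R. v = lincomb R M a ws)"

definition vs_dim :: "('c, 'd) ring_scheme \<Rightarrow> ('c, 'v, 'e) module_scheme \<Rightarrow> nat" where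
  "vs_dim R M = (THE n. \<exists>ws. ordered_basis R M ws \<and> length ws = n)"

definition linear_map ::
    "('c, 'd) ring_scheme \<Rightarrow> ('c, 'v, 'e) module_scheme \<Rightarrow> ('c, 'w, 'f) module_scheme \<Rightarrow>
     ('v \<Rightarrow> 'w) \<Rightarrow> bool" where
  "linear_map R M N A \<longleftrightarrow>
     A \<in> hom (add_monoid M) (add_monoid N) \<and>
     (\<forall>c \<in> carrier R. \<forall>x \<in> carrier M. A (c \<odot>\<^bsub>M\<^esub> x) = c \<odot>\<^bsub>N\<^esub> A x)"

definition kernel_space ::
    "('c, 'v, 'e) module_scheme \<Rightarrow> ('c, 'w, 'f) module_scheme \<Rightarrow> ('v \<Rightarrow> 'w) \<Rightarrow>
     ('c, 'v, 'e) module_scheme" where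
  "kernel_space M N A = M\<lparr>carrier := {x \<in> carrier M. A x = \<zero>\<^bsub>N\<^esub>}\<rparr>"

definition image_space ::
    "('c, 'v, 'e) module_scheme \<Rightarrow> ('c, 'w, 'f) module_scheme \<Rightarrow> ('v \<Rightarrow> 'w) \<Rightarrow>
     ('c, 'w, 'f) module_scheme" where
  "image_space M N A = N\<lparr>carrier := A ` carrier M\<rparr>"

definition map_rank ::
    "('c, 'd) ring_scheme \<Rightarrow> ('c, 'v, 'e) module_scheme \<Rightarrow> ('c, 'w, 'f) module_scheme \<Rightarrow>
     ('v \<Rightarrow> 'w) \<Rightarrow> nat" where
  "map_rank R M N A = vs_dim R (image_space M N A)"

text \<open>
  With the conventions of \<^typ>\<open>ereal\<close>, subtracting \<open>\<infinity>\<close> from a real or from \<open>-\<infinity>\<close> gives \<open>-\<infinity>\<close>,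
  so the scaling axiom is also correct for the scalar 0 and the vector 0.
\<close>

definition nonarch_normed_space ::
    "('k, 'z) ring_scheme \<Rightarrow> real set \<Rightarrow> (real \<Rightarrow> 'k, 'v) module \<Rightarrow> ('v \<Rightarrow> ereal) \<Rightarrow> bool" where
  "nonarch_normed_space K \<Gamma> M l \<longleftrightarrow>
     Module.module (novikov K \<Gamma>) M \<and>
     (\<forall>x \<in> carrier M. l x \<noteq> \<infinity>) \<and>
     (\<forall>x \<in> carrier M. l x = -\<infinity> \<longleftrightarrow> x = \<zero>\<^bsub>M\<^esub>) \<and>
     (\<forall>c \<in> carrier (novikov K \<Gamma>). \<forall>x \<in> carrier M. l (c \<odot>\<^bsub>M\<^esub> x) = l x - novikov_val K c) \<and>
     (\<forall>x \<in> carrier M. \<forall>y \<in> carrier M. l (x \<oplus>\<^bsub>M\<^esub> y) \<le> max (l x) (l y))"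

text \<open>
  The supremum over the finite index set is a maximum; it is \<open>-\<infinity>\<close> for the empty list.
\<close>

definition orthogonal_list ::
    "('c, 'd) ring_scheme \<Rightarrow> ('c, 'v, 'e) module_scheme \<Rightarrow> ('v \<Rightarrow> ereal) \<Rightarrow> 'v list \<Rightarrow> bool" where
  "orthogonal_list R M l ws \<longleftrightarrow>
     set ws \<subseteq> carrier M \<and>
     (\<forall>a \<in> {..<length ws} \<rightarrow> carrier R.
        l (lincomb R M a ws) = (SUP i \<in> {..<length ws}. l (a i \<odot>\<^bsub>M\<^esub> ws ! i)))"

definition orthogonal_basis ::
    "('c, 'd) ring_scheme \<Rightarrow> ('c, 'v, 'e) module_scheme \<Rightarrow> ('v \<Rightarrow> ereal) \<Rightarrow> 'v list \<Rightarrow> bool" where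
  "orthogonal_basis R M l ws \<longleftrightarrow> ordered_basis R M ws \<and> orthogonal_list R M l ws"

text \<open>Finite dimensionality is implied by the existence of a basis that is a list.\<close>

definition orthogonalizable_space ::
    "('k, 'z) ring_scheme \<Rightarrow> real set \<Rightarrow> (real \<Rightarrow> 'k, 'v) module \<Rightarrow> ('v \<Rightarrow> ereal) \<Rightarrow> bool" where
  "orthogonalizable_space K \<Gamma> M l \<longleftrightarrow>
     nonarch_normed_space K \<Gamma> M l \<and> (\<exists>ws. orthogonal_basis (novikov K \<Gamma>) M l ws)"

definition is_svd ::
    "('c, 'd) ring_scheme \<Rightarrow> ('c, 'v, 'e) module_scheme \<Rightarrow> ('v \<Rightarrow> ereal) \<Rightarrow>
     ('c, 'w, 'f) module_scheme \<Rightarrow> ('w \<Rightarrow> ereal) \<Rightarrow> ('v \<Rightarrow> 'w) \<Rightarrow> 'v list \<Rightarrow> 'w list \<Rightarrow> bool" where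
  "is_svd R M lM N lN A ys xs \<longleftrightarrow>
     (let r = map_rank R M N A in
        orthogonal_basis R M lM ys \<and>
        orthogonal_basis R N lN xs \<and>
        orthogonal_basis R (kernel_space M N A) lM (drop r ys) \<and>
        orthogonal_basis R (image_space M N A) lN (take r xs) \<and>
        (\<forall>i < r. A (ys ! i) = xs ! i) \<and>
        (\<forall>i j. i \<le> j \<and> j < r \<longrightarrow>
           lM (ys ! i) - lN (xs ! i) \<ge> lM (ys ! j) - lN (xs ! j)))"

text \<open>
  The direct sum of the spaces in all degrees is given by the family of its homogeneous summands;
  accordingly the boundary operator and the filtration function are families indexed by the degree.
\<close>

record ('k, 'v) filtered_complex =
  chain_space :: "int \<Rightarrow> (real \<Rightarrow> 'k, 'v) module"
  bdry :: "int \<Rightarrow> 'v \<Rightarrow> 'v"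
  filt :: "int \<Rightarrow> 'v \<Rightarrow> ereal"

definition floer_complex ::
    "('k, 'z) ring_scheme \<Rightarrow> real set \<Rightarrow> ('k, 'v) filtered_complex \<Rightarrow> bool" where
  "floer_complex K \<Gamma> C \<longleftrightarrow>
     (\<forall>k. orthogonalizable_space K \<Gamma> (chain_space C k) (filt C k)) \<and>
     (\<forall>k. linear_map (novikov K \<Gamma>) (chain_space C k) (chain_space C (k - 1)) (bdry C k)) \<and>
     (\<forall>k. \<forall>x \<in> carrier (chain_space C k). bdry C (k - 1) (bdry C k x) = \<zero>\<^bsub>chain_space C (k - 2)\<^esub>) \<and>
     (\<forall>k. \<forall>x \<in> carrier (chain_space C k). filt C (k - 1) (bdry C k x) \<le> filt C k x)"

definition filtered_chain_iso ::
    "('k, 'z) ring_scheme \<Rightarrow> real set \<Rightarrow> ('k, 'v) filtered_complex \<Rightarrow> ('k, 'w) filtered_complex \<Rightarrow>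
     (int \<Rightarrow> 'v \<Rightarrow> 'w) \<Rightarrow> bool" where
  "filtered_chain_iso K \<Gamma> C D \<Phi> \<longleftrightarrow>
     (\<forall>k. linear_map (novikov K \<Gamma>) (chain_space C k) (chain_space D k) (\<Phi> k)) \<and>
     (\<forall>k. bij_betw (\<Phi> k) (carrier (chain_space C k)) (carrier (chain_space D k))) \<and>
     (\<forall>k. \<forall>x \<in> carrier (chain_space C k). \<Phi> (k - 1) (bdry C k x) = bdry D k (\<Phi> k x)) \<and>
     (\<forall>k. \<forall>x \<in> carrier (chain_space C k). filt D k (\<Phi> k x) = filt C k x)"

definition filtered_chain_isomorphic ::
    "('k, 'z) ring_scheme \<Rightarrow> real set \<Rightarrow> ('k, 'v) filtered_complex \<Rightarrow> ('k, 'w) filtered_complex \<Rightarrow>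
     bool" where
  "filtered_chain_isomorphic K \<Gamma> C D \<longleftrightarrow> (\<exists>\<Phi>. filtered_chain_iso K \<Gamma> C D \<Phi>)"

definition cycle_space :: "('k, 'v) filtered_complex \<Rightarrow> int \<Rightarrow> (real \<Rightarrow> 'k, 'v) module" where
  "cycle_space C k = kernel_space (chain_space C k) (chain_space C (k - 1)) (bdry C k)"

text \<open>
  An element of the quotient of the reals by \<open>\<Gamma>\<close> is a coset, i.e. a set of reals.
\<close>

definition bars_of_svd ::
    "real set \<Rightarrow> ('v \<Rightarrow> ereal) \<Rightarrow> ('w \<Rightarrow> ereal) \<Rightarrow> nat \<Rightarrow> 'v list \<Rightarrow> 'w list \<Rightarrow>
     (real set \<times> ereal) multiset" where
  "bars_of_svd \<Gamma> lM lN r ys xs =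
     image_mset
       (\<lambda>i. (\<Gamma> #>\<^bsub>real_add_group\<^esub> real_of_ereal (lN (xs ! i)),
             if i < r then lM (ys ! i) - lN (xs ! i) else \<infinity>))
       (mset_set {..<length xs})"

definition verbose_barcode ::
    "('k, 'z) ring_scheme \<Rightarrow> real set \<Rightarrow> ('k, 'v) filtered_complex \<Rightarrow> int \<Rightarrow>
     (real set \<times> ereal) multiset" where
  "verbose_barcode K \<Gamma> C k =
     (let (ys, xs) = (SOME (ys, xs).
            is_svd (novikov K \<Gamma>) (chain_space C (k + 1)) (filt C (k + 1)) (cycle_space C k) (filt C k)
              (bdry C (k + 1)) ys xs)
      in bars_of_svd \<Gamma> (filt C (k + 1)) (filt C k)
           (map_rank (novikov K \<Gamma>) (chain_space C (k + 1)) (cycle_space C k) (bdry C (k + 1))) ys xs)"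

end

theory Submission
  imports Defs "HOL-Combinatorics.List_Permutation"
begin

text \<open>
  Eliminating with a pivot that decreases the filtration least keeps all bases orthogonal, so every
  filtered map has a singular value decomposition.  If the vectors \<open>y\<^sub>i, x\<^sub>i\<close> form such decompositions of
  the boundary maps, the \<open>y\<^sub>i\<close> of finite bars of degree \<open>k - 1\<close> together with all \<open>x\<^sub>j\<close> of degree \<open>k\<close> form an
  orthogonal basis of the \<open>k\<close>-th chain space, on which the boundary operator just sends \<open>y\<^sub>i\<close> to
  \<open>x\<^sub>i\<close>.  Equal barcodes match such bases of the two complexes up to scalars \<open>T\<^sup>g\<close>, and the matching
  extends to a filtered isomorphism.

  Conversely, an isomorphism transports singular value decompositions, and it remains to see that
  the bars do not depend on the decomposition.  The \<open>x\<^sub>i\<close> with \<open>i < r\<close> are an orthogonal basis of the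
  image for two filtrations at once: the given one and the quotient filtration, which takes the value
  \<open>\<ell>(y\<^sub>i)\<close> at \<open>x\<^sub>i\<close>.  The number of \<open>x\<^sub>i\<close> with prescribed pair of values up to a common shift in \<open>\<Gamma>\<close>
  is the same for all common orthogonal bases (it is the dimension over the coefficient field of
  \<open>V\<^bsub>\<le>s,\<le>t\<^esub> / (V\<^bsub><s,\<le>t\<^esub> + V\<^bsub>\<le>s,<t\<^esub>)\<close>).
\<close>

text \<open>The barcode records pairs of levels. Two bases may agree in all first levels and in all
  second levels and still pair them differently, so dimensions taken for one filtration at a time
  are not enough. The quotient filtration moves the second level onto the image, where one family of
  vectors carries both numbers and can be compared with another family in the same space.
  Multiplying a vector by T^g shifts both numbers alike, which is why only a common shift is divided
  out. Two common bases are compared directly through leading coefficients, without forming a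
  quotient space: a surplus on one side yields a linear system over the coefficient field with more
  unknowns than equations. Infinite bars have no second level; they are counted as the difference
  between cycles and boundaries, using one filtration twice. In the converse direction one scalar
  T^g per finite bar has to correct two degrees at once: it is applied to both ends of the bar, and
  equality of the gaps makes the filtrations agree at both.\<close>

section \<open>Auxiliary facts on extended reals, disjoint sums and multisets\<close>

lemma finite_has_max_image:
  fixes w :: "'a \<Rightarrow> 'b::linorder"
  assumes "finite W" "W \<noteq> {}"
  obtains x where "x \<in> W" "\<And>y. y \<in> W \<Longrightarrow> w y \<le> w x"
proof -
  have "Max (w ` W) \<in> w ` W" using assms by (intro Max_in) auto
  then obtain x where "x \<in> W" "w x = Max (w ` W)" by auto
  then show thesis using that assms Max_ge[of "w ` W"] by auto
qed

text \<open>With \<open>min a b \<le> c\<close> read as the valuation inequality for a sum, this is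
  the ultrametric inequality for the terms \<open>lam i - val (a i)\<close> that make up filtration
  values.\<close>

lemma ereal_minus_le_max:
  fixes x :: real and a b c :: ereal
  assumes "min a b \<le> c"
  shows "ereal x - c \<le> max (ereal x - a) (ereal x - b)"
  using assms by (cases a; cases b; cases c) (auto simp: min_def max_def split: if_splits)

lemma ereal_minus_add_mono:
  fixes x y g :: real and a c :: ereal
  assumes "ereal x - a \<le> ereal (y - g)" "a \<noteq> -\<infinity>" "c \<noteq> -\<infinity>"
  shows "ereal x - (c + a) \<le> ereal (y - g) - c"
  using assms by (cases a; cases c) auto

lemma SUP_Plus: "(SUP i \<in> A <+> B. f i) = sup (SUP i\<in>A. f (Inl i)) (SUP j\<in>B. f (Inr j))"
  for f :: "'a + 'b \<Rightarrow> 'c::complete_lattice"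
  by (simp add: Plus_def SUP_union image_comp comp_def)

lemma bij_betw_map_sum:
  assumes "bij_betw f A A'" "bij_betw g B B'"
  shows "bij_betw (map_sum f g) (A <+> B) (A' <+> B')"
proof -
  have "inj_on (map_sum f g) (A <+> B)"
  proof (rule inj_onI)
    fix x y assume "x \<in> A <+> B" "y \<in> A <+> B" "map_sum f g x = map_sum f g y"
    then show "x = y"
      using bij_betw_imp_inj_on[OF assms(1)] bij_betw_imp_inj_on[OF assms(2)]
      by (cases x; cases y) (auto dest: inj_onD)
  qed
  moreover have "map_sum f g ` (A <+> B) = f ` A <+> g ` B"
    by (simp add: Plus_def image_Un image_image)
  ultimately show ?thesis using assms by (simp add: bij_betw_def)
qed

lemma image_mset_eq_imp_bij:
  fixes f g :: "nat \<Rightarrow> 'a"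
  assumes "image_mset f (mset_set {..<m}) = image_mset g (mset_set {..<n})"
  obtains \<sigma> where "bij_betw \<sigma> {..<m} {..<n}" "\<And>i. i < m \<Longrightarrow> f i = g (\<sigma> i)"
proof -
  have "mset (map f [0..<m]) = mset (map g [0..<n])"
    using assms by (simp add: mset_upt flip: atLeast0LessThan)
  then obtain \<sigma> where "bij_betw \<sigma> {..<length (map f [0..<m])} {..<length (map g [0..<n])}"
    "\<forall>i<length (map f [0..<m]). map f [0..<m] ! i = map g [0..<n] ! \<sigma> i"
    using permutation_Ex_bij by blast
  then have "bij_betw \<sigma> {..<m} {..<n}" "\<forall>i<m. f i = map g [0..<n] ! \<sigma> i" by auto
  moreover from this have "f i = g (\<sigma> i)" if "i < m" for i
    using that bij_betwE by fastforce
  ultimately show thesis using that by blast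
qed

lemma (in abelian_group) telescope_minus:
  assumes "a \<in> carrier G" "b \<in> carrier G" "c \<in> carrier G"
  shows "(a \<ominus> b) \<oplus> (c \<ominus> a) = c \<ominus> b"
proof -
  have "(a \<oplus> \<ominus> b) \<oplus> (c \<oplus> \<ominus> a) = (a \<oplus> \<ominus> a) \<oplus> (c \<oplus> \<ominus> b)"
    using assms by (simp add: a_ac)
  then show ?thesis using assms by (simp add: a_minus_def r_neg)
qed

section \<open>Linear combinations and linear maps\<close>

text \<open>Arbitrary index sets take the place of list positions, because bases get reindexed,
  restricted to subsets and joined along disjoint sums.\<close>

definition lc :: "('c, 'v, 'e) module_scheme \<Rightarrow> ('i \<Rightarrow> 'c) \<Rightarrow> ('i \<Rightarrow> 'v) \<Rightarrow> 'i set \<Rightarrow> 'v" where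
  "lc M a e I = (\<Oplus>\<^bsub>M\<^esub>i \<in> I. a i \<odot>\<^bsub>M\<^esub> e i)"

lemma lincomb_eq_lc: "lincomb R M a ws = lc M a ((!) ws) {..<length ws}"
  by (simp add: lincomb_def lc_def)

context module
begin

lemma lc_closed [intro, simp]:
  "\<lbrakk>a \<in> I \<rightarrow> carrier R; e \<in> I \<rightarrow> carrier M\<rbrakk> \<Longrightarrow> lc M a e I \<in> carrier M"
  unfolding lc_def by (intro M.finsum_closed) auto

lemma lc_cong:
  assumes "I = J" "b \<in> J \<rightarrow> carrier R" "f \<in> J \<rightarrow> carrier M"
    and "\<And>i. i \<in> J \<Longrightarrow> a i = b i" "\<And>i. i \<in> J \<Longrightarrow> e i = f i"
  shows "lc M a e I = lc M b f J"
  unfolding lc_def using assms by (intro M.finsum_cong') auto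

lemma lc_empty [simp]: "lc M a e {} = \<zero>\<^bsub>M\<^esub>"
  by (simp add: lc_def)

lemma lc_insert:
  "\<lbrakk>finite I; i \<notin> I; a i \<in> carrier R; e i \<in> carrier M; a \<in> I \<rightarrow> carrier R; e \<in> I \<rightarrow> carrier M\<rbrakk>
   \<Longrightarrow> lc M a e (insert i I) = a i \<odot>\<^bsub>M\<^esub> e i \<oplus>\<^bsub>M\<^esub> lc M a e I"
  unfolding lc_def by (intro M.finsum_insert) auto

lemma lc_add:
  "\<lbrakk>a \<in> I \<rightarrow> carrier R; b \<in> I \<rightarrow> carrier R; e \<in> I \<rightarrow> carrier M\<rbrakk>
   \<Longrightarrow> lc M (\<lambda>i. a i \<oplus> b i) e I = lc M a e I \<oplus>\<^bsub>M\<^esub> lc M b e I"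
  unfolding lc_def
  by (rule trans [OF _ M.finsum_addf], rule M.finsum_cong')
     (auto simp: smult_l_distr Pi_iff)

lemma lc_smult:
  "\<lbrakk>finite I; c \<in> carrier R; a \<in> I \<rightarrow> carrier R; e \<in> I \<rightarrow> carrier M\<rbrakk>
   \<Longrightarrow> lc M (\<lambda>i. c \<otimes> a i) e I = c \<odot>\<^bsub>M\<^esub> lc M a e I"
  unfolding lc_def
  by (subst finsum_smult_ldistr)
     (auto intro!: M.finsum_cong' simp: smult_assoc1 Pi_iff)

lemma lc_zero:
  "(\<And>i. i \<in> I \<Longrightarrow> a i = \<zero>) \<Longrightarrow> e \<in> I \<rightarrow> carrier M \<Longrightarrow> lc M a e I = \<zero>\<^bsub>M\<^esub>"
  unfolding lc_def by (intro M.add.finprod_one_eqI) (auto simp: Pi_iff)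

lemma lc_Un_disjoint:
  "\<lbrakk>finite I; finite J; I \<inter> J = {}; a \<in> I \<union> J \<rightarrow> carrier R; e \<in> I \<union> J \<rightarrow> carrier M\<rbrakk>
   \<Longrightarrow> lc M a e (I \<union> J) = lc M a e I \<oplus>\<^bsub>M\<^esub> lc M a e J"
  unfolding lc_def by (intro M.finsum_Un_disjoint) auto

lemma lc_mono_neutral:
  assumes "finite J" "I \<subseteq> J" "a \<in> J \<rightarrow> carrier R" "e \<in> J \<rightarrow> carrier M"
    and "\<And>i. i \<in> J - I \<Longrightarrow> a i = \<zero>"
  shows "lc M a e I = lc M a e J"
proof -
  have "lc M a e (I \<union> (J - I)) = lc M a e I \<oplus>\<^bsub>M\<^esub> lc M a e (J - I)"
    using assms by (intro lc_Un_disjoint) (auto intro: finite_subset)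
  moreover have "lc M a e (J - I) = \<zero>\<^bsub>M\<^esub>"
    using assms by (intro lc_zero) auto
  moreover have "I \<union> (J - I) = J" using assms by auto
  moreover have "lc M a e I \<in> carrier M" using assms by (intro lc_closed) auto
  ultimately show ?thesis by simp
qed

lemma lc_delta:
  assumes "finite I" "k \<in> I" "c \<in> carrier R" "e \<in> I \<rightarrow> carrier M"
  shows "lc M (\<lambda>i. if i = k then c else \<zero>) e I = c \<odot>\<^bsub>M\<^esub> e k"
proof -
  have "lc M (\<lambda>i. if i = k then c else \<zero>) e I = lc M (\<lambda>i. if i = k then c else \<zero>) e {k}"
    using assms by (intro lc_mono_neutral [symmetric]) auto
  also have "\<dots> = c \<odot>\<^bsub>M\<^esub> e k"
    using assms lc_insert [of "{}" k "\<lambda>i. if i = k then c else \<zero>" e] by (auto simp: Pi_iff)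
  finally show ?thesis .
qed

lemma lc_remove:
  assumes "finite I" "k \<in> I" "a \<in> I \<rightarrow> carrier R" "e \<in> I \<rightarrow> carrier M"
  shows "lc M a e I = a k \<odot>\<^bsub>M\<^esub> e k \<oplus>\<^bsub>M\<^esub> lc M a e (I - {k})"
proof -
  have "I = insert k (I - {k})" using assms by auto
  moreover have "lc M a e (insert k (I - {k})) = a k \<odot>\<^bsub>M\<^esub> e k \<oplus>\<^bsub>M\<^esub> lc M a e (I - {k})"
    using assms by (intro lc_insert) auto
  ultimately show ?thesis by simp
qed

lemma lc_reindex:
  assumes "inj_on h I" "a \<in> h ` I \<rightarrow> carrier R" "e \<in> h ` I \<rightarrow> carrier M"
  shows "lc M a e (h ` I) = lc M (a \<circ> h) (e \<circ> h) I"
  unfolding lc_def comp_def using assms by (intro M.finsum_reindex) (auto simp: Pi_iff)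

lemma lc_lc:
  assumes "finite J" "finite I" "c \<in> J \<rightarrow> carrier R" "e \<in> I \<rightarrow> carrier M"
    and "\<And>j. j \<in> J \<Longrightarrow> P j \<in> I \<rightarrow> carrier R"
  shows "lc M c (\<lambda>j. lc M (P j) e I) J = lc M (\<lambda>i. \<Oplus>j\<in>J. c j \<otimes> P j i) e I"
  using assms(1,3,5)
proof (induction J)
  case empty
  then show ?case using assms by (simp add: lc_zero)
next
  case (insert j J)
  have P: "\<And>i j'. i \<in> I \<Longrightarrow> j' \<in> insert j J \<Longrightarrow> c j' \<otimes> P j' i \<in> carrier R"
    using insert.prems by (auto simp: Pi_iff)
  have "lc M c (\<lambda>j. lc M (P j) e I) (insert j J)
      = c j \<odot>\<^bsub>M\<^esub> lc M (P j) e I \<oplus>\<^bsub>M\<^esub> lc M c (\<lambda>j. lc M (P j) e I) J"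
    using insert assms by (intro lc_insert) auto
  also have "\<dots> = lc M (\<lambda>i. c j \<otimes> P j i) e I \<oplus>\<^bsub>M\<^esub> lc M (\<lambda>i. \<Oplus>j\<in>J. c j \<otimes> P j i) e I"
    using insert assms by (subst lc_smult) auto
  also have "\<dots> = lc M (\<lambda>i. c j \<otimes> P j i \<oplus> (\<Oplus>j\<in>J. c j \<otimes> P j i)) e I"
    using P assms by (intro lc_add [symmetric]) (auto intro!: R.finsum_closed)
  also have "\<dots> = lc M (\<lambda>i. \<Oplus>j\<in>insert j J. c j \<otimes> P j i) e I"
    using P assms insert.hyps
    by (intro lc_cong) (auto simp: R.finsum_insert Pi_iff intro!: R.finsum_closed)
  finally show ?case .
qed

text \<open>Serves elimination: once a coordinate is cleared, the target vector belonging to it can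
  be replaced without touching the combination.\<close>

lemma lc_cong_support:
  assumes "a \<in> I \<rightarrow> carrier R" "f \<in> I \<rightarrow> carrier M" "e \<in> I \<rightarrow> carrier M"
    and "\<And>i. i \<in> I \<Longrightarrow> a i = \<zero> \<or> e i = f i"
  shows "lc M a e I = lc M a f I"
  unfolding lc_def
proof (rule M.finsum_cong')
  fix i assume "i \<in> I"
  then show "a i \<odot>\<^bsub>M\<^esub> e i = a i \<odot>\<^bsub>M\<^esub> f i"
    using assms(2,3) assms(4)[of i] by (cases "a i = \<zero>") (auto simp: Pi_iff)
qed (use assms in auto)

lemma lc_Plus:
  assumes "finite I" "finite J" "a \<in> I <+> J \<rightarrow> carrier R" "e \<in> I <+> J \<rightarrow> carrier M"
  shows "lc M a e (I <+> J)
    = lc M (\<lambda>i. a (Inl i)) (\<lambda>i. e (Inl i)) I \<oplus>\<^bsub>M\<^esub> lc M (\<lambda>j. a (Inr j)) (\<lambda>j. e (Inr j)) J"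
proof -
  have "lc M a e (Inl ` I \<union> Inr ` J) = lc M a e (Inl ` I) \<oplus>\<^bsub>M\<^esub> lc M a e (Inr ` J)"
    using assms by (intro lc_Un_disjoint) (auto simp: Plus_def)
  also have "lc M a e (Inl ` I) = lc M (a \<circ> Inl) (e \<circ> Inl) I"
    using assms by (intro lc_reindex) (auto simp: Plus_def)
  also have "lc M a e (Inr ` J) = lc M (a \<circ> Inr) (e \<circ> Inr) J"
    using assms by (intro lc_reindex) (auto simp: Plus_def)
  finally show ?thesis by (simp add: Plus_def comp_def)
qed

end

section \<open>Linear maps, and their kernels and images as modules\<close>

lemma linear_map_closed: "linear_map R M N A \<Longrightarrow> x \<in> carrier M \<Longrightarrow> A x \<in> carrier N"
  by (auto simp: linear_map_def hom_def)

lemma linear_map_lc: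
  assumes "Module.module R M" "Module.module R N" "linear_map R M N A"
    and "finite I" "a \<in> I \<rightarrow> carrier R" "e \<in> I \<rightarrow> carrier M"
  shows "A (lc M a e I) = lc N a (\<lambda>i. A (e i)) I"
proof -
  interpret M: Module.module R M by fact
  interpret N: Module.module R N by fact
  have add: "A (x \<oplus>\<^bsub>M\<^esub> y) = A x \<oplus>\<^bsub>N\<^esub> A y" if "x \<in> carrier M" "y \<in> carrier M" for x y
    using assms(3) that by (auto simp: linear_map_def hom_def)
  have smult: "A (c \<odot>\<^bsub>M\<^esub> x) = c \<odot>\<^bsub>N\<^esub> A x" if "c \<in> carrier R" "x \<in> carrier M" for c x
    using assms(3) that by (auto simp: linear_map_def)
  note closed = linear_map_closed[OF assms(3)]
  have "A \<zero>\<^bsub>M\<^esub> = A (\<zero>\<^bsub>R\<^esub> \<odot>\<^bsub>M\<^esub> \<zero>\<^bsub>M\<^esub>)" by simp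
  also have "\<dots> = \<zero>\<^bsub>N\<^esub>" by (subst smult) (auto simp: closed)
  finally have zero: "A \<zero>\<^bsub>M\<^esub> = \<zero>\<^bsub>N\<^esub>" .
  show ?thesis using assms(4-)
  proof (induction I)
    case empty
    then show ?case by (simp add: zero)
  next
    case (insert i I)
    have "A (lc M a e (insert i I)) = A (a i \<odot>\<^bsub>M\<^esub> e i \<oplus>\<^bsub>M\<^esub> lc M a e I)"
      using insert by (subst M.lc_insert) auto
    also have "\<dots> = a i \<odot>\<^bsub>N\<^esub> A (e i) \<oplus>\<^bsub>N\<^esub> lc N a (\<lambda>i. A (e i)) I"
      using insert by (subst add) (auto simp: smult)
    also have "\<dots> = lc N a (\<lambda>i. A (e i)) (insert i I)"
      using insert by (subst N.lc_insert) (auto intro: closed)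
    finally show ?case .
  qed
qed

lemma linear_map_zero:
  assumes "Module.module R M" "Module.module R N" "linear_map R M N A"
  shows "A \<zero>\<^bsub>M\<^esub> = \<zero>\<^bsub>N\<^esub>"
  using linear_map_lc[OF assms, of "{}"]
  by (simp add: module.lc_empty[OF assms(1)] module.lc_empty[OF assms(2)])

lemma linear_map_add:
  "linear_map R M N A \<Longrightarrow> x \<in> carrier M \<Longrightarrow> y \<in> carrier M \<Longrightarrow> A (x \<oplus>\<^bsub>M\<^esub> y) = A x \<oplus>\<^bsub>N\<^esub> A y"
  by (auto simp: linear_map_def hom_def)

lemma linear_map_smult:
  "linear_map R M N A \<Longrightarrow> c \<in> carrier R \<Longrightarrow> x \<in> carrier M \<Longrightarrow> A (c \<odot>\<^bsub>M\<^esub> x) = c \<odot>\<^bsub>N\<^esub> A x"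
  by (auto simp: linear_map_def)

lemma linear_mapI:
  assumes "\<And>x. x \<in> carrier M \<Longrightarrow> A x \<in> carrier N"
    and "\<And>x y. x \<in> carrier M \<Longrightarrow> y \<in> carrier M \<Longrightarrow> A (x \<oplus>\<^bsub>M\<^esub> y) = A x \<oplus>\<^bsub>N\<^esub> A y"
    and "\<And>c x. c \<in> carrier R \<Longrightarrow> x \<in> carrier M \<Longrightarrow> A (c \<odot>\<^bsub>M\<^esub> x) = c \<odot>\<^bsub>N\<^esub> A x"
  shows "linear_map R M N A"
  using assms by (auto simp: linear_map_def hom_def)

lemma
  assumes "Module.module R M" "submodule H R M" "finite I" "a \<in> I \<rightarrow> carrier R" "e \<in> I \<rightarrow> H"
  shows lc_submodule: "lc (M\<lparr>carrier := H\<rparr>) a e I = lc M a e I"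
    and lc_in_submodule: "lc M a e I \<in> H"
proof -
  interpret M: Module.module R M by fact
  let ?H = "M\<lparr>carrier := H\<rparr>"
  interpret H: Module.module R ?H
    using submodule.submodule_is_module[OF assms(2,1)] .
  have HM: "H \<subseteq> carrier M" using M.submoduleE(1)[OF assms(2)] .
  have "lc M a e I \<in> H \<and> lc ?H a e I = lc M a e I" using assms(3-)
  proof (induction I)
    case empty
    show ?case using H.zero_closed by (simp add: lc_def H.finsum_empty M.finsum_empty)
  next
    case (insert i I)
    then have IH: "lc M a e I \<in> H" "lc ?H a e I = lc M a e I" by auto
    have 1: "lc M a e (insert i I) = a i \<odot>\<^bsub>M\<^esub> e i \<oplus>\<^bsub>M\<^esub> lc M a e I"
      using insert HM by (intro M.lc_insert) auto
    have 2: "lc ?H a e (insert i I) = a i \<odot>\<^bsub>M\<^esub> e i \<oplus>\<^bsub>M\<^esub> lc M a e I"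
      using insert IH(2) by (subst H.lc_insert) auto
    have "a i \<odot>\<^bsub>M\<^esub> e i \<in> H" using H.smult_closed[of "a i" "e i"] insert by auto
    then show ?case using 1 2 H.a_closed[of "a i \<odot>\<^bsub>M\<^esub> e i" "lc M a e I"] IH by simp
  qed
  then show "lc ?H a e I = lc M a e I" "lc M a e I \<in> H" by auto
qed

lemma kernel_submodule:
  assumes M: "Module.module R M" and N: "Module.module R N" and A: "linear_map R M N A"
  shows "submodule {x \<in> carrier M. A x = \<zero>\<^bsub>N\<^esub>} R M"
proof -
  interpret M: Module.module R M by fact
  interpret N: Module.module R N by fact
  show ?thesis
  proof (rule M.submoduleI, goal_cases)
    case (3 x)
    have "\<ominus>\<^bsub>M\<^esub> x = (\<ominus>\<^bsub>R\<^esub> \<one>\<^bsub>R\<^esub>) \<odot>\<^bsub>M\<^esub> x" using 3 by (simp add: M.smult_l_minus)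
    then show ?case using 3 by (simp add: linear_map_smult[OF A])
  qed (auto simp: linear_map_zero[OF M N A] linear_map_add[OF A] linear_map_smult[OF A])
qed

lemma image_submodule:
  assumes M: "Module.module R M" and N: "Module.module R N" and A: "linear_map R M N A"
  shows "submodule (A ` carrier M) R N"
proof -
  interpret M: Module.module R M by fact
  interpret N: Module.module R N by fact
  show ?thesis
  proof (rule N.submoduleI, goal_cases)
    case 1
    then show ?case using linear_map_closed[OF A] by auto
  next
    case 2
    then show ?case using linear_map_zero[OF M N A] M.zero_closed by (metis imageI)
  next
    case (3 y)
    then obtain x where x: "x \<in> carrier M" "y = A x" by auto
    have "\<ominus>\<^bsub>N\<^esub> y = (\<ominus>\<^bsub>R\<^esub> \<one>\<^bsub>R\<^esub>) \<odot>\<^bsub>N\<^esub> y"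
      using x linear_map_closed[OF A] by (simp add: N.smult_l_minus)
    also have "\<dots> = A ((\<ominus>\<^bsub>R\<^esub> \<one>\<^bsub>R\<^esub>) \<odot>\<^bsub>M\<^esub> x)" using x by (simp add: linear_map_smult[OF A])
    finally show ?case using x by auto
  next
    case (4 a b)
    then obtain x y where "x \<in> carrier M" "a = A x" "y \<in> carrier M" "b = A y" by auto
    then show ?case using linear_map_add[OF A, of x y] by (metis M.a_closed imageI)
  next
    case (5 c y)
    then obtain x where "x \<in> carrier M" "y = A x" by auto
    then show ?case using linear_map_smult[OF A, of c x] 5 by (metis M.smult_closed imageI)
  qed
qed

lemma kernel_space_module:
  assumes "Module.module R M" "Module.module R N" "linear_map R M N A"
  shows "Module.module R (kernel_space M N A)"
  using submodule.submodule_is_module[OF kernel_submodule[OF assms] assms(1)]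
  by (simp add: kernel_space_def)

lemma image_space_module:
  assumes "Module.module R M" "Module.module R N" "linear_map R M N A"
  shows "Module.module R (image_space M N A)"
  using submodule.submodule_is_module[OF image_submodule[OF assms] assms(2)]
  by (simp add: image_space_def)

section \<open>Homogeneous linear systems with more unknowns than equations\<close>

text \<open>Gaussian elimination by induction on the equations: a zero row is dropped, any other row
  is solved for one unknown \<open>k\<close> and substituted into the rest. It serves over two
  fields, over \<Lambda> for the invariance of dimension and over the coefficient field for the
  count of bars.\<close>

lemma (in field) underdetermined_system:
  assumes "finite I" "finite J" "card I < card J"
    and "\<And>i j. i \<in> I \<Longrightarrow> j \<in> J \<Longrightarrow> p i j \<in> carrier R"
  shows "\<exists>c \<in> J \<rightarrow> carrier R. (\<exists>j\<in>J. c j \<noteq> \<zero>) \<and> (\<forall>i\<in>I. (\<Oplus>j\<in>J. p i j \<otimes> c j) = \<zero>)"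
  using assms
proof (induction I arbitrary: J p)
  case empty
  then have "J \<noteq> {}" by auto
  then show ?case
    by (intro bexI [of _ "\<lambda>_. \<one>"]) auto
next
  case (insert i I)
  show ?case
  proof (cases "\<forall>j\<in>J. p i j = \<zero>")
    case True
    have "\<exists>c \<in> J \<rightarrow> carrier R. (\<exists>j\<in>J. c j \<noteq> \<zero>) \<and> (\<forall>i\<in>I. (\<Oplus>j\<in>J. p i j \<otimes> c j) = \<zero>)"
      using insert.prems insert.hyps by (intro insert.IH) auto
    then obtain c where c: "c \<in> J \<rightarrow> carrier R" "\<exists>j\<in>J. c j \<noteq> \<zero>"
        "\<forall>i\<in>I. (\<Oplus>j\<in>J. p i j \<otimes> c j) = \<zero>" by blast
    have "(\<Oplus>j\<in>J. p i j \<otimes> c j) = \<zero>"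
      using True c(1) by (intro add.finprod_one_eqI) (auto simp: Pi_iff)
    then show ?thesis using c by (intro bexI [of _ c]) auto
  next
    case False
    then obtain k where k: "k \<in> J" "p i k \<noteq> \<zero>" by blast
    have pk: "p i k \<in> Units R" using k insert.prems by (auto simp: field_Units)
    \<comment> \<open>Multiplier that clears the entry of row \<open>i'\<close> in the pivot column;
      the reduced system \<open>p'\<close> lives on \<open>J - {k}\<close> because its column
      \<open>k\<close> vanishes.\<close>
    define q where "q = (\<lambda>i'. p i' k \<otimes> inv (p i k))"
    have qc: "q i' \<in> carrier R" if "i' \<in> insert i I" for i'
      unfolding q_def using that insert.prems k pk by auto
    define p' where "p' = (\<lambda>i' j. p i' j \<ominus> q i' \<otimes> p i j)"
    have "\<exists>c \<in> J - {k} \<rightarrow> carrier R. (\<exists>j\<in>J - {k}. c j \<noteq> \<zero>) \<and>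
             (\<forall>i'\<in>I. (\<Oplus>j\<in>J - {k}. p' i' j \<otimes> c j) = \<zero>)"
      using insert.prems insert.hyps k qc by (intro insert.IH) (auto simp: p'_def)
    then obtain c where c: "c \<in> J - {k} \<rightarrow> carrier R" "\<exists>j\<in>J - {k}. c j \<noteq> \<zero>"
        "\<forall>i'\<in>I. (\<Oplus>j\<in>J - {k}. p' i' j \<otimes> c j) = \<zero>" by blast
    define s where "s = (\<lambda>i'. \<Oplus>j\<in>J - {k}. p i' j \<otimes> c j)"
    define d where "d = c(k := \<ominus> (inv (p i k) \<otimes> s i))"
    have sc: "s i' \<in> carrier R" if "i' \<in> insert i I" for i'
      unfolding s_def using that c(1) insert.prems by (intro finsum_closed) (auto simp: Pi_iff)
    have dc: "d \<in> J \<rightarrow> carrier R"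
      using c(1) sc[of i] pk by (auto simp: d_def Pi_iff)
    \<comment> \<open>Back substitution: with \<open>d k\<close> solved from row \<open>i\<close>,
      every row of the full system takes the form of a reduced one. For row \<open>i\<close> itself
      the multiplier \<open>q i\<close> is one, so that row vanishes.\<close>
    have sum: "(\<Oplus>j\<in>J. p i' j \<otimes> d j) = s i' \<ominus> q i' \<otimes> s i" if i': "i' \<in> insert i I" for i'
    proof -
      have J: "J = insert k (J - {k})" using k by auto
      have "(\<Oplus>j\<in>insert k (J - {k}). p i' j \<otimes> d j)
          = p i' k \<otimes> d k \<oplus> (\<Oplus>j\<in>J - {k}. p i' j \<otimes> d j)"
        using i' insert.prems k dc by (intro finsum_insert) (auto simp: Pi_iff)
      also have "(\<Oplus>j\<in>J - {k}. p i' j \<otimes> d j) = s i'"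
        unfolding s_def using i' insert.prems c(1)
        by (intro finsum_cong') (auto simp: d_def Pi_iff)
      also have "p i' k \<otimes> d k \<oplus> s i' = s i' \<ominus> q i' \<otimes> s i"
        using i' insert.prems(3)[of i' k] k pk sc[of i] sc[OF i'] qc[OF i'] unfolding d_def q_def
        by (simp add: r_minus m_assoc minus_eq a_comm)
      finally show ?thesis using J by simp
    qed
    have "(\<Oplus>j\<in>J. p i' j \<otimes> d j) = \<zero>" if i': "i' \<in> insert i I" for i'
    proof (cases "i' = i")
      case True
      have "q i = \<one>" using pk by (simp add: q_def)
      then show ?thesis using sum[of i] sc[of i] True by (simp add: minus_eq r_neg)
    next
      case False
      then have "i' \<in> I" using i' by auto
      then have "\<zero> = (\<Oplus>j\<in>J - {k}. p' i' j \<otimes> c j)" using c by auto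
      also have "\<dots> = (\<Oplus>j\<in>J - {k}. p i' j \<otimes> c j \<oplus> (\<ominus> q i') \<otimes> (p i j \<otimes> c j))"
        using i' insert.prems(3) c(1) qc[OF i'] unfolding p'_def
        by (intro finsum_cong') (auto simp: Pi_iff minus_eq l_distr l_minus m_assoc)
      also have "\<dots> = s i' \<oplus> (\<Oplus>j\<in>J - {k}. (\<ominus> q i') \<otimes> (p i j \<otimes> c j))"
        unfolding s_def
        using i' insert.prems(3) c(1) qc[OF i'] by (intro finsum_addf) (auto simp: Pi_iff)
      also have "(\<Oplus>j\<in>J - {k}. (\<ominus> q i') \<otimes> (p i j \<otimes> c j)) = (\<ominus> q i') \<otimes> s i"
        unfolding s_def
        using i' insert.prems c(1) qc[OF i'] by (intro finsum_rdistr [symmetric]) (auto simp: Pi_iff)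
      also have "s i' \<oplus> (\<ominus> q i') \<otimes> s i = s i' \<ominus> q i' \<otimes> s i"
        using sc[OF i'] sc[of i] qc[OF i'] by (simp add: minus_eq l_minus)
      finally show ?thesis using sum[OF i'] by simp
    qed
    moreover have "\<exists>j\<in>J. d j \<noteq> \<zero>" using c(2) by (auto simp: d_def)
    ultimately show ?thesis using dc by blast
  qed
qed

section \<open>Orthogonal bases over a valued field\<close>

text \<open>Orthogonality and elimination use only a valuation on the scalars, so this half works
  over any valued field; formal sums return afterwards, in \<open>novikov_field\<close>.\<close>

locale valued_field = field R for R (structure) +
  fixes val :: "'a \<Rightarrow> ereal"
  assumes val_eq_PInf: "a \<in> carrier R \<Longrightarrow> val a = \<infinity> \<longleftrightarrow> a = \<zero>"
    and val_not_MInf: "a \<in> carrier R \<Longrightarrow> val a \<noteq> -\<infinity>"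
    and val_mult: "a \<in> carrier R \<Longrightarrow> b \<in> carrier R \<Longrightarrow> val (a \<otimes> b) = val a + val b"
    and val_add: "a \<in> carrier R \<Longrightarrow> b \<in> carrier R \<Longrightarrow> min (val a) (val b) \<le> val (a \<oplus> b)"
begin

lemma val_zero [simp]: "val \<zero> = \<infinity>"
  by (simp add: val_eq_PInf)

lemma val_finite: "a \<in> carrier R \<Longrightarrow> a \<noteq> \<zero> \<Longrightarrow> \<bar>val a\<bar> \<noteq> \<infinity>"
  using val_eq_PInf val_not_MInf by (auto simp: abs_eq_infinity_cases)

lemma val_real: "a \<in> carrier R \<Longrightarrow> a \<noteq> \<zero> \<Longrightarrow> \<exists>r. val a = ereal r"
  using val_finite by (metis ereal_real')

lemma val_one [simp]: "val \<one> = 0"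
proof -
  obtain r where "val \<one> = ereal r" using val_real[of \<one>] by auto
  moreover have "val \<one> = val \<one> + val \<one>" using val_mult[of \<one> \<one>] by simp
  ultimately show ?thesis by (simp add: zero_ereal_def)
qed

text \<open>Because minus one squares to one, twice its valuation is zero.\<close>

lemma val_minus [simp]:
  assumes "a \<in> carrier R" shows "val (\<ominus> a) = val a"
proof -
  have "(\<ominus> \<one>) \<otimes> (\<ominus> \<one>) = \<one>" by (simp add: l_minus r_minus)
  then have "val (\<ominus> \<one>) + val (\<ominus> \<one>) = 0" by (metis val_mult val_one add.inv_closed one_closed)
  then have "val (\<ominus> \<one>) = 0"
    by (cases "val (\<ominus> \<one>)") (auto simp: zero_ereal_def)
  moreover have "\<ominus> a = (\<ominus> \<one>) \<otimes> a" using assms by (simp add: l_minus)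
  ultimately show ?thesis using assms val_mult[of "\<ominus> \<one>" a] by simp
qed

lemma val_diff: "a \<in> carrier R \<Longrightarrow> b \<in> carrier R \<Longrightarrow> min (val a) (val b) \<le> val (a \<ominus> b)"
  using val_add[of a "\<ominus> b"] by (simp add: minus_eq)

lemma val_inv: 
  assumes "a \<in> carrier R" "a \<noteq> \<zero>"
  shows "val (inv a) = - val a"
proof -
  have a: "a \<in> Units R" using assms by (simp add: field_Units)
  then have "val a + val (inv a) = 0" using assms val_mult[of a "inv a"] by simp
  then show ?thesis using val_real[OF assms]
    by (cases "val (inv a)") (auto simp: zero_ereal_def)
qed

text \<open>
  \<open>lam i\<close> is the filtration of \<open>e i\<close>.  The last clause also forces linear independence, because
  \<open>-\<infinity>\<close> on the right-hand side means that all coefficients vanish.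
\<close>

definition obasis ::
    "('a, 'v, 'e) module_scheme \<Rightarrow> ('v \<Rightarrow> ereal) \<Rightarrow> ('i \<Rightarrow> 'v) \<Rightarrow> 'i set \<Rightarrow> ('i \<Rightarrow> real) \<Rightarrow> bool" where
  "obasis M l e I lam \<longleftrightarrow> finite I \<and> e \<in> I \<rightarrow> carrier M \<and>
     (\<forall>x \<in> carrier M. \<exists>a \<in> I \<rightarrow> carrier R. x = lc M a e I) \<and>
     (\<forall>a \<in> I \<rightarrow> carrier R. l (lc M a e I) = (SUP i \<in> I. ereal (lam i) - val (a i)))"

lemma
  assumes "obasis M l e I lam"
  shows obasis_finite: "finite I"
    and obasis_closed: "e \<in> I \<rightarrow> carrier M"
    and obasis_span: "x \<in> carrier M \<Longrightarrow> \<exists>a \<in> I \<rightarrow> carrier R. x = lc M a e I"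
    and obasis_norm: "a \<in> I \<rightarrow> carrier R \<Longrightarrow> l (lc M a e I) = (SUP i \<in> I. ereal (lam i) - val (a i))"
  using assms by (auto simp: obasis_def)

lemma obasis_term_le:
  assumes "obasis M l e I lam" "a \<in> I \<rightarrow> carrier R" "i \<in> I"
  shows "ereal (lam i) - val (a i) \<le> l (lc M a e I)"
  using assms by (auto simp: obasis_norm intro!: SUP_upper)

lemma obasis_independent:
  assumes "Module.module R M" "obasis M l e I lam" "a \<in> I \<rightarrow> carrier R" "lc M a e I = \<zero>\<^bsub>M\<^esub>" "i \<in> I"
  shows "a i = \<zero>"
proof -
  interpret M: Module.module R M by fact
  have "lc M (\<lambda>_. \<zero>) e I = \<zero>\<^bsub>M\<^esub>"
    using assms by (intro M.lc_zero) (auto dest: obasis_closed)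
  then have "l \<zero>\<^bsub>M\<^esub> = (SUP i \<in> I. ereal (lam i) - val \<zero>)"
    using obasis_norm[OF assms(2), of "\<lambda>_. \<zero>"] by simp
  also have "\<dots> \<le> -\<infinity>" by (intro SUP_least) simp
  finally have "ereal (lam i) - val (a i) \<le> -\<infinity>"
    using obasis_term_le[OF assms(2,3,5)] assms(4) by simp
  then have "val (a i) = \<infinity>" by (cases "val (a i)") auto
  then show ?thesis using assms val_eq_PInf[of "a i"] by auto
qed

lemma obasis_unique:
  assumes M: "Module.module R M" and e: "obasis M l e I lam"
    and a: "a \<in> I \<rightarrow> carrier R" and b: "b \<in> I \<rightarrow> carrier R"
    and eq: "lc M a e I = lc M b e I" and i: "i \<in> I"
  shows "a i = b i"
proof -
  interpret M: Module.module R M by fact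
  note ec = obasis_closed[OF e] and fin = obasis_finite[OF e]
  have "lc M (\<lambda>i. a i \<oplus> (\<ominus> \<one>) \<otimes> b i) e I = lc M a e I \<oplus>\<^bsub>M\<^esub> (\<ominus> \<one>) \<odot>\<^bsub>M\<^esub> lc M b e I"
    using a b ec fin by (subst M.lc_add) (auto simp: M.lc_smult Pi_iff)
  also have "\<dots> = \<zero>\<^bsub>M\<^esub>"
    using eq a b ec by (simp add: M.smult_l_minus M.r_neg)
  finally have "a i \<oplus> (\<ominus> \<one>) \<otimes> b i = \<zero>"
    using a b i by (intro obasis_independent[OF M e, where a = "\<lambda>i. a i \<oplus> (\<ominus> \<one>) \<otimes> b i"]) auto
  moreover have "a i \<in> carrier R" "b i \<in> carrier R" using a b i by auto
  ultimately have "a i \<ominus> b i = \<zero>" by (simp add: l_minus minus_eq)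
  then show ?thesis using \<open>a i \<in> carrier R\<close> \<open>b i \<in> carrier R\<close> by (metis a_minus_def add.inv_closed minus_equality minus_minus r_neg)
qed

lemma obasis_norm_smult:
  assumes M: "Module.module R M" and e: "obasis M l e I lam" and "i \<in> I" "c \<in> carrier R"
  shows "l (c \<odot>\<^bsub>M\<^esub> e i) = ereal (lam i) - val c"
proof -
  interpret M: Module.module R M by fact
  let ?a = "\<lambda>j. if j = i then c else \<zero>"
  have "l (c \<odot>\<^bsub>M\<^esub> e i) = l (lc M ?a e I)"
    using assms obasis_closed[OF e] obasis_finite[OF e] by (subst M.lc_delta) auto
  also have "\<dots> = (SUP j\<in>I. ereal (lam j) - val (?a j))"
    using assms by (intro obasis_norm) auto
  also have "\<dots> = ereal (lam i) - val c"
    using assms by (intro antisym SUP_least SUP_upper2[of i]) auto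
  finally show ?thesis .
qed

lemma obasis_norm_basis:
  assumes "Module.module R M" "obasis M l e I lam" "i \<in> I"
  shows "l (e i) = ereal (lam i)"
proof -
  interpret M: Module.module R M by fact
  have "e i \<in> carrier M" using obasis_closed[OF assms(2)] assms(3) by auto
  then show ?thesis using obasis_norm_smult[OF assms one_closed] by (simp add: zero_ereal_def)
qed

section \<open>Changes of basis that preserve orthogonality\<close>

text \<open>The vector put in place of \<open>e k\<close> has its filtration attained by its
  \<open>k\<close>-th term, as \<open>dom\<close> says. Hence whatever this vector adds along
  another \<open>e i\<close> is at most what it contributes at \<open>k\<close>, and the maximum
  over old coordinates and the maximum over new ones bound each other. The new level
  \<open>lam k - g\<close> is the filtration of that \<open>k\<close>-th term.\<close>

lemma obasis_replace:
  assumes M: "Module.module R M" and e: "obasis M l e I lam" and k: "k \<in> I"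
    and a: "a \<in> I \<rightarrow> carrier R" and g: "val (a k) = ereal g"
    and dom: "\<And>i. i \<in> I \<Longrightarrow> ereal (lam i) - val (a i) \<le> ereal (lam k) - val (a k)"
  shows "obasis M l (e(k := lc M a e I)) I (lam(k := lam k - g))"
proof -
  interpret M: Module.module R M by fact
  note ec = obasis_closed[OF e] and fin = obasis_finite[OF e]
  let ?e = "e(k := lc M a e I)" and ?lam = "lam(k := lam k - g)"
  have ak: "a k \<noteq> \<zero>" "a k \<in> carrier R" "a k \<in> Units R"
    using g a k by (auto simp: field_Units)
  have wc: "lc M a e I \<in> carrier M" using a ec by auto
  have ec': "?e \<in> I \<rightarrow> carrier M" using ec wc by auto
  \<comment> \<open>Old coordinates of the vector whose coordinates in the new basis are
    \<open>b\<close>. The change is triangular, with the invertible entry \<open>a k\<close> on the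
    diagonal at \<open>k\<close>.\<close>
  define tr where "tr = (\<lambda>b i. b k \<otimes> a i \<oplus> (if i = k then \<zero> else b i))"
  have trc: "tr b \<in> I \<rightarrow> carrier R" if "b \<in> I \<rightarrow> carrier R" for b
    using that a k by (auto simp: tr_def Pi_iff)
  have lc: "lc M b ?e I = lc M (tr b) e I" if b: "b \<in> I \<rightarrow> carrier R" for b
  proof -
    have "lc M b ?e I = b k \<odot>\<^bsub>M\<^esub> lc M a e I \<oplus>\<^bsub>M\<^esub> lc M b ?e (I - {k})"
      using M.lc_remove[OF fin k b ec'] by simp
    also have "lc M b ?e (I - {k}) = lc M (\<lambda>i. if i = k then \<zero> else b i) e (I - {k})"
      using b ec by (intro M.lc_cong) (auto simp: Pi_iff)
    also have "\<dots> = lc M (\<lambda>i. if i = k then \<zero> else b i) e I"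
      using fin b ec by (intro M.lc_mono_neutral) (auto simp: Pi_iff)
    also have "b k \<odot>\<^bsub>M\<^esub> lc M a e I = lc M (\<lambda>i. b k \<otimes> a i) e I"
      using fin b k a ec by (intro M.lc_smult [symmetric]) auto
    also have "lc M (\<lambda>i. b k \<otimes> a i) e I \<oplus>\<^bsub>M\<^esub> lc M (\<lambda>i. if i = k then \<zero> else b i) e I
        = lc M (tr b) e I"
      unfolding tr_def using b k a ec by (intro M.lc_add [symmetric]) (auto simp: Pi_iff)
    finally show ?thesis .
  qed
  have norm: "l (lc M b ?e I) = (SUP i \<in> I. ereal (?lam i) - val (b i))" if b: "b \<in> I \<rightarrow> carrier R" for b
  proof -
    have bk: "b k \<in> carrier R" using b k by auto
    have at_k: "ereal (lam k) - val (tr b k) = ereal (?lam k) - val (b k)"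
      using bk ak g val_not_MInf[of "b k"] unfolding tr_def
      by (cases "val (b k)") (auto simp: val_mult)
    \<comment> \<open>The spill of the new vector along \<open>e i\<close> never exceeds its own
      term; this is \<open>dom\<close>, shifted by the valuation of \<open>b k\<close>.\<close>
    have cross: "ereal (lam i) - val (b k \<otimes> a i) \<le> ereal (?lam k) - val (b k)" if i: "i \<in> I" for i
    proof -
      have ai: "a i \<in> carrier R" using a i by auto
      have "ereal (lam i) - val (a i) \<le> ereal (lam k - g)" using dom[OF i] g by simp
      then have "ereal (lam i) - (val (b k) + val (a i)) \<le> ereal (lam k - g) - val (b k)"
        using bk ai by (intro ereal_minus_add_mono) (auto simp: val_not_MInf)
      then show ?thesis using bk ai by (simp add: val_mult)
    qed
    have "(SUP i \<in> I. ereal (lam i) - val (tr b i)) = (SUP i \<in> I. ereal (?lam i) - val (b i))"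
    proof (intro antisym SUP_least)
      fix i assume i: "i \<in> I"
      have ai: "a i \<in> carrier R" and bi: "b i \<in> carrier R" using a b i by auto
      show "ereal (lam i) - val (tr b i) \<le> (SUP i \<in> I. ereal (?lam i) - val (b i))"
      proof (cases "i = k")
        case True
        then show ?thesis using at_k k by (intro SUP_upper2[of k]) auto
      next
        case False
        have "ereal (lam i) - val (tr b i)
            \<le> max (ereal (lam i) - val (b k \<otimes> a i)) (ereal (lam i) - val (b i))"
          unfolding tr_def using False ai bi bk by (intro ereal_minus_le_max) (auto intro: val_add)
        also have "\<dots> \<le> max (ereal (?lam k) - val (b k)) (ereal (?lam i) - val (b i))"
          using cross[OF i] False by (intro max.mono) auto
        also have "\<dots> \<le> (SUP i \<in> I. ereal (?lam i) - val (b i))"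
          using i k by (intro max.boundedI SUP_upper)
        finally show ?thesis .
      qed
      show "ereal (?lam i) - val (b i) \<le> (SUP i \<in> I. ereal (lam i) - val (tr b i))"
      proof (cases "i = k")
        case True
        then show ?thesis using at_k k by (intro SUP_upper2[of k]) auto
      next
        case False
        have "b i = tr b i \<ominus> b k \<otimes> a i"
          using False ai bi bk by (simp add: tr_def minus_eq a_comm a_lcomm r_neg)
        moreover have "min (val (tr b i)) (val (b k \<otimes> a i)) \<le> val (tr b i \<ominus> b k \<otimes> a i)"
          using trc[OF b] i ai bk by (intro val_diff) auto
        ultimately have "ereal (lam i) - val (b i)
            \<le> max (ereal (lam i) - val (tr b i)) (ereal (lam i) - val (b k \<otimes> a i))"
          by (intro ereal_minus_le_max) simp
        also have "\<dots> \<le> max (ereal (lam i) - val (tr b i)) (ereal (lam k) - val (tr b k))"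
          using cross[OF i] at_k by (intro max.mono) auto
        also have "\<dots> \<le> (SUP i \<in> I. ereal (lam i) - val (tr b i))"
          using i k by (intro max.boundedI SUP_upper)
        finally show ?thesis using False by simp
      qed
    qed
    then show ?thesis using lc[OF b] obasis_norm[OF e trc[OF b]] by simp
  qed
  have span: "\<exists>b \<in> I \<rightarrow> carrier R. x = lc M b ?e I" if x: "x \<in> carrier M" for x
  proof -
    obtain c where c: "c \<in> I \<rightarrow> carrier R" "x = lc M c e I" using obasis_span[OF e x] by auto
    \<comment> \<open>Inverse of \<open>tr\<close>: divide by the pivot at \<open>k\<close>, then
      subtract the spill elsewhere.\<close>
    define b where "b = (\<lambda>i. if i = k then c k \<otimes> inv (a k) else c i \<ominus> c k \<otimes> inv (a k) \<otimes> a i)"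
    have b: "b \<in> I \<rightarrow> carrier R" using c(1) ak a k by (auto simp: b_def Pi_iff)
    have "tr b i = c i" if i: "i \<in> I" for i
    proof -
      have "a i \<in> carrier R" "c i \<in> carrier R" "c k \<in> carrier R" using a c i k by auto
      then show ?thesis using ak
        by (auto simp: tr_def b_def m_assoc minus_eq a_lcomm r_neg)
    qed
    then have "lc M (tr b) e I = lc M c e I" using c ec by (intro M.lc_cong) auto
    then show ?thesis using lc[OF b] b c by (intro bexI [of _ b]) simp_all
  qed
  show ?thesis using fin ec' norm span by (auto simp: obasis_def)
qed

text \<open>Each change is an instance of \<open>obasis_replace\<close> with leading coefficient
  one, so no level moves. The vector \<open>e k\<close> stays fixed as \<open>k\<close> is outside
  \<open>T\<close>, which lets the changes be made one after another.\<close>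

lemma obasis_shear:
  assumes M: "Module.module R M" and e: "obasis M l e I lam" and k: "k \<in> I"
    and T: "T \<subseteq> I - {k}" and c: "c \<in> T \<rightarrow> carrier R"
    and dom: "\<And>i. i \<in> T \<Longrightarrow> ereal (lam k) - val (c i) \<le> ereal (lam i)"
  shows "obasis M l (\<lambda>i. if i \<in> T then e i \<oplus>\<^bsub>M\<^esub> c i \<odot>\<^bsub>M\<^esub> e k else e i) I lam"
proof -
  interpret M: Module.module R M by fact
  have ec: "\<And>i. i \<in> I \<Longrightarrow> e i \<in> carrier M" and fin: "finite I"
    using obasis_closed[OF e] obasis_finite[OF e] by auto
  have "finite T" using T fin finite_subset by blast
  then show ?thesis using T c dom
  proof (induction T)
    case empty
    then show ?case using e by simp
  next
    case (insert j T)
    let ?e = "\<lambda>i. if i \<in> T then e i \<oplus>\<^bsub>M\<^esub> c i \<odot>\<^bsub>M\<^esub> e k else e i"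
    let ?a = "\<lambda>i. (if i = j then \<one> else \<zero>) \<oplus> (if i = k then c j else \<zero>)"
    have IH: "obasis M l ?e I lam" using insert by auto
    have j: "j \<in> I" "j \<noteq> k" "c j \<in> carrier R" "j \<notin> T" "k \<notin> T" using insert by auto
    have "obasis M l (?e(j := lc M ?a ?e I)) I (lam(j := lam j - 0))"
    proof (rule obasis_replace[OF M IH j(1)])
      fix i assume "i \<in> I"
      then show "ereal (lam i) - val (?a i) \<le> ereal (lam j) - val (?a j)"
        using j insert.prems(3)[of j] by (auto simp: zero_ereal_def)
    qed (use j in \<open>auto simp: zero_ereal_def\<close>)
    also have "lc M ?a ?e I = lc M (\<lambda>i. if i = j then \<one> else \<zero>) ?e I
        \<oplus>\<^bsub>M\<^esub> lc M (\<lambda>i. if i = k then c j else \<zero>) ?e I"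
      using j obasis_closed[OF IH] by (intro M.lc_add) auto
    also have "\<dots> = e j \<oplus>\<^bsub>M\<^esub> c j \<odot>\<^bsub>M\<^esub> e k"
      using j ec obasis_closed[OF IH] fin k by (simp add: M.lc_delta)
    also have "?e(j := e j \<oplus>\<^bsub>M\<^esub> c j \<odot>\<^bsub>M\<^esub> e k)
        = (\<lambda>i. if i \<in> insert j T then e i \<oplus>\<^bsub>M\<^esub> c i \<odot>\<^bsub>M\<^esub> e k else e i)"
      by auto
    finally show ?case by simp
  qed
qed

lemma obasis_reindex:
  assumes M: "Module.module R M" and e: "obasis M l e I lam" and h: "bij_betw h J I"
  shows "obasis M l (\<lambda>j. e (h j)) J (\<lambda>j. lam (h j))"
proof -
  interpret M: Module.module R M by fact
  note ec = obasis_closed[OF e] and fin = obasis_finite[OF e]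
  have finJ: "finite J" using fin h bij_betw_finite by blast
  have hJ: "h ` J = I" and inj: "inj_on h J" using h by (auto simp: bij_betw_def)
  have push: "lc M a (\<lambda>j. e (h j)) J = lc M (\<lambda>i. a (the_inv_into J h i)) e I"
    if a: "a \<in> J \<rightarrow> carrier R" for a
  proof -
    have inv: "\<And>i. i \<in> I \<Longrightarrow> the_inv_into J h i \<in> J"
      using h hJ inj by (metis order_refl the_inv_into_into)
    have "lc M (\<lambda>i. a (the_inv_into J h i)) e (h ` J)
        = lc M ((\<lambda>i. a (the_inv_into J h i)) \<circ> h) (e \<circ> h) J"
      using inj inv a ec hJ by (intro M.lc_reindex) auto
    also have "\<dots> = lc M a (\<lambda>j. e (h j)) J"
      using a ec hJ inj by (intro M.lc_cong) (auto simp: the_inv_into_f_f)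
    finally show ?thesis using hJ by simp
  qed
  have "\<exists>a \<in> J \<rightarrow> carrier R. x = lc M a (\<lambda>j. e (h j)) J" if x: "x \<in> carrier M" for x
  proof -
    obtain b where b: "b \<in> I \<rightarrow> carrier R" "x = lc M b e I" using obasis_span[OF e x] by auto
    have "lc M b e (h ` J) = lc M (b \<circ> h) (e \<circ> h) J"
      using inj b ec hJ by (intro M.lc_reindex) auto
    then show ?thesis using b hJ by (intro bexI[of _ "b \<circ> h"]) (auto simp: comp_def)
  qed
  moreover have "l (lc M a (\<lambda>j. e (h j)) J) = (SUP j\<in>J. ereal (lam (h j)) - val (a j))"
    if a: "a \<in> J \<rightarrow> carrier R" for a
  proof -
    have inv: "\<And>i. i \<in> I \<Longrightarrow> the_inv_into J h i \<in> J"
      using h hJ inj by (metis order_refl the_inv_into_into)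
    have "l (lc M a (\<lambda>j. e (h j)) J)
        = (SUP i\<in>h ` J. ereal (lam i) - val (a (the_inv_into J h i)))"
      unfolding push[OF a] hJ using a inv by (intro obasis_norm[OF e]) auto
    also have "\<dots> = (SUP j\<in>J. ereal (lam (h j)) - val (a j))"
      unfolding image_comp using inj by (intro SUP_cong) (auto simp: the_inv_into_f_f)
    finally show ?thesis .
  qed
  moreover have "(\<lambda>j. e (h j)) \<in> J \<rightarrow> carrier M" using ec hJ by auto
  ultimately show ?thesis using finJ by (auto simp: obasis_def)
qed

text \<open>Meant for powers of T: they move a level inside its class modulo \<Gamma>, and so
  realise the freedom that the barcode leaves.\<close>

lemma obasis_scale:
  assumes M: "Module.module R M" and e: "obasis M l e I lam"
    and u: "\<And>i. i \<in> I \<Longrightarrow> u i \<in> carrier R" and g: "\<And>i. i \<in> I \<Longrightarrow> val (u i) = ereal (g i)"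
  shows "obasis M l (\<lambda>i. u i \<odot>\<^bsub>M\<^esub> e i) I (\<lambda>i. lam i - g i)"
proof -
  interpret M: Module.module R M by fact
  note ec = obasis_closed[OF e] and fin = obasis_finite[OF e]
  have u0: "u i \<noteq> \<zero>" "u i \<in> Units R" if "i \<in> I" for i
    using g[OF that] u[OF that] by (auto simp: field_Units)
  have push: "lc M a (\<lambda>i. u i \<odot>\<^bsub>M\<^esub> e i) I = lc M (\<lambda>i. a i \<otimes> u i) e I"
    if "a \<in> I \<rightarrow> carrier R" for a
    unfolding lc_def using that u ec by (intro M.finsum_cong') (auto simp: M.smult_assoc1 Pi_iff)
  have "\<exists>a \<in> I \<rightarrow> carrier R. x = lc M a (\<lambda>i. u i \<odot>\<^bsub>M\<^esub> e i) I" if x: "x \<in> carrier M" for x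
  proof -
    obtain b where b: "b \<in> I \<rightarrow> carrier R" "x = lc M b e I" using obasis_span[OF e x] by auto
    have a: "(\<lambda>i. b i \<otimes> inv (u i)) \<in> I \<rightarrow> carrier R" using b u0 by auto
    have "lc M (\<lambda>i. (b i \<otimes> inv (u i)) \<otimes> u i) e I = lc M b e I"
      using b ec u0 u by (intro M.lc_cong) (auto simp: m_assoc Pi_iff)
    then show ?thesis using a b push[OF a] by (intro bexI[of _ "\<lambda>i. b i \<otimes> inv (u i)"]) simp_all
  qed
  moreover have "l (lc M a (\<lambda>i. u i \<odot>\<^bsub>M\<^esub> e i) I) = (SUP i\<in>I. ereal (lam i - g i) - val (a i))"
    if a: "a \<in> I \<rightarrow> carrier R" for a
  proof -
    have "l (lc M a (\<lambda>i. u i \<odot>\<^bsub>M\<^esub> e i) I) = (SUP i\<in>I. ereal (lam i) - val (a i \<otimes> u i))"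
      unfolding push[OF a] using a u by (intro obasis_norm[OF e]) auto
    also have "\<dots> = (SUP i\<in>I. ereal (lam i - g i) - val (a i))"
    proof (intro SUP_cong refl)
      fix i assume i: "i \<in> I"
      then have "a i \<in> carrier R" using a by auto
      then show "ereal (lam i) - val (a i \<otimes> u i) = ereal (lam i - g i) - val (a i)"
        using i u g val_not_MInf[of "a i"] by (cases "val (a i)") (auto simp: val_mult)
    qed
    finally show ?thesis .
  qed
  moreover have "(\<lambda>i. u i \<odot>\<^bsub>M\<^esub> e i) \<in> I \<rightarrow> carrier M" using ec u by auto
  ultimately show ?thesis using fin by (auto simp: obasis_def)
qed

lemma obasis_cong:
  assumes M: "Module.module R M" and e: "obasis M l e I lam"
    and eq: "\<And>i. i \<in> I \<Longrightarrow> e' i = e i" "\<And>i. i \<in> I \<Longrightarrow> lam' i = lam i"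
  shows "obasis M l e' I lam'"
proof -
  interpret M: Module.module R M by fact
  have "lc M a e' I = lc M a e I" if "a \<in> I \<rightarrow> carrier R" for a
    using that obasis_closed[OF e] eq by (intro M.lc_cong) auto
  moreover have "(SUP i\<in>I. ereal (lam' i) - val (a i)) = (SUP i\<in>I. ereal (lam i) - val (a i))" for a
    using eq by (intro SUP_cong) auto
  moreover have "e' \<in> I \<rightarrow> carrier M" using obasis_closed[OF e] eq by auto
  ultimately show ?thesis using e by (auto simp: obasis_def)
qed

section \<open>Gaussian elimination that respects filtrations\<close>

text \<open>Loop invariant of the elimination. On \<open>S\<close> the map already has its final
  form, and the images of the remaining vectors avoid the target vectors used so far, so the next
  pivot cannot disturb finished pairs. Besides \<open>S\<close> and \<open>s\<close> only
  \<open>e\<close>, \<open>f\<close> and \<open>mu\<close> change between rounds; the source levels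
  \<open>lam\<close> are kept.\<close>

definition eliminated ::
    "('a, 'v, 'e) module_scheme \<Rightarrow> ('v \<Rightarrow> ereal) \<Rightarrow> ('a, 'w, 'f) module_scheme \<Rightarrow> ('w \<Rightarrow> ereal) \<Rightarrow>
     ('v \<Rightarrow> 'w) \<Rightarrow> 'i set \<Rightarrow> 'j set \<Rightarrow> ('i \<Rightarrow> 'v) \<Rightarrow> ('i \<Rightarrow> real) \<Rightarrow> ('j \<Rightarrow> 'w) \<Rightarrow> ('j \<Rightarrow> real) \<Rightarrow>
     'i set \<Rightarrow> ('i \<Rightarrow> 'j) \<Rightarrow> bool" where
  "eliminated M l N l' A I J e lam f mu S s \<longleftrightarrow>
     obasis M l e I lam \<and> obasis N l' f J mu \<and> S \<subseteq> I \<and> inj_on s S \<and> s ` S \<subseteq> J \<and>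
     (\<forall>i\<in>S. A (e i) = f (s i)) \<and>
     (\<forall>i\<in>I - S. \<exists>a \<in> J \<rightarrow> carrier R. A (e i) = lc N a f J \<and> (\<forall>j\<in>s ` S. a j = \<zero>))"

text \<open>
  The pivot is chosen where \<open>A\<close> decreases the filtration least; this makes both the row
  and the column operation preserve orthogonality.
\<close>

lemma elimination_step:
  assumes M: "Module.module R M" and N: "Module.module R N" and A: "linear_map R M N A"
    and st: "eliminated M l N l' A I J e lam f mu S s"
    and nz: "\<exists>i\<in>I - S. A (e i) \<noteq> \<zero>\<^bsub>N\<^esub>"
  shows "\<exists>e' f' mu' k s'. k \<in> I - S \<and> eliminated M l N l' A I J e' lam f' mu' (insert k S) s'"
proof -
  interpret M: Module.module R M by fact
  interpret N: Module.module R N by fact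
  from st have e: "obasis M l e I lam" and f: "obasis N l' f J mu" and SI: "S \<subseteq> I"
    and inj: "inj_on s S" and sJ: "s ` S \<subseteq> J" and AS: "\<And>i. i \<in> S \<Longrightarrow> A (e i) = f (s i)"
    and ex: "\<And>i. i \<in> I - S \<Longrightarrow> \<exists>a \<in> J \<rightarrow> carrier R. A (e i) = lc N a f J \<and> (\<forall>j\<in>s ` S. a j = \<zero>)"
    by (auto simp: eliminated_def)
  note ec = obasis_closed[OF e] and finI = obasis_finite[OF e]
    and fc = obasis_closed[OF f] and finJ = obasis_finite[OF f]
  obtain a where a: "\<And>i. i \<in> I - S \<Longrightarrow> a i \<in> J \<rightarrow> carrier R"
    "\<And>i. i \<in> I - S \<Longrightarrow> A (e i) = lc N (a i) f J"
    "\<And>i j. i \<in> I - S \<Longrightarrow> j \<in> s ` S \<Longrightarrow> a i j = \<zero>"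
    using ex by metis
  have ac: "a i j \<in> carrier R" if "i \<in> I - S" "j \<in> J" for i j using a(1) that by auto
  define W where "W = {(i, j). i \<in> I - S \<and> j \<in> J \<and> a i j \<noteq> \<zero>}"
  \<comment> \<open>Level of the term at \<open>f j\<close> in \<open>A (e i)\<close> minus the
    level of \<open>e i\<close>. The maximum runs over the whole matrix because \<open>dom\<close>
    is used in two directions: over all \<open>i\<close> at fixed \<open>p\<close> for the changes
    of source vectors, and over all \<open>j\<close> at fixed \<open>k\<close> for the replacement
    of \<open>f p\<close>.\<close>
  define w where "w = (\<lambda>(i, j). mu j - lam i - real_of_ereal (val (a i j)))"
  have "W \<subseteq> I \<times> J" by (auto simp: W_def)
  then have finW: "finite W" using finI finJ finite_subset by blast
  have "W \<noteq> {}"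
  proof
    assume "W = {}"
    then have "A (e i) = \<zero>\<^bsub>N\<^esub>" if "i \<in> I - S" for i
      unfolding a(2)[OF that] using that fc \<open>W = {}\<close> by (intro N.lc_zero) (auto simp: W_def)
    then show False using nz by auto
  qed
  then obtain x where x: "x \<in> W" "\<And>y. y \<in> W \<Longrightarrow> w y \<le> w x"
    using finite_has_max_image[OF finW] by blast
  obtain k p where kp: "x = (k, p)" by force
  have k: "k \<in> I" "k \<notin> S" and p: "p \<in> J" and akp: "a k p \<noteq> \<zero>" using x kp by (auto simp: W_def)
  have pS: "p \<notin> s ` S" using a(3)[of k p] akp k by auto
  obtain g where g: "val (a k p) = ereal g" using val_real[OF ac akp] k p by auto
  have akU: "a k p \<in> Units R" using akp ac k p by (auto simp: field_Units)
  have dom: "ereal (mu j - lam i) - val (a i j) \<le> ereal (mu p - lam k - g)"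
    if i: "i \<in> I - S" and j: "j \<in> J" for i j
  proof (cases "a i j = \<zero>")
    case False
    then have "w (i, j) \<le> w (k, p)" using x kp i j by (auto simp: W_def)
    moreover obtain r where "val (a i j) = ereal r" using val_real[OF ac False] i j by auto
    ultimately show ?thesis using g by (simp add: w_def)
  qed simp
  define c where "c = (\<lambda>i. \<ominus> (a i p \<otimes> inv (a k p)))"
  define T where "T = I - S - {k}"
  have cc: "c \<in> T \<rightarrow> carrier R" using ac p akU by (auto simp: c_def T_def)
  define e' where "e' = (\<lambda>i. if i \<in> T then e i \<oplus>\<^bsub>M\<^esub> c i \<odot>\<^bsub>M\<^esub> e k else e i)"
  have e': "obasis M l e' I lam"
    unfolding e'_def
  proof (rule obasis_shear[OF M e k(1) _ cc])
    fix i assume "i \<in> T"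
    then have i: "i \<in> I - S" by (auto simp: T_def)
    have "val (c i) = val (a i p) + - ereal g"
      using ac[OF i p] akU akp ac[of k p] k p g by (simp add: c_def val_mult val_inv)
    then show "ereal (lam k) - val (c i) \<le> ereal (lam i)"
      using dom[OF i p] by (cases "val (a i p)") auto
  qed (auto simp: T_def)
  define f' where "f' = f(p := lc N (a k) f J)"
  define mu' where "mu' = mu(p := mu p - g)"
  have f': "obasis N l' f' J mu'"
    unfolding f'_def mu'_def
  proof (rule obasis_replace[where a = "a k", OF N f p _ g])
    show "a k \<in> J \<rightarrow> carrier R" using a k by auto
    fix j assume "j \<in> J"
    then show "ereal (mu j) - val (a k j) \<le> ereal (mu p) - val (a k p)"
      using dom[of k j] k g by (cases "val (a k j)") auto
  qed
  have fc': "f' \<in> J \<rightarrow> carrier N" using obasis_closed[OF f'] .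
  define s' where "s' = s(k := p)"
  have inj': "inj_on s' (insert k S)" using inj k pS by (auto simp: s'_def inj_on_def)
  have s'J: "s' ` insert k S \<subseteq> J" using sJ p by (auto simp: s'_def)
  have eq1: "A (e' i) = f' (s' i)" if "i \<in> insert k S" for i
    using that AS pS k a(2)[of k] by (auto simp: e'_def f'_def s'_def T_def)
  have eq2: "\<exists>b \<in> J \<rightarrow> carrier R. A (e' i) = lc N b f' J \<and> (\<forall>j\<in>s' ` insert k S. b j = \<zero>)"
    if i: "i \<in> I - insert k S" for i
  proof (intro bexI conjI)
    let ?b = "\<lambda>j. a i j \<oplus> c i \<otimes> a k j"
    have iT: "i \<in> T" and iS: "i \<in> I - S" and kS: "k \<in> I - S" using i k by (auto simp: T_def)
    have ci: "c i \<in> carrier R" using cc iT by auto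
    show b: "?b \<in> J \<rightarrow> carrier R" using ac[OF iS] ac[OF kS] ci by auto
    \<comment> \<open>The multiplier \<open>c i\<close> cancels the coordinate at the pivot, so
      passing from \<open>f\<close> to \<open>f'\<close>, which differ only at \<open>p\<close>,
      leaves the combination unchanged.\<close>
    have bp: "?b p = \<zero>"
      using ac[OF iS p] ac[OF kS p] akU by (simp add: c_def m_assoc l_minus r_neg)
    have "A (e' i) = A (e i) \<oplus>\<^bsub>N\<^esub> c i \<odot>\<^bsub>N\<^esub> A (e k)"
      using iT iS kS ec ci by (simp add: e'_def linear_map_add[OF A] linear_map_smult[OF A] Pi_iff)
    also have "\<dots> = lc N ?b f J"
      using a(1,2)[OF iS] a(1,2)[OF kS] ci finJ fc
      by (subst N.lc_add) (auto simp: N.lc_smult Pi_iff)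
    also have "\<dots> = lc N ?b f' J"
      using b fc fc' bp by (intro N.lc_cong_support) (auto simp: f'_def)
    finally show "A (e' i) = lc N ?b f' J" .
    show "\<forall>j\<in>s' ` insert k S. ?b j = \<zero>"
      using bp a(3)[OF iS] a(3)[OF kS] ci by (auto simp: s'_def)
  qed
  have "eliminated M l N l' A I J e' lam f' mu' (insert k S) s'"
    unfolding eliminated_def using e' f' SI k inj' s'J eq1 eq2 by auto
  then show ?thesis using k by blast
qed

lemma elimination:
  assumes M: "Module.module R M" and N: "Module.module R N" and A: "linear_map R M N A"
    and "eliminated M l N l' A I J e lam f mu S s"
  shows "\<exists>e f mu S s. eliminated M l N l' A I J e lam f mu S s \<and> (\<forall>i\<in>I - S. A (e i) = \<zero>\<^bsub>N\<^esub>)"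
  using assms(4)
proof (induction "card (I - S)" arbitrary: e f mu S s rule: less_induct)
  case less
  show ?case
  proof (cases "\<forall>i\<in>I - S. A (e i) = \<zero>\<^bsub>N\<^esub>")
    case True
    then show ?thesis using less.prems by blast
  next
    case False
    then obtain e' f' mu' k s' where k: "k \<in> I - S"
      and st: "eliminated M l N l' A I J e' lam f' mu' (insert k S) s'"
      using elimination_step[OF M N A less.prems] by blast
    have "finite I" using less.prems by (auto simp: eliminated_def dest: obasis_finite)
    then have "card (I - insert k S) < card (I - S)" using k by (intro psubset_card_mono) auto
    then show ?thesis using less.hyps st by blast
  qed
qed

section \<open>Invariance of dimension, and the passage between lists and indexed bases\<close>

text \<open>In coordinates, a dependence among the \<open>w j\<close> is a solution of a homogeneous
  system with one equation per element of \<open>I\<close>; if \<open>J\<close> had more elements, a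
  nonzero solution would exist.\<close>

lemma card_independent_le_card_spanning:
  assumes M: "Module.module R M" and fin: "finite I" "finite J"
    and e: "e \<in> I \<rightarrow> carrier M" and span: "\<And>j. j \<in> J \<Longrightarrow> \<exists>a \<in> I \<rightarrow> carrier R. w j = lc M a e I"
    and indep: "\<And>c. c \<in> J \<rightarrow> carrier R \<Longrightarrow> lc M c w J = \<zero>\<^bsub>M\<^esub> \<Longrightarrow> \<forall>j\<in>J. c j = \<zero>"
  shows "card J \<le> card I"
proof (rule ccontr)
  interpret M: Module.module R M by fact
  assume "\<not> card J \<le> card I"
  then have less: "card I < card J" by simp
  obtain P where P: "\<And>j. j \<in> J \<Longrightarrow> P j \<in> I \<rightarrow> carrier R" "\<And>j. j \<in> J \<Longrightarrow> w j = lc M (P j) e I"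
    using span by metis
  have "\<exists>c \<in> J \<rightarrow> carrier R. (\<exists>j\<in>J. c j \<noteq> \<zero>) \<and> (\<forall>i\<in>I. (\<Oplus>j\<in>J. P j i \<otimes> c j) = \<zero>)"
    using P by (intro underdetermined_system fin less) auto
  then obtain c where c: "c \<in> J \<rightarrow> carrier R" "\<exists>j\<in>J. c j \<noteq> \<zero>" 
      "\<And>i. i \<in> I \<Longrightarrow> (\<Oplus>j\<in>J. P j i \<otimes> c j) = \<zero>" by blast
  have "lc M c w J = lc M c (\<lambda>j. lc M (P j) e I) J"
    using c P e by (intro M.lc_cong) auto
  also have "\<dots> = lc M (\<lambda>i. \<Oplus>j\<in>J. c j \<otimes> P j i) e I"
    using c P e fin by (intro M.lc_lc) auto
  also have "\<dots> = \<zero>\<^bsub>M\<^esub>"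
  proof (rule M.lc_zero[OF _ e])
    fix i assume i: "i \<in> I"
    have "(\<Oplus>j\<in>J. c j \<otimes> P j i) = (\<Oplus>j\<in>J. P j i \<otimes> c j)"
      using c P i by (intro finsum_cong') (auto simp: m_comm Pi_iff)
    then show "(\<Oplus>j\<in>J. c j \<otimes> P j i) = \<zero>" using c i by simp
  qed
  finally show False using indep[OF c(1)] c(2) by auto
qed

text \<open>Justifies the \<open>THE\<close> in \<open>vs_dim\<close>, and with it every computation
  of \<open>map_rank\<close>.\<close>

lemma vs_dim_eq:
  assumes M: "Module.module R M" and ws: "ordered_basis R M ws"
  shows "vs_dim R M = length ws"
proof -
  have le: "length us \<le> length vs" if "ordered_basis R M us" "ordered_basis R M vs" for us vs
  proof -
    have "card {..<length us} \<le> card {..<length vs}"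
    proof (rule card_independent_le_card_spanning[OF M, of _ _ "(!) vs" "(!) us"])
      show "(!) vs \<in> {..<length vs} \<rightarrow> carrier M"
        using that(2) by (auto simp: ordered_basis_def)
      show "\<exists>a\<in>{..<length vs} \<rightarrow> carrier R. us ! j = lc M a ((!) vs) {..<length vs}"
        if "j \<in> {..<length us}" for j
      proof -
        have "us ! j \<in> carrier M"
          using that \<open>ordered_basis R M us\<close> by (auto simp: ordered_basis_def)
        then show ?thesis using \<open>ordered_basis R M vs\<close> by (auto simp: ordered_basis_def lincomb_eq_lc)
      qed
      show "\<forall>j\<in>{..<length us}. c j = \<zero>"
        if "c \<in> {..<length us} \<rightarrow> carrier R" "lc M c ((!) us) {..<length us} = \<zero>\<^bsub>M\<^esub>" for c
        using that \<open>ordered_basis R M us\<close> by (auto simp: ordered_basis_def lincomb_eq_lc)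
    qed auto
    then show ?thesis by simp
  qed
  show ?thesis unfolding vs_dim_def
    using ws le by (intro the_equality) (auto intro!: antisym)
qed

definition normed_module :: "('a, 'v, 'e) module_scheme \<Rightarrow> ('v \<Rightarrow> ereal) \<Rightarrow> bool" where
  "normed_module M l \<longleftrightarrow> Module.module R M \<and> (\<forall>x \<in> carrier M. l x \<noteq> \<infinity>) \<and>
     (\<forall>x \<in> carrier M. l x = -\<infinity> \<longleftrightarrow> x = \<zero>\<^bsub>M\<^esub>) \<and>
     (\<forall>c \<in> carrier R. \<forall>x \<in> carrier M. l (c \<odot>\<^bsub>M\<^esub> x) = l x - val c)"

lemma normed_module_kernel:
  assumes "normed_module M l" "Module.module R N" "linear_map R M N A"
  shows "normed_module (kernel_space M N A) l"
  using assms kernel_space_module[of R M N A] by (auto simp: normed_module_def kernel_space_def)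

lemma normed_module_real:
  "normed_module M l \<Longrightarrow> x \<in> carrier M \<Longrightarrow> x \<noteq> \<zero>\<^bsub>M\<^esub> \<Longrightarrow> ereal (real_of_ereal (l x)) = l x"
  by (cases "l x") (auto simp: normed_module_def)

text \<open>A zero vector in the list would contradict independence; hence all levels are real, and
  the scaling axiom turns the terms of the supremum into level minus valuation.\<close>

lemma orthogonal_basis_imp_obasis:
  assumes l: "normed_module M l" and ws: "orthogonal_basis R M l ws"
  shows "obasis M l ((!) ws) {..<length ws} (\<lambda>i. real_of_ereal (l (ws ! i)))"
proof -
  let ?I = "{..<length ws}"
  have "Module.module R M" using l by (simp add: normed_module_def)
  then interpret M: Module.module R M .
  have wsc: "ws ! i \<in> carrier M" if "i < length ws" for i
    using ws that by (auto simp: orthogonal_basis_def ordered_basis_def)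
  have ws0: "ws ! i \<noteq> \<zero>\<^bsub>M\<^esub>" if i: "i < length ws" for i
  proof
    assume "ws ! i = \<zero>\<^bsub>M\<^esub>"
    then have "lc M (\<lambda>j. if j = i then \<one> else \<zero>) ((!) ws) ?I = \<zero>\<^bsub>M\<^esub>"
      using i wsc by (subst M.lc_delta) auto
    moreover have "\<forall>a \<in> ?I \<rightarrow> carrier R. lc M a ((!) ws) ?I = \<zero>\<^bsub>M\<^esub> \<longrightarrow> (\<forall>j < length ws. a j = \<zero>)"
      using ws unfolding orthogonal_basis_def ordered_basis_def lincomb_eq_lc by blast
    ultimately have "\<forall>j < length ws. (if j = i then \<one> else \<zero>) = \<zero>"
      by (elim ballE[where x = "\<lambda>j. if j = i then \<one> else \<zero>"]) auto
    then show False using i by auto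
  qed
  have "l (lc M a ((!) ws) ?I) = (SUP i \<in> ?I. ereal (real_of_ereal (l (ws ! i))) - val (a i))"
    if a: "a \<in> ?I \<rightarrow> carrier R" for a
  proof -
    have "l (lc M a ((!) ws) ?I) = (SUP i \<in> ?I. l (a i \<odot>\<^bsub>M\<^esub> ws ! i))"
      using ws a by (auto simp: orthogonal_basis_def orthogonal_list_def lincomb_eq_lc)
    also have "\<dots> = (SUP i \<in> ?I. ereal (real_of_ereal (l (ws ! i))) - val (a i))"
      using a wsc ws0 l
      by (intro SUP_cong refl) (auto simp: normed_module_real normed_module_def Pi_iff)
    finally show ?thesis .
  qed
  then show ?thesis
    using ws wsc unfolding obasis_def orthogonal_basis_def ordered_basis_def lincomb_eq_lc by auto
qed

lemma obasis_imp_orthogonal_basis: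
  assumes M: "Module.module R M" and ws: "obasis M l ((!) ws) {..<length ws} lam"
  shows "orthogonal_basis R M l ws"
proof -
  have "set ws \<subseteq> carrier M"
    using obasis_closed[OF ws] by (auto simp: in_set_conv_nth)
  moreover have "(SUP i \<in> {..<length ws}. ereal (lam i) - val (a i))
      = (SUP i \<in> {..<length ws}. l (a i \<odot>\<^bsub>M\<^esub> ws ! i))" if "a \<in> {..<length ws} \<rightarrow> carrier R" for a
    using that by (intro SUP_cong refl obasis_norm_smult[OF M ws, symmetric]) auto
  ultimately show ?thesis
    using obasis_span[OF ws] obasis_independent[OF M ws] obasis_norm[OF ws]
    by (auto simp: orthogonal_basis_def ordered_basis_def orthogonal_list_def lincomb_eq_lc)
qed

section \<open>Singular value decompositions\<close>

text \<open>A decomposition without the ordering of the gaps and without the clauses on kernel and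
  image; the latter are recovered in \<open>obasis_kernel\<close> and \<open>obasis_image\<close>.
  The number \<open>r\<close> is a parameter, so that ranks have to be computed only in the passage
  from and to \<open>is_svd\<close>.\<close>

definition singular_bases ::
    "('a, 'v, 'e) module_scheme \<Rightarrow> ('v \<Rightarrow> ereal) \<Rightarrow> ('a, 'w, 'f) module_scheme \<Rightarrow> ('w \<Rightarrow> ereal) \<Rightarrow>
     ('v \<Rightarrow> 'w) \<Rightarrow> nat \<Rightarrow> nat \<Rightarrow> (nat \<Rightarrow> 'v) \<Rightarrow> (nat \<Rightarrow> real) \<Rightarrow> nat \<Rightarrow> (nat \<Rightarrow> 'w) \<Rightarrow> (nat \<Rightarrow> real) \<Rightarrow> bool"
  where
  "singular_bases M lM N lN A r n y mu m x lam \<longleftrightarrow>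
     obasis M lM y {..<n} mu \<and> obasis N lN x {..<m} lam \<and> r \<le> n \<and> r \<le> m \<and>
     (\<forall>i<r. A (y i) = x i) \<and> (\<forall>i. r \<le> i \<and> i < n \<longrightarrow> A (y i) = \<zero>\<^bsub>N\<^esub>)"

lemma obasis_image_formula:
  assumes M: "Module.module R M" and N: "Module.module R N" and A: "linear_map R M N A"
    and sb: "singular_bases M lM N lN A r n y mu m x lam"
    and a: "a \<in> {..<n} \<rightarrow> carrier R"
  shows "A (lc M a y {..<n}) = lc N a x {..<r}"
proof -
  interpret N: Module.module R N by fact
  from sb have y: "obasis M lM y {..<n} mu" and x: "obasis N lN x {..<m} lam" and rn: "r \<le> n" "r \<le> m"
    and Ay: "\<And>i. i < r \<Longrightarrow> A (y i) = x i" "\<And>i. r \<le> i \<Longrightarrow> i < n \<Longrightarrow> A (y i) = \<zero>\<^bsub>N\<^esub>"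
    by (auto simp: singular_bases_def)
  have yc: "y i \<in> carrier M" if "i < n" for i using obasis_closed[OF y] that by auto
  have Ayc: "A (y i) \<in> carrier N" if "i < n" for i using yc[OF that] linear_map_closed[OF A] by auto
  have *: "{..<n} = {..<r} \<union> {r..<n}" "{..<r} \<inter> {r..<n} = {}" using rn by auto
  have "A (lc M a y {..<n}) = lc N a (\<lambda>i. A (y i)) {..<n}"
    using a yc by (intro linear_map_lc[OF M N A]) auto
  also have "\<dots> = lc N a (\<lambda>i. A (y i)) {..<r} \<oplus>\<^bsub>N\<^esub> lc N a (\<lambda>i. A (y i)) {r..<n}"
    unfolding *(1) using *(2) a Ayc rn by (intro N.lc_Un_disjoint) auto
  also have "lc N a (\<lambda>i. A (y i)) {r..<n} = \<zero>\<^bsub>N\<^esub>"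
    unfolding lc_def using Ay a by (intro N.add.finprod_one_eqI) (auto simp: Pi_iff)
  also have "lc N a (\<lambda>i. A (y i)) {..<r} = lc N a x {..<r}"
    using a obasis_closed[OF x] rn Ay by (intro N.lc_cong) auto
  also have "lc N a x {..<r} \<oplus>\<^bsub>N\<^esub> \<zero>\<^bsub>N\<^esub> = lc N a x {..<r}"
    using a obasis_closed[OF x] rn by (intro N.r_zero N.lc_closed) auto
  finally show ?thesis .
qed

text \<open>Extending coefficients by zero adds only terms -\<infinity> to the supremum, so the
  maximum formula is inherited by the span of any part of the basis.\<close>

lemma obasis_subset:
  assumes M: "Module.module R M" and H: "submodule H R M" and e: "obasis M l e I lam"
    and JI: "J \<subseteq> I" and eH: "e \<in> J \<rightarrow> H"
    and span: "\<And>x. x \<in> H \<Longrightarrow> \<exists>a \<in> J \<rightarrow> carrier R. x = lc M a e J"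
  shows "obasis (M\<lparr>carrier := H\<rparr>) l e J lam"
proof -
  interpret M: Module.module R M by fact
  note ec = obasis_closed[OF e] and finI = obasis_finite[OF e]
  have finJ: "finite J" using JI finI finite_subset by blast
  have "l (lc M a e J) = (SUP i\<in>J. ereal (lam i) - val (a i))" if a: "a \<in> J \<rightarrow> carrier R" for a
  proof -
    let ?a = "\<lambda>i. if i \<in> J then a i else \<zero>"
    have "lc M a e J = lc M ?a e J" using a ec JI by (intro M.lc_cong) auto
    also have "\<dots> = lc M ?a e I" using finI JI a ec by (intro M.lc_mono_neutral) auto
    also have "l \<dots> = (SUP i\<in>I. ereal (lam i) - val (?a i))"
      using a by (intro obasis_norm[OF e]) auto
    also have "\<dots> = (SUP i\<in>J. ereal (lam i) - val (a i))"
    proof (intro antisym SUP_least)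
      fix i assume "i \<in> I"
      then show "ereal (lam i) - val (?a i) \<le> (SUP i\<in>J. ereal (lam i) - val (a i))"
        by (cases "i \<in> J") (auto intro: SUP_upper)
    next
      fix i assume "i \<in> J"
      then show "ereal (lam i) - val (a i) \<le> (SUP i\<in>I. ereal (lam i) - val (?a i))"
        using JI by (intro SUP_upper2[of i]) auto
    qed
    finally show ?thesis .
  qed
  then show ?thesis using finJ eH span
    unfolding obasis_def by (simp add: lc_submodule[OF M H finJ _ eH])
qed

text \<open>The image of a vector involves only the independent \<open>x i\<close> with
  \<open>i < r\<close>, with the vector's own coordinates as coefficients; if the image is zero,
  those coordinates vanish.\<close>

lemma obasis_kernel:
  assumes M: "Module.module R M" and N: "Module.module R N" and A: "linear_map R M N A"
    and sb: "singular_bases M lM N lN A r n y mu m x lam"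
  shows "obasis (kernel_space M N A) lM y {r..<n} mu"
proof -
  interpret M: Module.module R M by fact
  interpret N: Module.module R N by fact
  from sb have y: "obasis M lM y {..<n} mu" and x: "obasis N lN x {..<m} lam" and rn: "r \<le> n" "r \<le> m"
    and Ay: "\<And>i. r \<le> i \<Longrightarrow> i < n \<Longrightarrow> A (y i) = \<zero>\<^bsub>N\<^esub>"
    by (auto simp: singular_bases_def)
  have "\<exists>a \<in> {r..<n} \<rightarrow> carrier R. v = lc M a y {r..<n}"
    if v: "v \<in> carrier M" "A v = \<zero>\<^bsub>N\<^esub>" for v
  proof -
    obtain a where a: "a \<in> {..<n} \<rightarrow> carrier R" "v = lc M a y {..<n}" using obasis_span[OF y v(1)] by auto
    let ?a = "\<lambda>i. if i < r then a i else \<zero>"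
    have "lc N ?a x {..<m} = lc N ?a x {..<r}"
      using rn a(1) obasis_closed[OF x] by (intro N.lc_mono_neutral [symmetric]) (auto simp: Pi_iff)
    also have "\<dots> = lc N a x {..<r}"
      using rn a(1) obasis_closed[OF x] by (intro N.lc_cong) (auto simp: Pi_iff)
    also have "\<dots> = \<zero>\<^bsub>N\<^esub>" using obasis_image_formula[OF M N A sb a(1)] a v by simp
    finally have "?a i = \<zero>" if "i < m" for i
      using that a(1) rn by (intro obasis_independent[OF N x, where a = ?a and i = i]) (auto simp: Pi_iff)
    then have a0: "a i = \<zero>" if "i < r" for i using that rn by (metis order_less_le_trans)
    have "lc M a y {r..<n} = lc M a y {..<n}"
      using a(1) a0 obasis_closed[OF y] by (intro M.lc_mono_neutral) auto
    then show ?thesis using a by (intro bexI[of _ a]) auto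
  qed
  then show ?thesis unfolding kernel_space_def
    using obasis_closed[OF y] Ay
    by (intro obasis_subset[OF M kernel_submodule[OF M N A] y]) auto
qed

lemma obasis_image:
  assumes M: "Module.module R M" and N: "Module.module R N" and A: "linear_map R M N A"
    and sb: "singular_bases M lM N lN A r n y mu m x lam"
  shows "obasis (image_space M N A) lN x {..<r} lam"
proof -
  from sb have y: "obasis M lM y {..<n} mu" and x: "obasis N lN x {..<m} lam" and rn: "r \<le> n" "r \<le> m"
    and Ay: "\<And>i. i < r \<Longrightarrow> A (y i) = x i"
    by (auto simp: singular_bases_def)
  show ?thesis unfolding image_space_def
  proof (rule obasis_subset[OF N image_submodule[OF M N A] x])
    show "x \<in> {..<r} \<rightarrow> A ` carrier M"
    proof
      fix i assume "i \<in> {..<r}"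
      then have "x i = A (y i)" "y i \<in> carrier M" using Ay obasis_closed[OF y] rn by auto
      then show "x i \<in> A ` carrier M" by (rule image_eqI)
    qed
    fix v assume "v \<in> A ` carrier M"
    then obtain u where u: "u \<in> carrier M" "v = A u" by auto
    obtain a where a: "a \<in> {..<n} \<rightarrow> carrier R" "u = lc M a y {..<n}" using obasis_span[OF y u(1)] by auto
    then show "\<exists>a \<in> {..<r} \<rightarrow> carrier R. v = lc N a x {..<r}"
      using u rn obasis_image_formula[OF M N A sb a(1)] by (intro bexI[of _ a]) auto
  qed (use rn in auto)
qed

lemma obasis_imp_orthogonal_basis_map:
  assumes M: "Module.module R M" and e: "obasis M l e I lam" and L: "distinct L" "set L = I"
  shows "orthogonal_basis R M l (map e L)"
proof -
  have "obasis M l (\<lambda>j. e (L ! j)) {..<length L} (\<lambda>j. lam (L ! j))"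
    using L by (intro obasis_reindex[OF M e]) (auto intro: bij_betw_nth)
  then have "obasis M l ((!) (map e L)) {..<length (map e L)} (\<lambda>j. lam (L ! j))"
    unfolding length_map by (rule obasis_cong[OF M]) auto
  then show ?thesis by (rule obasis_imp_orthogonal_basis[OF M])
qed

text \<open>The lengths are the point at issue, since \<open>take\<close> and \<open>drop\<close>
  truncate silently. The rank is at most the length of \<open>xs\<close> because the truncated list
  is a basis of a space of exactly that dimension. It is at most the length of \<open>ys\<close>
  because the images of the members of \<open>ys\<close> span the image, which contains that many
  independent vectors.\<close>

lemma is_svd_imp_singular_bases:
  assumes lM: "normed_module M lM" and lN: "normed_module N lN" and A: "linear_map R M N A"
    and svd: "is_svd R M lM N lN A ys xs"
  shows "singular_bases M lM N lN A (map_rank R M N A)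
           (length ys) ((!) ys) (\<lambda>i. real_of_ereal (lM (ys ! i)))
           (length xs) ((!) xs) (\<lambda>i. real_of_ereal (lN (xs ! i)))"
proof -
  have M: "Module.module R M" and N: "Module.module R N" using lM lN by (auto simp: normed_module_def)
  interpret M: Module.module R M by fact
  interpret N: Module.module R N by fact
  let ?r = "map_rank R M N A"
  from svd have ys: "orthogonal_basis R M lM ys" and xs: "orthogonal_basis R N lN xs"
    and ker: "orthogonal_basis R (kernel_space M N A) lM (drop ?r ys)"
    and im: "orthogonal_basis R (image_space M N A) lN (take ?r xs)"
    and Ay: "\<And>i. i < ?r \<Longrightarrow> A (ys ! i) = xs ! i"
    by (auto simp: is_svd_def Let_def)
  note imM = image_space_module[OF M N A]
  have im': "ordered_basis R (image_space M N A) (take ?r xs)"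
    using im by (simp add: orthogonal_basis_def)
  have "length (take ?r xs) = ?r"
    unfolding map_rank_def[of R M N A] using vs_dim_eq[OF imM im'] by (simp add: map_rank_def)
  then have rm: "?r \<le> length xs" by simp
  have yso: "obasis M lM ((!) ys) {..<length ys} (\<lambda>i. real_of_ereal (lM (ys ! i)))"
    by (rule orthogonal_basis_imp_obasis[OF lM ys])
  have xso: "obasis N lN ((!) xs) {..<length xs} (\<lambda>i. real_of_ereal (lN (xs ! i)))"
    by (rule orthogonal_basis_imp_obasis[OF lN xs])
  have xc: "xs ! i \<in> carrier N" if "i < length xs" for i using obasis_closed[OF xso] that by auto
  have yc: "ys ! i \<in> carrier M" if "i < length ys" for i using obasis_closed[OF yso] that by auto
  have "card {..<?r} \<le> card {..<length ys}"
  proof (rule card_independent_le_card_spanning[OF N, of _ _ "\<lambda>i. A (ys ! i)" "(!) xs"])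
    show "(\<lambda>i. A (ys ! i)) \<in> {..<length ys} \<rightarrow> carrier N"
      using yc linear_map_closed[OF A] by auto
    fix j assume j: "j \<in> {..<?r}"
    have "xs ! j \<in> set (take ?r xs)" using j rm by (auto simp: in_set_conv_nth intro!: exI[of _ j])
    then have "xs ! j \<in> A ` carrier M"
      using im' by (auto simp: ordered_basis_def image_space_def)
    then obtain u where u: "u \<in> carrier M" "xs ! j = A u" by auto
    obtain a where a: "a \<in> {..<length ys} \<rightarrow> carrier R" "u = lc M a ((!) ys) {..<length ys}"
      using obasis_span[OF yso u(1)] by auto
    then show "\<exists>a\<in>{..<length ys} \<rightarrow> carrier R. xs ! j = lc N a (\<lambda>i. A (ys ! i)) {..<length ys}"
      using u yc by (intro bexI[of _ a]) (auto simp: linear_map_lc[OF M N A])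
  next
    fix c assume c: "c \<in> {..<?r} \<rightarrow> carrier R" "lc N c ((!) xs) {..<?r} = \<zero>\<^bsub>N\<^esub>"
    let ?c = "\<lambda>i. if i < ?r then c i else \<zero>"
    have "lc N ?c ((!) xs) {..<length xs} = lc N ?c ((!) xs) {..<?r}"
      using c rm xc by (intro N.lc_mono_neutral[symmetric]) (auto simp: Pi_iff)
    also have "\<dots> = lc N c ((!) xs) {..<?r}"
      using c rm xc by (intro N.lc_cong) (auto simp: Pi_iff)
    finally have "?c j = \<zero>" if "j < length xs" for j
      using that c by (intro obasis_independent[OF N xso, where a = ?c and i = j]) (auto simp: Pi_iff)
    then show "\<forall>j\<in>{..<?r}. c j = \<zero>" using rm by (metis lessThan_iff order_less_le_trans)
  qed auto
  then have rn: "?r \<le> length ys" by simp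
  have "A (ys ! i) = \<zero>\<^bsub>N\<^esub>" if "?r \<le> i" "i < length ys" for i
  proof -
    have "ys ! i \<in> set (drop ?r ys)"
      using that by (auto simp: in_set_conv_nth intro!: exI[of _ "i - ?r"])
    then show ?thesis using ker by (auto simp: orthogonal_basis_def ordered_basis_def kernel_space_def)
  qed
  then show ?thesis using yso xso rm rn Ay by (auto simp: singular_bases_def)
qed

lemma singular_bases_imp_is_svd:
  assumes M: "Module.module R M" and N: "Module.module R N" and A: "linear_map R M N A"
    and sb: "singular_bases M lM N lN A r (length ys) ((!) ys) mu (length xs) ((!) xs) lam"
    and ord: "\<And>i j. i \<le> j \<Longrightarrow> j < r \<Longrightarrow> mu j - lam j \<le> mu i - lam i"
  shows "is_svd R M lM N lN A ys xs"
proof -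
  from sb have y: "obasis M lM ((!) ys) {..<length ys} mu" and x: "obasis N lN ((!) xs) {..<length xs} lam"
    and rn: "r \<le> length ys" "r \<le> length xs" and Ay: "\<And>i. i < r \<Longrightarrow> A (ys ! i) = xs ! i"
    by (auto simp: singular_bases_def)
  note kerM = kernel_space_module[OF M N A] and imM = image_space_module[OF M N A]
  have ker: "orthogonal_basis R (kernel_space M N A) lM (drop r ys)"
  proof -
    have "map ((!) ys) [r..<length ys] = drop r ys" using rn by (auto simp: list_eq_iff_nth_eq)
    then show ?thesis
      using obasis_imp_orthogonal_basis_map[OF kerM obasis_kernel[OF M N A sb], of "[r..<length ys]"]
      by simp
  qed
  have im: "orthogonal_basis R (image_space M N A) lN (take r xs)"
  proof -
    have "map ((!) xs) [0..<r] = take r xs" using rn by (auto simp: list_eq_iff_nth_eq)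
    then show ?thesis
      using obasis_imp_orthogonal_basis_map[OF imM obasis_image[OF M N A sb], of "[0..<r]"]
      by (simp add: atLeast0LessThan)
  qed
  have "map_rank R M N A = length (take r xs)"
    unfolding map_rank_def using im by (intro vs_dim_eq[OF imM]) (simp add: orthogonal_basis_def)
  then have r: "map_rank R M N A = r" using rn by simp
  have "lM (ys ! j) - lN (xs ! j) \<le> lM (ys ! i) - lN (xs ! i)" if "i \<le> j" "j < r" for i j
    using that ord[OF that] rn obasis_norm_basis[OF M y] obasis_norm_basis[OF N x] by auto
  then show ?thesis
    using ker im Ay obasis_imp_orthogonal_basis[OF M y] obasis_imp_orthogonal_basis[OF N x]
    by (auto simp: is_svd_def Let_def r)
qed

lemma ex_svd:
  assumes M: "Module.module R M" and N: "Module.module R N" and A: "linear_map R M N A"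
    and e: "obasis M lM e I lam" and f: "obasis N lN f J mu"
  shows "\<exists>ys xs. is_svd R M lM N lN A ys xs"
proof -
  have init: "eliminated M lM N lN A I J e lam f mu {} (\<lambda>_. undefined)"
    using e f obasis_span[OF f linear_map_closed[OF A]] obasis_closed[OF e]
    by (auto simp: eliminated_def)
  obtain e f mu S s where el: "eliminated M lM N lN A I J e lam f mu S s"
    and A0: "\<And>i. i \<in> I - S \<Longrightarrow> A (e i) = \<zero>\<^bsub>N\<^esub>"
    using elimination[OF M N A init] by metis
  then have e: "obasis M lM e I lam" and f: "obasis N lN f J mu" and SI: "S \<subseteq> I"
    and inj: "inj_on s S" and sJ: "s ` S \<subseteq> J" and AS: "\<And>i. i \<in> S \<Longrightarrow> A (e i) = f (s i)"
    by (auto simp: eliminated_def)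
  have "finite S" "finite (I - S)" "finite (J - s ` S)"
    using obasis_finite[OF e] obasis_finite[OF f] SI finite_subset by auto
  then obtain L0 L2 K2 where L0: "distinct L0" "set L0 = S" and L2: "distinct L2" "set L2 = I - S"
    and K2: "distinct K2" "set K2 = J - s ` S"
    by (metis finite_distinct_list)
  \<comment> \<open>Ascending target minus source level means descending gap, the order demanded by
    \<open>is_svd\<close>; listing the targets as \<open>map s L\<close> keeps partners at equal
    positions.\<close>
  define L where "L = sort_key (\<lambda>i. mu (s i) - lam i) L0"
  have L: "distinct L" "set L = S" "sorted (map (\<lambda>i. mu (s i) - lam i) L)"
    using L0 by (auto simp: L_def)
  define P where "P = L @ L2"
  define Q where "Q = map s L @ K2"
  have P: "distinct P" "set P = I" using L L2 SI by (auto simp: P_def)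
  have Q: "distinct Q" "set Q = J" using L K2 sJ inj by (auto simp: Q_def distinct_map)
  have y: "obasis M lM ((!) (map e P)) {..<length (map e P)} (\<lambda>j. lam (P ! j))"
    unfolding length_map using P
    by (intro obasis_cong[OF M obasis_reindex[OF M e, of "(!) P"]]) (auto intro: bij_betw_nth)
  have x: "obasis N lN ((!) (map f Q)) {..<length (map f Q)} (\<lambda>j. mu (Q ! j))"
    unfolding length_map using Q
    by (intro obasis_cong[OF N obasis_reindex[OF N f, of "(!) Q"]]) (auto intro: bij_betw_nth)
  have "A (map e P ! i) = map f Q ! i" if "i < length L" for i
    using that AS L by (auto simp: P_def Q_def nth_append)
  moreover have "A (map e P ! i) = \<zero>\<^bsub>N\<^esub>" if i: "length L \<le> i" "i < length (map e P)" for i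
  proof -
    have "P ! i \<in> set L2" using i by (auto simp: P_def nth_append)
    then show ?thesis using A0 L2 i by simp
  qed
  ultimately have sb: "singular_bases M lM N lN A (length L) (length (map e P)) ((!) (map e P))
      (\<lambda>j. lam (P ! j)) (length (map f Q)) ((!) (map f Q)) (\<lambda>j. mu (Q ! j))"
    using x y by (auto simp: singular_bases_def P_def Q_def)
  have "is_svd R M lM N lN A (map e P) (map f Q)"
  proof (rule singular_bases_imp_is_svd[OF M N A sb])
    fix i j assume ij: "i \<le> j" "j < length L"
    then have "map (\<lambda>i. mu (s i) - lam i) L ! i \<le> map (\<lambda>i. mu (s i) - lam i) L ! j"
      using L(3) by (intro sorted_nth_mono) auto
    then show "lam (P ! j) - mu (Q ! j) \<le> lam (P ! i) - mu (Q ! i)"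
      using ij by (simp add: P_def Q_def nth_append)
  qed
  then show ?thesis by blast
qed

section \<open>The quotient filtration on the image\<close>

text \<open>The usual quotient norm, the level of the cheapest preimage. It depends only on the map
  and the source filtration, so it is available before any decomposition is chosen.\<close>

definition quotient_norm ::
    "('a, 'v, 'e) module_scheme \<Rightarrow> ('v \<Rightarrow> ereal) \<Rightarrow> ('v \<Rightarrow> 'w) \<Rightarrow> 'w \<Rightarrow> ereal" where
  "quotient_norm M l A v = (INF u \<in> {u \<in> carrier M. A u = v}. l u)"

text \<open>All preimages of a combination of the \<open>x i\<close> share the first
  \<open>r\<close> coordinates and differ only along the kernel vectors \<open>y i\<close> with
  \<open>i \<ge> r\<close>. By orthogonality the infimum is attained where the latter coordinates
  are zero, which leaves the levels \<open>mu i\<close> of the \<open>y i\<close>.\<close>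

lemma obasis_quotient_norm:
  assumes M: "Module.module R M" and N: "Module.module R N" and A: "linear_map R M N A"
    and sb: "singular_bases M lM N lN A r n y mu m x lam"
  shows "obasis (image_space M N A) (quotient_norm M lM A) x {..<r} mu"
proof -
  interpret M: Module.module R M by fact
  interpret N: Module.module R N by fact
  let ?I = "image_space M N A"
  from sb have y: "obasis M lM y {..<n} mu" and rn: "r \<le> n" by (auto simp: singular_bases_def)
  note x = obasis_image[OF M N A sb] and imM = image_space_module[OF M N A]
  have xc: "x \<in> {..<r} \<rightarrow> A ` carrier M" using obasis_closed[OF x] by (simp add: image_space_def)
  have xN: "x \<in> {..<r} \<rightarrow> carrier N"
  proof -
    have "obasis N lN x {..<m} lam" "r \<le> m" using sb by (auto simp: singular_bases_def)
    then show ?thesis by (auto dest!: obasis_closed)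
  qed
  have lcI: "lc ?I a x {..<r} = lc N a x {..<r}" if "a \<in> {..<r} \<rightarrow> carrier R" for a
    unfolding image_space_def using that xc
    by (intro lc_submodule[OF N image_submodule[OF M N A]]) auto
  have "quotient_norm M lM A (lc ?I a x {..<r}) = (SUP i\<in>{..<r}. ereal (mu i) - val (a i))"
    if a: "a \<in> {..<r} \<rightarrow> carrier R" for a
    unfolding quotient_norm_def
  proof (intro antisym INF_greatest)
    let ?a = "\<lambda>i. if i < r then a i else \<zero>"
    have a': "?a \<in> {..<n} \<rightarrow> carrier R" using a by auto
    let ?u = "lc M ?a y {..<n}"
    have uc: "?u \<in> carrier M" using a' obasis_closed[OF y] by blast
    have "A ?u = lc N ?a x {..<r}" by (rule obasis_image_formula[OF M N A sb a'])
    also have "\<dots> = lc N a x {..<r}"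
      using a xN by (intro N.lc_cong) auto
    finally have "A ?u = lc ?I a x {..<r}" using lcI[OF a] by simp
    then have "(INF u \<in> {u \<in> carrier M. A u = lc ?I a x {..<r}}. lM u) \<le> lM ?u"
      using uc by (intro INF_lower) auto
    also have "\<dots> = (SUP i\<in>{..<n}. ereal (mu i) - val (?a i))" by (rule obasis_norm[OF y a'])
    also have "\<dots> \<le> (SUP i\<in>{..<r}. ereal (mu i) - val (a i))"
    proof (rule SUP_least)
      fix i show "ereal (mu i) - val (?a i) \<le> (SUP i\<in>{..<r}. ereal (mu i) - val (a i))"
        by (cases "i < r") (auto intro: SUP_upper)
    qed
    finally show "(INF u \<in> {u \<in> carrier M. A u = lc ?I a x {..<r}}. lM u)
        \<le> (SUP i\<in>{..<r}. ereal (mu i) - val (a i))" .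
  next
    fix u assume "u \<in> {u \<in> carrier M. A u = lc ?I a x {..<r}}"
    then have u: "u \<in> carrier M" "A u = lc ?I a x {..<r}" by auto
    obtain b where b: "b \<in> {..<n} \<rightarrow> carrier R" "u = lc M b y {..<n}" using obasis_span[OF y u(1)] by auto
    have b': "b \<in> {..<r} \<rightarrow> carrier R" using b(1) rn by auto
    have "lc ?I b x {..<r} = lc ?I a x {..<r}"
      using u b obasis_image_formula[OF M N A sb b(1)] lcI[OF b'] by simp
    then have ab: "a i = b i" if "i < r" for i
      using obasis_unique[OF imM x b' a] that by auto
    show "(SUP i\<in>{..<r}. ereal (mu i) - val (a i)) \<le> lM u"
      using ab rn b(1) obasis_term_le[OF y b(1)] b(2) by (intro SUP_least) auto
  qed
  then show ?thesis using x by (auto simp: obasis_def)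
qed

section \<open>Adapted bases and isometries\<close>

text \<open>The tail of \<open>y\<close> and the family \<open>z\<close> are two orthogonal bases of
  the same kernel. Orthogonality of \<open>y\<close> separates the level of a combination of its
  first \<open>r\<close> members from the level of a kernel part, and the kernel part may then be
  measured by \<open>z\<close>. This makes room for the basis of cycles that comes from the next
  boundary map.\<close>

lemma obasis_adapted:
  assumes M: "Module.module R M" and N: "Module.module R N" and A: "linear_map R M N A"
    and sb: "singular_bases M lM N lN A r n y mu m x lam"
    and z: "obasis (kernel_space M N A) lM z J ze"
  shows "obasis M lM (case_sum y z) ({..<r} <+> J) (case_sum mu ze)"
proof -
  interpret M: Module.module R M by fact
  let ?H = "{x \<in> carrier M. A x = \<zero>\<^bsub>N\<^esub>}" and ?S = "{..<r} <+> J"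
  note H = kernel_submodule[OF M N A]
  from sb have y: "obasis M lM y {..<n} mu" and rn: "r \<le> n" by (auto simp: singular_bases_def)
  note ker = obasis_kernel[OF M N A sb]
  have yc: "y i \<in> carrier M" if "i < n" for i using obasis_closed[OF y] that by auto
  have zH: "z \<in> J \<rightarrow> ?H" using obasis_closed[OF z] by (simp add: kernel_space_def)
  have yH: "y \<in> {r..<n} \<rightarrow> ?H" using obasis_closed[OF ker] by (simp add: kernel_space_def)
  have finJ: "finite J" using obasis_finite[OF z] .
  have lc_z: "lc (kernel_space M N A) a z J = lc M a z J" "lc M a z J \<in> ?H" if "a \<in> J \<rightarrow> carrier R" for a
    using lc_submodule[OF M H finJ that zH] lc_in_submodule[OF M H finJ that zH]
    by (auto simp: kernel_space_def)
  have lc_y: "lc (kernel_space M N A) a y {r..<n} = lc M a y {r..<n}" "lc M a y {r..<n} \<in> ?H"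
    if "a \<in> {r..<n} \<rightarrow> carrier R" for a
    using lc_submodule[OF M H _ that yH] lc_in_submodule[OF M H _ that yH]
    by (auto simp: kernel_space_def)
  have split: "lc M a y {..<n} = lc M a y {..<r} \<oplus>\<^bsub>M\<^esub> lc M a y {r..<n}"
    if "a \<in> {..<n} \<rightarrow> carrier R" for a
  proof -
    have *: "{..<n} = {..<r} \<union> {r..<n}" using rn by auto
    show ?thesis unfolding * using that yc rn by (intro M.lc_Un_disjoint) auto
  qed
  have ec: "case_sum y z \<in> ?S \<rightarrow> carrier M" using yc rn zH by (auto elim!: PlusE)
  have "\<exists>c \<in> ?S \<rightarrow> carrier R. v = lc M c (case_sum y z) ?S" if v: "v \<in> carrier M" for v
  proof -
    obtain a where a: "a \<in> {..<n} \<rightarrow> carrier R" "v = lc M a y {..<n}" using obasis_span[OF y v] by auto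
    have "lc M a y {r..<n} \<in> carrier (kernel_space M N A)"
      using a lc_y(2)[of a] by (simp add: kernel_space_def Pi_iff)
    then obtain b where b: "b \<in> J \<rightarrow> carrier R" "lc M a y {r..<n} = lc M b z J"
      using obasis_span[OF z] lc_z(1) by metis
    have c: "case_sum a b \<in> ?S \<rightarrow> carrier R" using a b rn by (auto elim!: PlusE)
    have "lc M (case_sum a b) (case_sum y z) ?S = v"
      using M.lc_Plus[OF _ finJ c ec] split[OF a(1)] a(2) b(2) by simp
    then show ?thesis using c by blast
  qed
  moreover have "lM (lc M c (case_sum y z) ?S) = (SUP i \<in> ?S. ereal (case_sum mu ze i) - val (c i))"
    if c: "c \<in> ?S \<rightarrow> carrier R" for c
  proof -
    let ?q = "lc M (\<lambda>j. c (Inr j)) z J"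
    have cl: "\<And>i. i < r \<Longrightarrow> c (Inl i) \<in> carrier R" and cr: "(\<lambda>j. c (Inr j)) \<in> J \<rightarrow> carrier R"
      using c by auto
    obtain a where a: "a \<in> {r..<n} \<rightarrow> carrier R" "?q = lc M a y {r..<n}"
      using obasis_span[OF ker, of ?q] lc_z(2)[OF cr] lc_y(1) by (auto simp: kernel_space_def)
    let ?a = "\<lambda>i. if i < r then c (Inl i) else a i"
    have a': "?a \<in> {..<n} \<rightarrow> carrier R" using a(1) cl by auto
    have "lc M ?a y {..<n} = lc M ?a y {..<r} \<oplus>\<^bsub>M\<^esub> lc M ?a y {r..<n}" by (rule split[OF a'])
    also have "lc M ?a y {..<r} = lc M (\<lambda>i. c (Inl i)) y {..<r}"
      using cl yc rn by (intro M.lc_cong) auto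
    also have "lc M ?a y {r..<n} = lc M a y {r..<n}"
      using a(1) yc by (intro M.lc_cong) auto
    finally have "lc M c (case_sum y z) ?S = lc M ?a y {..<n}"
      using M.lc_Plus[OF _ finJ c ec] a(2) by simp
    then have "lM (lc M c (case_sum y z) ?S) = (SUP i\<in>{..<n}. ereal (mu i) - val (?a i))"
      using obasis_norm[OF y a'] by simp
    also have "{..<n} = {..<r} \<union> {r..<n}" using rn by auto
    also have "(SUP i\<in>{..<r} \<union> {r..<n}. ereal (mu i) - val (?a i))
        = sup (SUP i\<in>{..<r}. ereal (mu i) - val (c (Inl i))) (SUP i\<in>{r..<n}. ereal (mu i) - val (a i))"
      unfolding SUP_union by (intro arg_cong2[where f = sup] SUP_cong) auto
    also have "(SUP i\<in>{r..<n}. ereal (mu i) - val (a i)) = lM ?q"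
      using obasis_norm[OF ker a(1)] lc_y(1)[OF a(1)] a(2) by simp
    also have "lM ?q = (SUP j\<in>J. ereal (ze j) - val (c (Inr j)))"
      using obasis_norm[OF z cr] lc_z(1)[OF cr] by simp
    finally show ?thesis by (simp add: SUP_Plus)
  qed
  ultimately show ?thesis using ec finJ by (auto simp: obasis_def)
qed

definition isometry_onto ::
    "('a, 'v, 'e) module_scheme \<Rightarrow> ('v \<Rightarrow> ereal) \<Rightarrow> ('a, 'w, 'f) module_scheme \<Rightarrow> ('w \<Rightarrow> ereal) \<Rightarrow>
     ('v \<Rightarrow> 'w) \<Rightarrow> bool" where
  "isometry_onto M l N l' \<phi> \<longleftrightarrow> linear_map R M N \<phi> \<and> bij_betw \<phi> (carrier M) (carrier N) \<and>
     (\<forall>x \<in> carrier M. l' (\<phi> x) = l x)"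

text \<open>The map keeps coordinates; as both bases have the same levels \<open>lam\<close>, the
  maximum formula returns the same value on either side.\<close>

lemma obasis_isometry:
  assumes M: "Module.module R M" and N: "Module.module R N"
    and e: "obasis M l e I lam" and f: "obasis N l' f I lam"
  shows "\<exists>\<phi>. isometry_onto M l N l' \<phi> \<and> (\<forall>i\<in>I. \<phi> (e i) = f i)"
proof -
  interpret M: Module.module R M by fact
  interpret N: Module.module R N by fact
  note ec = obasis_closed[OF e] and fc = obasis_closed[OF f] and fin = obasis_finite[OF e]
  obtain co where co: "\<And>x. x \<in> carrier M \<Longrightarrow> co x \<in> I \<rightarrow> carrier R"
    "\<And>x. x \<in> carrier M \<Longrightarrow> x = lc M (co x) e I"
    using obasis_span[OF e] by metis
  define \<phi> where "\<phi> = (\<lambda>x. lc N (co x) f I)"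
  have \<phi>: "\<phi> (lc M a e I) = lc N a f I" if a: "a \<in> I \<rightarrow> carrier R" for a
  proof -
    have x: "lc M a e I \<in> carrier M" using a ec by auto
    have "co (lc M a e I) i = a i" if "i \<in> I" for i
      using obasis_unique[OF M e co(1)[OF x] a] co(2)[OF x] that by simp
    then show ?thesis unfolding \<phi>_def using a fc by (intro N.lc_cong) auto
  qed
  have "linear_map R M N \<phi>"
  proof (rule linear_mapI)
    fix x assume x: "x \<in> carrier M"
    then show "\<phi> x \<in> carrier N" unfolding \<phi>_def using co(1) fc by auto
  next
    fix x y assume x: "x \<in> carrier M" and y: "y \<in> carrier M"
    have cs: "(\<lambda>i. co x i \<oplus> co y i) \<in> I \<rightarrow> carrier R" using x y co(1) by (auto simp: Pi_iff)
    have "x \<oplus>\<^bsub>M\<^esub> y = lc M (\<lambda>i. co x i \<oplus> co y i) e I"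
      using x y co ec by (subst M.lc_add) auto
    then have "\<phi> (x \<oplus>\<^bsub>M\<^esub> y) = lc N (\<lambda>i. co x i \<oplus> co y i) f I" using \<phi>[OF cs] by simp
    also have "\<dots> = \<phi> x \<oplus>\<^bsub>N\<^esub> \<phi> y" unfolding \<phi>_def using x y co fc by (subst N.lc_add) auto
    finally show "\<phi> (x \<oplus>\<^bsub>M\<^esub> y) = \<phi> x \<oplus>\<^bsub>N\<^esub> \<phi> y" .
  next
    fix c x assume c: "c \<in> carrier R" and x: "x \<in> carrier M"
    have cs: "(\<lambda>i. c \<otimes> co x i) \<in> I \<rightarrow> carrier R" using x c co(1) by (auto simp: Pi_iff)
    have "c \<odot>\<^bsub>M\<^esub> x = lc M (\<lambda>i. c \<otimes> co x i) e I"
      using x c co ec fin by (subst M.lc_smult) auto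
    then have "\<phi> (c \<odot>\<^bsub>M\<^esub> x) = lc N (\<lambda>i. c \<otimes> co x i) f I" using \<phi>[OF cs] by simp
    also have "\<dots> = c \<odot>\<^bsub>N\<^esub> \<phi> x" unfolding \<phi>_def using x c co fc fin by (subst N.lc_smult) auto
    finally show "\<phi> (c \<odot>\<^bsub>M\<^esub> x) = c \<odot>\<^bsub>N\<^esub> \<phi> x" .
  qed
  moreover have "bij_betw \<phi> (carrier M) (carrier N)"
  proof (rule bij_betw_imageI)
    show "inj_on \<phi> (carrier M)"
    proof (rule inj_onI)
      fix x y assume x: "x \<in> carrier M" and y: "y \<in> carrier M" and eq: "\<phi> x = \<phi> y"
      have "co x i = co y i" if "i \<in> I" for i
        using obasis_unique[OF N f co(1)[OF x] co(1)[OF y]] eq that by (simp add: \<phi>_def)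
      then have "lc M (co x) e I = lc M (co y) e I" using co(1)[OF y] ec by (intro M.lc_cong) auto
      then show "x = y" using co(2)[OF x] co(2)[OF y] by simp
    qed
    have "\<phi> ` carrier M \<subseteq> carrier N" unfolding \<phi>_def using co(1) fc by auto
    moreover have "z \<in> \<phi> ` carrier M" if z: "z \<in> carrier N" for z
    proof -
      obtain a where a: "a \<in> I \<rightarrow> carrier R" "z = lc N a f I" using obasis_span[OF f z] by metis
      then have "z = \<phi> (lc M a e I)" "lc M a e I \<in> carrier M" using \<phi> ec by auto
      then show ?thesis by (rule image_eqI)
    qed
    ultimately show "\<phi> ` carrier M = carrier N" by auto
  qed
  moreover have "l' (\<phi> x) = l x" if x: "x \<in> carrier M" for x
    using obasis_norm[OF e co(1)[OF x]] obasis_norm[OF f co(1)[OF x]] co(2)[OF x]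
    by (simp add: \<phi>_def)
  moreover have "\<phi> (e i) = f i" if i: "i \<in> I" for i
  proof -
    let ?d = "\<lambda>j. if j = i then \<one> else \<zero>"
    have "\<phi> (lc M ?d e I) = lc N ?d f I" by (intro \<phi>) auto
    moreover have "e i \<in> carrier M" "f i \<in> carrier N" using i ec fc by auto
    ultimately show ?thesis using i ec fc fin by (simp add: M.lc_delta N.lc_delta)
  qed
  ultimately show ?thesis unfolding isometry_onto_def by blast
qed

lemma obasis_transport:
  assumes M: "Module.module R M" and N: "Module.module R N"
    and e: "obasis M l e I lam" and \<phi>: "isometry_onto M l N l' \<phi>"
  shows "obasis N l' (\<lambda>i. \<phi> (e i)) I lam"
proof -
  interpret M: Module.module R M by fact
  note ec = obasis_closed[OF e] and fin = obasis_finite[OF e]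
  from \<phi> have lin: "linear_map R M N \<phi>" and im: "\<phi> ` carrier M = carrier N"
    and iso: "\<And>x. x \<in> carrier M \<Longrightarrow> l' (\<phi> x) = l x"
    by (auto simp: isometry_onto_def bij_betw_def)
  have lc: "lc N a (\<lambda>i. \<phi> (e i)) I = \<phi> (lc M a e I)" if "a \<in> I \<rightarrow> carrier R" for a
    using linear_map_lc[OF M N lin fin that ec] by simp
  have "\<exists>a \<in> I \<rightarrow> carrier R. y = lc N a (\<lambda>i. \<phi> (e i)) I" if y: "y \<in> carrier N" for y
  proof -
    obtain x where x: "x \<in> carrier M" "y = \<phi> x" using y im by auto
    then show ?thesis using obasis_span[OF e x(1)] lc by metis
  qed
  moreover have "(\<lambda>i. \<phi> (e i)) \<in> I \<rightarrow> carrier N" using ec linear_map_closed[OF lin] by auto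
  moreover have "l' (lc N a (\<lambda>i. \<phi> (e i)) I) = (SUP i\<in>I. ereal (lam i) - val (a i))"
    if a: "a \<in> I \<rightarrow> carrier R" for a
    using lc[OF a] iso[of "lc M a e I"] obasis_norm[OF e a] a ec by simp
  ultimately show ?thesis using fin by (auto simp: obasis_def)
qed

end

section \<open>The Novikov field\<close>

text \<open>That \<Lambda> is a commutative ring enters as an assumption; \<open>theoremA\<close>
  obtains it from the module structure of a chain space, whose axioms contain it. Left to prove for
  a field are nontriviality and inverses.\<close>

locale novikov_field = K: field K for K :: "('k, 'z) ring_scheme" (structure) +
  fixes \<Gamma> :: "real set"
  assumes subgroup_Gamma: "subgroup \<Gamma> real_add_group"
    and cring_novikov: "cring (novikov K \<Gamma>)"
begin

abbreviation \<Lambda> :: "(real \<Rightarrow> 'k) ring" where "\<Lambda> \<equiv> novikov K \<Gamma>"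

sublocale L: cring \<Lambda> by (rule cring_novikov)

lemma zero_in_Gamma [simp]: "0 \<in> \<Gamma>"
  and add_in_Gamma: "g \<in> \<Gamma> \<Longrightarrow> h \<in> \<Gamma> \<Longrightarrow> g + h \<in> \<Gamma>"
  using subgroup.one_closed[OF subgroup_Gamma] subgroup.m_closed[OF subgroup_Gamma]
  by (auto simp: real_add_group_def)

lemma uminus_in_Gamma: "g \<in> \<Gamma> \<Longrightarrow> - g \<in> \<Gamma>"
proof -
  assume g: "g \<in> \<Gamma>"
  interpret G: group real_add_group
  proof (rule groupI)
    fix x assume "x \<in> carrier real_add_group"
    show "\<exists>y\<in>carrier real_add_group. y \<otimes>\<^bsub>real_add_group\<^esub> x = \<one>\<^bsub>real_add_group\<^esub>"
      by (rule bexI[of _ "- x"]) (auto simp: real_add_group_def)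
  qed (auto simp: real_add_group_def)
  have "inv\<^bsub>real_add_group\<^esub> g = - g"
    by (rule G.inv_equality) (auto simp: real_add_group_def)
  then show ?thesis using subgroup.m_inv_closed[OF subgroup_Gamma g] by simp
qed

lemma diff_in_Gamma: "g \<in> \<Gamma> \<Longrightarrow> h \<in> \<Gamma> \<Longrightarrow> g - h \<in> \<Gamma>"
  using add_in_Gamma[of g "- h"] uminus_in_Gamma by simp

lemma
  assumes "a \<in> carrier \<Lambda>"
  shows coeff_closed: "a g \<in> carrier K"
    and coeff_outside: "g \<notin> \<Gamma> \<Longrightarrow> a g = \<zero>"
    and finite_support_below: "finite {g. g < c \<and> a g \<noteq> \<zero>}"
  using assms by (auto simp: novikov_def)

lemma carrier_novikovI:
  assumes "\<And>g. a g \<in> carrier K" "\<And>g. g \<notin> \<Gamma> \<Longrightarrow> a g = \<zero>" "\<And>c. finite {g. g < c \<and> a g \<noteq> \<zero>}"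
  shows "a \<in> carrier \<Lambda>"
  using assms by (auto simp: novikov_def)

lemma zero_novikov: "\<zero>\<^bsub>\<Lambda>\<^esub> = (\<lambda>_. \<zero>)"
  and one_novikov: "\<one>\<^bsub>\<Lambda>\<^esub> = (\<lambda>g. if g = 0 then \<one> else \<zero>)"
  and add_novikov [simp]: "(a \<oplus>\<^bsub>\<Lambda>\<^esub> b) g = a g \<oplus> b g"
  and mult_novikov: "(a \<otimes>\<^bsub>\<Lambda>\<^esub> b) g = (\<Oplus>h \<in> {h. a h \<noteq> \<zero> \<and> b (g - h) \<noteq> \<zero>}. a h \<otimes> b (g - h))"
  by (auto simp: novikov_def)

lemma minus_novikov:
  assumes "a \<in> carrier \<Lambda>" shows "(\<ominus>\<^bsub>\<Lambda>\<^esub> a) g = \<ominus> a g"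
proof -
  have "(\<ominus>\<^bsub>\<Lambda>\<^esub> a \<oplus>\<^bsub>\<Lambda>\<^esub> a) g = \<zero>" using L.l_neg[OF assms] by (simp add: zero_novikov)
  then have "(\<ominus>\<^bsub>\<Lambda>\<^esub> a) g \<oplus> a g = \<zero>" by simp
  then show ?thesis
    using coeff_closed[OF assms] coeff_closed[OF L.a_inv_closed[OF assms]] K.minus_equality by auto
qed

lemma finsum_novikov:
  "finite A \<Longrightarrow> f \<in> A \<rightarrow> carrier \<Lambda> \<Longrightarrow> finsum \<Lambda> f A g = (\<Oplus>i\<in>A. f i g)"
proof (induction A rule: finite_induct)
  case (insert i A)
  then have "f i g \<in> carrier K" "(\<lambda>i. f i g) \<in> A \<rightarrow> carrier K" by (auto intro!: coeff_closed)
  then show ?case using insert by (simp add: L.finsum_insert K.finsum_insert)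
qed (simp add: zero_novikov)

section \<open>Leading exponents and the valuation\<close>

text \<open>A nonempty set of reals need not have a least element; here the support below any bound
  is finite, so the \<open>LEAST\<close> in \<open>novikov_val\<close> is attained.\<close>

lemma leading_coeff:
  assumes "a \<in> carrier \<Lambda>" "a \<noteq> \<zero>\<^bsub>\<Lambda>\<^esub>"
  obtains g where "g \<in> \<Gamma>" "novikov_val K a = ereal g" "a g \<noteq> \<zero>" "\<And>h. h < g \<Longrightarrow> a h = \<zero>"
proof -
  obtain g0 where g0: "a g0 \<noteq> \<zero>" using assms by (auto simp: zero_novikov)
  \<comment> \<open>The bound \<open>g0 + 1\<close> puts \<open>g0\<close> itself inside the finite
    part of the support, so that the minimum of this part is the minimum of the whole
    support.\<close>
  define S where "S = {g. g < g0 + 1 \<and> a g \<noteq> \<zero>}"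
  have S: "finite S" "g0 \<in> S" using finite_support_below[OF assms(1)] g0 by (auto simp: S_def)
  define g where "g = Min S"
  have gS: "g \<in> S" unfolding g_def using S by (intro Min_in) auto
  have le: "g \<le> h" if "a h \<noteq> \<zero>" for h
  proof (cases "h < g0 + 1")
    case True
    then show ?thesis unfolding g_def using that S by (intro Min_le) (auto simp: S_def)
  next
    case False
    then show ?thesis using gS by (auto simp: S_def)
  qed
  have ag: "a g \<noteq> \<zero>" using gS by (simp add: S_def)
  have "(LEAST g. a g \<noteq> \<zero>) = g" using ag le by (intro Least_equality)
  then have "novikov_val K a = ereal g" using ag by (auto simp: novikov_val_def)
  moreover have "g \<in> \<Gamma>" using ag coeff_outside[OF assms(1)] by blast
  ultimately show ?thesis using that ag le by force
qed

lemma val_zero_novikov: "novikov_val K \<zero>\<^bsub>\<Lambda>\<^esub> = \<infinity>"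
  by (simp add: novikov_val_def zero_novikov)

lemma coeff_below_val:
  assumes "a \<in> carrier \<Lambda>" "ereal g < novikov_val K a"
  shows "a g = \<zero>"
proof (cases "a = \<zero>\<^bsub>\<Lambda>\<^esub>")
  case False
  then show ?thesis using leading_coeff[OF assms(1)] assms(2) by (metis ereal_less(3) less_ereal.simps(1))
qed (simp add: zero_novikov)

lemma val_geI:
  assumes "a \<in> carrier \<Lambda>" "\<And>h. ereal h < c \<Longrightarrow> a h = \<zero>"
  shows "c \<le> novikov_val K a"
proof (cases "a = \<zero>\<^bsub>\<Lambda>\<^esub>")
  case False
  then obtain g where "novikov_val K a = ereal g" "a g \<noteq> \<zero>" using leading_coeff[OF assms(1)] by metis
  then show ?thesis using assms(2) by (metis not_le)
qed (simp add: val_zero_novikov)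

lemma val_eqI:
  assumes "a \<in> carrier \<Lambda>" "a g \<noteq> \<zero>" "\<And>h. h < g \<Longrightarrow> a h = \<zero>"
  shows "novikov_val K a = ereal g"
proof (rule antisym)
  show "novikov_val K a \<le> ereal g" using coeff_below_val[OF assms(1), of g] assms(2) by force
  show "ereal g \<le> novikov_val K a" using assms by (intro val_geI) auto
qed

definition monom :: "'k \<Rightarrow> real \<Rightarrow> real \<Rightarrow> 'k" where
  "monom c g = (\<lambda>h. if h = g then c else \<zero>)"

lemma monom_closed:
  assumes "c \<in> carrier K" "g \<in> \<Gamma>" shows "monom c g \<in> carrier \<Lambda>"
proof (rule carrier_novikovI)
  fix x show "finite {h. h < x \<and> monom c g h \<noteq> \<zero>}"
    by (rule finite_subset[of _ "{g}"]) (auto simp: monom_def)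
qed (use assms in \<open>auto simp: monom_def\<close>)

lemma val_monom:
  "c \<in> carrier K \<Longrightarrow> c \<noteq> \<zero> \<Longrightarrow> g \<in> \<Gamma> \<Longrightarrow> novikov_val K (monom c g) = ereal g"
  by (intro val_eqI monom_closed) (auto simp: monom_def)

lemma mult_monom:
  assumes a: "a \<in> carrier \<Lambda>" and c: "c \<in> carrier K"
  shows "(a \<otimes>\<^bsub>\<Lambda>\<^esub> monom c g) h = a (h - g) \<otimes> c"
proof (cases "a (h - g) = \<zero> \<or> c = \<zero>")
  case True
  then have empty: "{h'. a h' \<noteq> \<zero> \<and> monom c g (h - h') \<noteq> \<zero>} = {}" by (auto simp: monom_def)
  show ?thesis unfolding mult_novikov empty using True c coeff_closed[OF a, of "h - g"] by auto
next
  case False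
  have "h - h' = g \<longleftrightarrow> h' = h - g" for h' by auto
  then have "{h'. a h' \<noteq> \<zero> \<and> monom c g (h - h') \<noteq> \<zero>} = {h - g}"
    using False by (auto simp: monom_def)
  then show ?thesis using c coeff_closed[OF a] by (simp add: mult_novikov monom_def)
qed

text \<open>In a term of the product at \<open>p + q\<close> whose index is not \<open>p\<close>,
  one of the two exponents falls below its bound. The coefficients at \<open>p\<close> and
  \<open>q\<close> may be zero, so that lower bounds can be multiplied up in
  \<open>pow_vanishes\<close>.\<close>

lemma mult_leading:
  assumes a: "a \<in> carrier \<Lambda>" and b: "b \<in> carrier \<Lambda>"
    and lower: "\<And>h. h < p \<Longrightarrow> a h = \<zero>" "\<And>h. h < q \<Longrightarrow> b h = \<zero>"
  shows "(a \<otimes>\<^bsub>\<Lambda>\<^esub> b) (p + q) = a p \<otimes> b q" and "g < p + q \<Longrightarrow> (a \<otimes>\<^bsub>\<Lambda>\<^esub> b) g = \<zero>"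
proof -
  show "(a \<otimes>\<^bsub>\<Lambda>\<^esub> b) (p + q) = a p \<otimes> b q"
  proof (cases "a p = \<zero> \<or> b q = \<zero>")
    case True
    have "h = p" if "a h \<noteq> \<zero>" "b (p + q - h) \<noteq> \<zero>" for h
      using that lower(1)[of h] lower(2)[of "p + q - h"] by force
    then have empty: "{h. a h \<noteq> \<zero> \<and> b (p + q - h) \<noteq> \<zero>} = {}"
    proof (intro equals0I)
      fix h assume "h \<in> {h. a h \<noteq> \<zero> \<and> b (p + q - h) \<noteq> \<zero>}"
      moreover from this have "h = p" using \<open>\<And>h. a h \<noteq> \<zero> \<Longrightarrow> b (p + q - h) \<noteq> \<zero> \<Longrightarrow> h = p\<close> by blast
      ultimately show False using True by simp
    qed
    show ?thesis unfolding mult_novikov empty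
      using True coeff_closed[OF a, of p] coeff_closed[OF b, of q] by auto
  next
    case False
    have "h = p" if "a h \<noteq> \<zero>" "b (p + q - h) \<noteq> \<zero>" for h
      using that lower(1)[of h] lower(2)[of "p + q - h"] by force
    then have "{h. a h \<noteq> \<zero> \<and> b (p + q - h) \<noteq> \<zero>} = {p}" using False by auto
    then show ?thesis using coeff_closed[OF a] coeff_closed[OF b] by (simp add: mult_novikov)
  qed
  assume g: "g < p + q"
  have "a h = \<zero> \<or> b (g - h) = \<zero>" for h
    using lower(1)[of h] lower(2)[of "g - h"] g by force
  then have empty: "{h. a h \<noteq> \<zero> \<and> b (g - h) \<noteq> \<zero>} = {}" by auto
  show "(a \<otimes>\<^bsub>\<Lambda>\<^esub> b) g = \<zero>" unfolding mult_novikov empty by simp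
qed

lemma val_mult_novikov:
  assumes a: "a \<in> carrier \<Lambda>" and b: "b \<in> carrier \<Lambda>"
  shows "novikov_val K (a \<otimes>\<^bsub>\<Lambda>\<^esub> b) = novikov_val K a + novikov_val K b"
proof (cases "a = \<zero>\<^bsub>\<Lambda>\<^esub> \<or> b = \<zero>\<^bsub>\<Lambda>\<^esub>")
  case True
  have "novikov_val K x \<noteq> -\<infinity>" for x by (simp add: novikov_val_def)
  then show ?thesis using True a b by (auto simp: val_zero_novikov)
next
  case False
  obtain p where p: "novikov_val K a = ereal p" "a p \<noteq> \<zero>" "\<And>h. h < p \<Longrightarrow> a h = \<zero>"
    using leading_coeff[OF a] False by metis
  obtain q where q: "novikov_val K b = ereal q" "b q \<noteq> \<zero>" "\<And>h. h < q \<Longrightarrow> b h = \<zero>"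
    using leading_coeff[OF b] False by metis
  have "novikov_val K (a \<otimes>\<^bsub>\<Lambda>\<^esub> b) = ereal (p + q)"
    using a b p q mult_leading[OF a b p(3) q(3)] K.integral_iff[OF coeff_closed[OF a] coeff_closed[OF b], of p q]
    by (intro val_eqI) auto
  then show ?thesis using p q by simp
qed

lemma val_add_novikov:
  assumes a: "a \<in> carrier \<Lambda>" and b: "b \<in> carrier \<Lambda>"
  shows "min (novikov_val K a) (novikov_val K b) \<le> novikov_val K (a \<oplus>\<^bsub>\<Lambda>\<^esub> b)"
  using a b by (intro val_geI) (auto simp: coeff_below_val)

lemma val_eq_infinity: "a \<in> carrier \<Lambda> \<Longrightarrow> novikov_val K a = \<infinity> \<longleftrightarrow> a = \<zero>\<^bsub>\<Lambda>\<^esub>"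
  by (metis PInfty_neq_ereal(1) leading_coeff val_zero_novikov)

section \<open>Inverses through geometric series\<close>

lemma pow_vanishes:
  assumes x: "x \<in> carrier \<Lambda>" and low: "\<And>h. h < p \<Longrightarrow> x h = \<zero>" and "h < real n * p"
  shows "(x [^]\<^bsub>\<Lambda>\<^esub> n) h = \<zero>"
  using assms(3)
proof (induction n arbitrary: h)
  case 0
  then show ?case by (simp add: one_novikov)
next
  case (Suc n)
  have "(x [^]\<^bsub>\<Lambda>\<^esub> n \<otimes>\<^bsub>\<Lambda>\<^esub> x) h = \<zero>"
    using Suc x low by (intro mult_leading(2)[where p = "real n * p" and q = p]) (auto simp: algebra_simps)
  then show ?case by simp
qed

text \<open>
  The inverse of \<open>1 - x\<close> is the geometric series; its coefficient at \<open>g\<close> is read off a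
  partial sum in which all powers contributing at or below \<open>g\<close> are present.
\<close>

lemma one_minus_invertible:
  assumes x: "x \<in> carrier \<Lambda>" and p: "p > 0" and low: "\<And>h. h < p \<Longrightarrow> x h = \<zero>"
  shows "\<exists>b \<in> carrier \<Lambda>. (\<one>\<^bsub>\<Lambda>\<^esub> \<ominus>\<^bsub>\<Lambda>\<^esub> x) \<otimes>\<^bsub>\<Lambda>\<^esub> b = \<one>\<^bsub>\<Lambda>\<^esub>"
proof -
  define s where "s = (\<lambda>n. \<Oplus>\<^bsub>\<Lambda>\<^esub>i\<in>{..<n}. x [^]\<^bsub>\<Lambda>\<^esub> (i::nat))"
  have sc: "s n \<in> carrier \<Lambda>" for n unfolding s_def using x by (intro L.finsum_closed) auto
  have s_Suc: "s (Suc n) = x [^]\<^bsub>\<Lambda>\<^esub> n \<oplus>\<^bsub>\<Lambda>\<^esub> s n" for n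
    unfolding s_def lessThan_Suc using x by (subst L.finsum_insert) auto
  have stable: "s (n + k) g = s n g" if "g < real n * p" for n k g
  proof (induction k)
    case (Suc k)
    have "real n * p \<le> real (n + k) * p" using p by (intro mult_right_mono) auto
    then have "(x [^]\<^bsub>\<Lambda>\<^esub> (n + k)) g = \<zero>" using that by (intro pow_vanishes[OF x low]) auto
    then show ?case using Suc coeff_closed[OF sc] by (simp add: s_Suc)
  qed simp
  \<comment> \<open>The \<open>n\<close>-th power of \<open>x\<close> vanishes below
    \<open>n * p\<close>, so from \<open>N g\<close> on no power reaches \<open>g\<close>; the added
    one makes the bound strict.\<close>
  define N where "N = (\<lambda>g::real. nat \<lceil>g / p\<rceil> + 1)"
  have N: "g < real (N g) * p" for g
  proof -
    have "g / p < real (N g)" unfolding N_def by linarith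
    then show ?thesis using p by (simp add: field_simps)
  qed
  define b where "b = (\<lambda>g. s (N g) g)"
  have b_eq: "b g = s n g" if "g < real n * p" for n g
    using stable[OF that, of "N g"] stable[OF N[of g], of n] by (simp add: b_def add.commute)
  have bc: "b \<in> carrier \<Lambda>"
  proof (rule carrier_novikovI)
    fix c :: real
    \<comment> \<open>Below \<open>c\<close> one partial sum serves for all exponents, and its
      support there is finite.\<close>
    have "b g = s (N c) g" if "g < c" for g using N[of c] that by (intro b_eq) linarith
    then have "{g. g < c \<and> b g \<noteq> \<zero>} \<subseteq> {g. g < c \<and> s (N c) g \<noteq> \<zero>}" by auto
    then show "finite {g. g < c \<and> b g \<noteq> \<zero>}"
      using finite_support_below[OF sc] finite_subset by blast
  qed (use coeff_closed[OF sc] coeff_outside[OF sc] in \<open>auto simp: b_def\<close>)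
  define y where "y = \<one>\<^bsub>\<Lambda>\<^esub> \<ominus>\<^bsub>\<Lambda>\<^esub> x"
  have yc: "y \<in> carrier \<Lambda>" unfolding y_def using x by simp
  have y0: "y h = \<zero>" if "h < 0" for h
    using that x low p minus_novikov[OF x] by (simp add: y_def a_minus_def one_novikov)
  have telescope: "y \<otimes>\<^bsub>\<Lambda>\<^esub> s n = \<one>\<^bsub>\<Lambda>\<^esub> \<ominus>\<^bsub>\<Lambda>\<^esub> x [^]\<^bsub>\<Lambda>\<^esub> n" for n
  proof (induction n)
    case 0
    show ?case using yc by (simp add: s_def L.r_neg a_minus_def)
  next
    case (Suc n)
    have "y \<otimes>\<^bsub>\<Lambda>\<^esub> s (Suc n) = y \<otimes>\<^bsub>\<Lambda>\<^esub> x [^]\<^bsub>\<Lambda>\<^esub> n \<oplus>\<^bsub>\<Lambda>\<^esub> (\<one>\<^bsub>\<Lambda>\<^esub> \<ominus>\<^bsub>\<Lambda>\<^esub> x [^]\<^bsub>\<Lambda>\<^esub> n)"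
      using yc x sc Suc by (simp add: s_Suc L.r_distr)
    also have "y \<otimes>\<^bsub>\<Lambda>\<^esub> x [^]\<^bsub>\<Lambda>\<^esub> n = x [^]\<^bsub>\<Lambda>\<^esub> n \<ominus>\<^bsub>\<Lambda>\<^esub> x [^]\<^bsub>\<Lambda>\<^esub> Suc n"
      using x L.m_comm[of x "x [^]\<^bsub>\<Lambda>\<^esub> n"] by (simp add: y_def a_minus_def L.l_distr L.l_minus)
    also have "(x [^]\<^bsub>\<Lambda>\<^esub> n \<ominus>\<^bsub>\<Lambda>\<^esub> x [^]\<^bsub>\<Lambda>\<^esub> Suc n) \<oplus>\<^bsub>\<Lambda>\<^esub> (\<one>\<^bsub>\<Lambda>\<^esub> \<ominus>\<^bsub>\<Lambda>\<^esub> x [^]\<^bsub>\<Lambda>\<^esub> n)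
        = \<one>\<^bsub>\<Lambda>\<^esub> \<ominus>\<^bsub>\<Lambda>\<^esub> x [^]\<^bsub>\<Lambda>\<^esub> Suc n"
      using x by (intro L.telescope_minus) auto
    finally show ?case .
  qed
  have "(y \<otimes>\<^bsub>\<Lambda>\<^esub> b) g = \<one>\<^bsub>\<Lambda>\<^esub> g" for g
  proof -
    let ?n = "N g"
    \<comment> \<open>As \<open>y\<close> has no negative exponents, the coefficient of the product
      at \<open>g\<close> sees \<open>b\<close> only at exponents up to \<open>g\<close>.\<close>
    have eq: "b (g - h) = s ?n (g - h)" if "y h \<noteq> \<zero>" for h
    proof -
      have "0 \<le> h" using y0 that by force
      then show ?thesis using b_eq[of "g - h" ?n] N[of g] by linarith
    qed
    have "(y \<otimes>\<^bsub>\<Lambda>\<^esub> b) g = (y \<otimes>\<^bsub>\<Lambda>\<^esub> s ?n) g"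
      unfolding mult_novikov using eq coeff_closed[OF yc] coeff_closed[OF sc]
      by (intro K.finsum_cong') auto
    also have "\<dots> = (\<one>\<^bsub>\<Lambda>\<^esub> \<ominus>\<^bsub>\<Lambda>\<^esub> x [^]\<^bsub>\<Lambda>\<^esub> ?n) g" using telescope by simp
    also have "\<dots> = \<one>\<^bsub>\<Lambda>\<^esub> g \<ominus> (x [^]\<^bsub>\<Lambda>\<^esub> ?n) g"
      using x by (simp add: a_minus_def minus_novikov)
    also have "(x [^]\<^bsub>\<Lambda>\<^esub> ?n) g = \<zero>" using N by (intro pow_vanishes[OF x low]) auto
    finally show ?thesis by (simp add: a_minus_def one_novikov)
  qed
  then have "y \<otimes>\<^bsub>\<Lambda>\<^esub> b = \<one>\<^bsub>\<Lambda>\<^esub>" by auto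
  then show ?thesis using bc by (auto simp: y_def)
qed

text \<open>Dividing out the leading monomial leaves a series 1 - x in which \<open>x\<close> has
  only positive exponents. The geometric series needs more than positivity, namely a positive lower
  bound \<open>p\<close> for these exponents; it is the least exponent of \<open>x\<close>, which
  exists because \<open>x\<close> is again an element of \<Lambda>.\<close>

lemma novikov_invertible:
  assumes a: "a \<in> carrier \<Lambda>" and nz: "a \<noteq> \<zero>\<^bsub>\<Lambda>\<^esub>"
  shows "\<exists>b \<in> carrier \<Lambda>. a \<otimes>\<^bsub>\<Lambda>\<^esub> b = \<one>\<^bsub>\<Lambda>\<^esub>"
proof -
  obtain g where g: "g \<in> \<Gamma>" "a g \<noteq> \<zero>" "\<And>h. h < g \<Longrightarrow> a h = \<zero>"
    using leading_coeff[OF a nz] by metis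
  have agU: "a g \<in> Units K" using g coeff_closed[OF a] by (auto simp: K.field_Units)
  define u where "u = monom (inv (a g)) (- g)"
  have uc: "u \<in> carrier \<Lambda>" unfolding u_def using agU g by (intro monom_closed) (auto simp: uminus_in_Gamma)
  define y where "y = a \<otimes>\<^bsub>\<Lambda>\<^esub> u"
  define x where "x = \<one>\<^bsub>\<Lambda>\<^esub> \<ominus>\<^bsub>\<Lambda>\<^esub> y"
  have yc: "y \<in> carrier \<Lambda>" and xc: "x \<in> carrier \<Lambda>" using a uc by (auto simp: y_def x_def)
  have y: "y h = a (h + g) \<otimes> inv (a g)" for h
    unfolding y_def u_def using agU by (simp add: mult_monom[OF a])
  have x_le: "x h = \<zero>" if "h \<le> 0" for h
    using that yc agU a g by (cases "h = 0")
      (auto simp: x_def a_minus_def minus_novikov one_novikov y K.r_neg)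
  have "\<exists>p>0. \<forall>h<p. x h = \<zero>"
  proof (cases "x = \<zero>\<^bsub>\<Lambda>\<^esub>")
    case True
    then show ?thesis by (auto simp: zero_novikov intro: exI[of _ 1])
  next
    case False
    then obtain p where p: "x p \<noteq> \<zero>" "\<And>h. h < p \<Longrightarrow> x h = \<zero>" using leading_coeff[OF xc] by metis
    then have "p > 0" using x_le[of p] by (meson not_le)
    then show ?thesis using p by auto
  qed
  then obtain p where "p > 0" "\<And>h. h < p \<Longrightarrow> x h = \<zero>" by blast
  then obtain b where b: "b \<in> carrier \<Lambda>" "(\<one>\<^bsub>\<Lambda>\<^esub> \<ominus>\<^bsub>\<Lambda>\<^esub> x) \<otimes>\<^bsub>\<Lambda>\<^esub> b = \<one>\<^bsub>\<Lambda>\<^esub>"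
    using one_minus_invertible[OF xc] by blast
  have "\<one>\<^bsub>\<Lambda>\<^esub> \<ominus>\<^bsub>\<Lambda>\<^esub> x = y"
    using yc by (simp add: x_def a_minus_def L.minus_add L.r_neg1 L.r_neg2)
  then have "a \<otimes>\<^bsub>\<Lambda>\<^esub> (u \<otimes>\<^bsub>\<Lambda>\<^esub> b) = \<one>\<^bsub>\<Lambda>\<^esub>" using b a uc by (simp add: y_def L.m_assoc)
  then show ?thesis using uc b by (intro bexI[of _ "u \<otimes>\<^bsub>\<Lambda>\<^esub> b"]) auto
qed

sublocale V: valued_field \<Lambda> "novikov_val K"
proof -
  have "\<one>\<^bsub>\<Lambda>\<^esub> 0 \<noteq> \<zero>\<^bsub>\<Lambda>\<^esub> 0" by (simp add: one_novikov zero_novikov)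
  then have one0: "\<one>\<^bsub>\<Lambda>\<^esub> \<noteq> \<zero>\<^bsub>\<Lambda>\<^esub>" by metis
  have "field \<Lambda>"
    using novikov_invertible one0 by (intro L.cring_fieldI2) auto
  then show "valued_field \<Lambda> (novikov_val K)"
    using val_eq_infinity val_mult_novikov val_add_novikov
    by (intro valued_field.intro valued_field_axioms.intro) (auto simp: novikov_val_def[of K])
qed

section \<open>Bars of the boundary maps\<close>

text \<open>
  If there were too many \<open>w\<^sub>j\<close> of the given type, some combination \<open>v\<close> of them, with coefficients
  of the form \<open>c T\<^sup>g\<close>, would have no leading terms along the \<open>x\<^sub>i\<close> of that type.
  Then \<open>v\<close> is a sum of vectors each of which is strictly smaller than \<open>v\<close> for one of the
  two filtrations, so no \<open>w\<^sub>j\<close> can occur in \<open>v\<close> with a leading term.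
\<close>

lemma card_common_obasis_le:
  assumes M: "Module.module \<Lambda> M"
    and x: "V.obasis M l x I lam" and x': "V.obasis M l' x I lam'"
    and w: "V.obasis M l w J kap" and w': "V.obasis M l' w J kap'"
  shows "card {j \<in> J. \<exists>g\<in>\<Gamma>. kap j - g = s \<and> kap' j - g = t}
       \<le> card {i \<in> I. \<exists>g\<in>\<Gamma>. lam i - g = s \<and> lam' i - g = t}"
    (is "card ?J \<le> card ?I")
proof (rule ccontr)
  assume "\<not> card ?J \<le> card ?I"
  then have less: "card ?I < card ?J" by simp
  interpret M: Module.module \<Lambda> M by fact
  note xc = V.obasis_closed[OF x] and wc = V.obasis_closed[OF w]
    and finI = V.obasis_finite[OF x] and finJ = V.obasis_finite[OF w]
  have finI': "finite ?I" and finJ': "finite ?J" using finI finJ by auto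
  \<comment> \<open>Exponents that bring the vectors \<open>x i\<close> and \<open>w j\<close> to
    level \<open>s\<close>. For indices in \<open>?I\<close> and \<open>?J\<close> they lie in
    \<Gamma> and bring the second level to \<open>t\<close> as well.\<close>
  define h where "h = (\<lambda>i. lam i - s)"
  define g where "g = (\<lambda>j. kap j - s)"
  have g: "g j \<in> \<Gamma>" "kap j - g j = s" "kap' j - g j = t" if "j \<in> ?J" for j
    using that by (auto simp: g_def algebra_simps)
  have "\<exists>a \<in> I \<rightarrow> carrier \<Lambda>. w j = lc M a x I" if "j \<in> J" for j
    using that wc by (intro V.obasis_span[OF x]) auto
  then obtain P where P: "\<And>j. j \<in> J \<Longrightarrow> P j \<in> I \<rightarrow> carrier \<Lambda>" "\<And>j. j \<in> J \<Longrightarrow> w j = lc M (P j) x I"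
    by metis
  have "\<exists>a \<in> J \<rightarrow> carrier \<Lambda>. x i = lc M a w J" if "i \<in> I" for i
    using that xc by (intro V.obasis_span[OF w]) auto
  then obtain Q where Q: "\<And>i. i \<in> I \<Longrightarrow> Q i \<in> J \<rightarrow> carrier \<Lambda>" "\<And>i. i \<in> I \<Longrightarrow> x i = lc M (Q i) w J"
    by metis
  have Pc: "P j i \<in> carrier \<Lambda>" if "i \<in> I" "j \<in> J" for i j using P(1)[OF that(2)] that by auto
  have Qc: "Q i j \<in> carrier \<Lambda>" if "i \<in> I" "j \<in> J" for i j using Q(1)[OF that(1)] that by auto
  \<comment> \<open>A summand \<open>c j T^(g j) w j\<close> contributes
    \<open>P j i (h i - g j)\<close> times \<open>c j\<close> to the coefficient of
    \<open>x i\<close> at exponent \<open>h i\<close>. Each equation therefore kills one possible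
    leading term of the combination.\<close>
  have "\<exists>c \<in> ?J \<rightarrow> carrier K. (\<exists>j\<in>?J. c j \<noteq> \<zero>) \<and>
      (\<forall>i\<in>?I. (\<Oplus>j\<in>?J. P j i (h i - g j) \<otimes> c j) = \<zero>)"
    using Pc by (intro K.underdetermined_system finI' finJ' less) (auto intro: coeff_closed)
  then obtain c where c: "c \<in> ?J \<rightarrow> carrier K" "\<exists>j\<in>?J. c j \<noteq> \<zero>"
    "\<And>i. i \<in> ?I \<Longrightarrow> (\<Oplus>j\<in>?J. P j i (h i - g j) \<otimes> c j) = \<zero>" by blast
  have cc: "c j \<in> carrier K" if "j \<in> ?J" for j using c(1) that by blast
  define \<gamma> where "\<gamma> = (\<lambda>j. monom (c j) (g j))"
  define \<gamma>' where "\<gamma>' = (\<lambda>j. if j \<in> ?J then \<gamma> j else \<zero>\<^bsub>\<Lambda>\<^esub>)"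
  have \<gamma>c: "\<gamma> j \<in> carrier \<Lambda>" if "j \<in> ?J" for j
    unfolding \<gamma>_def using that g cc by (intro monom_closed) auto
  have \<gamma>'c: "\<gamma>' \<in> J \<rightarrow> carrier \<Lambda>" using \<gamma>c by (auto simp: \<gamma>'_def)
  have \<gamma>_val: "ereal (g j) \<le> novikov_val K (\<gamma> j)" if "j \<in> ?J" for j
    using \<gamma>c[OF that] by (intro val_geI) (auto simp: \<gamma>_def monom_def)
  define v where "v = lc M \<gamma> w ?J"
  define b where "b = (\<lambda>i. \<Oplus>\<^bsub>\<Lambda>\<^esub>j\<in>?J. \<gamma> j \<otimes>\<^bsub>\<Lambda>\<^esub> P j i)"
  have bc: "b i \<in> carrier \<Lambda>" if "i \<in> I" for i
    unfolding b_def using \<gamma>c Pc that by (intro L.finsum_closed) auto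
  have bI: "b \<in> I \<rightarrow> carrier \<Lambda>" using bc by auto
  have v_b: "v = lc M b x I"
  proof -
    have "v = lc M \<gamma> (\<lambda>j. lc M (P j) x I) ?J"
      unfolding v_def using \<gamma>c P xc by (intro M.lc_cong) auto
    also have "\<dots> = lc M b x I"
      unfolding b_def using \<gamma>c P xc finI finJ' by (intro M.lc_lc) auto
    finally show ?thesis .
  qed
  have v_\<gamma>': "v = lc M \<gamma>' w J"
  proof -
    have "v = lc M \<gamma>' w ?J"
      unfolding v_def using \<gamma>c wc by (intro M.lc_cong) (auto simp: \<gamma>'_def)
    also have "\<dots> = lc M \<gamma>' w J"
      using finJ \<gamma>'c wc by (intro M.lc_mono_neutral) (auto simp: \<gamma>'_def)
    finally show ?thesis .
  qed
  have b0: "b i (h i) = \<zero>" if i: "i \<in> ?I" for i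
  proof -
    have "b i (h i) = (\<Oplus>j\<in>?J. (\<gamma> j \<otimes>\<^bsub>\<Lambda>\<^esub> P j i) (h i))"
      unfolding b_def using \<gamma>c Pc i finJ' by (intro finsum_novikov) auto
    also have "\<dots> = (\<Oplus>j\<in>?J. P j i (h i - g j) \<otimes> c j)"
    proof (rule K.finsum_cong')
      fix j assume j: "j \<in> ?J"
      then have Pji: "P j i \<in> carrier \<Lambda>" using i Pc by auto
      then have "\<gamma> j \<otimes>\<^bsub>\<Lambda>\<^esub> P j i = P j i \<otimes>\<^bsub>\<Lambda>\<^esub> \<gamma> j" using \<gamma>c[OF j] by (intro L.m_comm)
      then show "(\<gamma> j \<otimes>\<^bsub>\<Lambda>\<^esub> P j i) (h i) = P j i (h i - g j) \<otimes> c j"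
        using mult_monom[OF Pji cc[OF j]] by (simp add: \<gamma>_def)
    qed (use cc Pc i coeff_closed in auto)
    also have "\<dots> = \<zero>" using c(3) i by blast
    finally show ?thesis .
  qed
  have bound: "ereal \<kappa> - novikov_val K (\<gamma>' j) \<le> ereal q"
    if "j \<in> J" "j \<in> ?J \<Longrightarrow> \<kappa> - g j = q" for \<kappa> q j
  proof (cases "j \<in> ?J")
    case True
    then show ?thesis using \<gamma>_val[OF True] that(2)[OF True] unfolding \<gamma>'_def
      by (cases "novikov_val K (\<gamma> j)") auto
  next
    case False
    then have "\<gamma>' j = \<zero>\<^bsub>\<Lambda>\<^esub>" unfolding \<gamma>'_def by (rule if_not_P)
    then show ?thesis by (simp add: val_zero_novikov)
  qed
  have lv: "l v \<le> ereal s"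
    unfolding v_\<gamma>' V.obasis_norm[OF w \<gamma>'c] using g by (intro SUP_least bound) auto
  have l'v: "l' v \<le> ereal t"
    unfolding v_\<gamma>' V.obasis_norm[OF w' \<gamma>'c] using g by (intro SUP_least bound) auto
  \<comment> \<open>Were both terms at full level, the leading exponent of \<open>b i\<close> would
    be \<open>h i\<close> with \<open>i\<close> in \<open>?I\<close>, but there the coefficient is
    zero by \<open>b0\<close>.\<close>
  have small: "ereal (lam i) - novikov_val K (b i) < ereal s \<or> ereal (lam' i) - novikov_val K (b i) < ereal t"
    if i: "i \<in> I" for i
  proof (rule ccontr)
    assume "\<not> ?thesis"
    moreover have "ereal (lam i) - novikov_val K (b i) \<le> ereal s"
      using V.obasis_term_le[OF x bI i] lv v_b by simp
    moreover have "ereal (lam' i) - novikov_val K (b i) \<le> ereal t"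
      using V.obasis_term_le[OF x' bI i] l'v v_b by simp
    ultimately have eq: "ereal (lam i) - novikov_val K (b i) = ereal s"
      "ereal (lam' i) - novikov_val K (b i) = ereal t" by auto
    then have "b i \<noteq> \<zero>\<^bsub>\<Lambda>\<^esub>" by (auto simp: val_zero_novikov)
    then obtain p where p: "p \<in> \<Gamma>" "novikov_val K (b i) = ereal p" "b i p \<noteq> \<zero>"
      using leading_coeff[OF bc[OF i]] by metis
    then have "lam i - p = s" "lam' i - p = t" using eq by auto
    then have "i \<in> ?I" "h i = p" using i p by (auto simp: h_def)
    then show False using b0 p by auto
  qed
  \<comment> \<open>Orthogonality of \<open>w\<close> bounds each coordinate of the vector
    \<open>b i\<close> times \<open>x i\<close> by the levels of that vector. Strict inequality for
    one filtration suffices, since at \<open>w j\<close> the exponent \<open>g j\<close> stands for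
    level \<open>s\<close> in the first filtration and for \<open>t\<close> in the second.\<close>
  have bQ: "(b i \<otimes>\<^bsub>\<Lambda>\<^esub> Q i j) (g j) = \<zero>" if i: "i \<in> I" and j: "j \<in> ?J" for i j
  proof -
    have jJ: "j \<in> J" using j by auto
    let ?d = "\<lambda>j. b i \<otimes>\<^bsub>\<Lambda>\<^esub> Q i j"
    have dc: "?d \<in> J \<rightarrow> carrier \<Lambda>" using bc[OF i] Qc[OF i] by auto
    have u: "b i \<odot>\<^bsub>M\<^esub> x i = lc M ?d w J"
      using bc[OF i] Q[OF i] wc finJ by (subst M.lc_smult) auto
    have "ereal (kap j) - novikov_val K (?d j) \<le> ereal (lam i) - novikov_val K (b i)"
      using V.obasis_term_le[OF w dc jJ] V.obasis_norm_smult[OF M x i bc[OF i]] u by simp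
    moreover have "ereal (kap' j) - novikov_val K (?d j) \<le> ereal (lam' i) - novikov_val K (b i)"
      using V.obasis_term_le[OF w' dc jJ] V.obasis_norm_smult[OF M x' i bc[OF i]] u by simp
    ultimately have "ereal (kap j) - novikov_val K (?d j) < ereal s \<or>
        ereal (kap' j) - novikov_val K (?d j) < ereal t"
      using small[OF i] by (meson order_le_less_trans)
    then have "ereal (g j) < novikov_val K (?d j)"
      using g(2,3)[OF j] by (cases "novikov_val K (?d j)") auto
    then show ?thesis using dc jJ by (intro coeff_below_val) auto
  qed
  have v_Q: "v = lc M (\<lambda>j. \<Oplus>\<^bsub>\<Lambda>\<^esub>i\<in>I. b i \<otimes>\<^bsub>\<Lambda>\<^esub> Q i j) w J"
  proof -
    have "v = lc M b (\<lambda>i. lc M (Q i) w J) I"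
      unfolding v_b using bI Q wc by (intro M.lc_cong) auto
    also have "\<dots> = lc M (\<lambda>j. \<Oplus>\<^bsub>\<Lambda>\<^esub>i\<in>I. b i \<otimes>\<^bsub>\<Lambda>\<^esub> Q i j) w J"
      using bI Q wc finI finJ by (intro M.lc_lc) auto
    finally show ?thesis .
  qed
  have "c j = \<zero>" if j: "j \<in> ?J" for j
  proof -
    have jJ: "j \<in> J" using j by auto
    have "\<gamma>' j = (\<Oplus>\<^bsub>\<Lambda>\<^esub>i\<in>I. b i \<otimes>\<^bsub>\<Lambda>\<^esub> Q i j)"
      using v_Q v_\<gamma>' bc Qc jJ
      by (intro V.obasis_unique[OF M w \<gamma>'c, of "\<lambda>j. \<Oplus>\<^bsub>\<Lambda>\<^esub>i\<in>I. b i \<otimes>\<^bsub>\<Lambda>\<^esub> Q i j"])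
         (auto intro!: L.finsum_closed)
    then have "\<gamma> j (g j) = (\<Oplus>\<^bsub>\<Lambda>\<^esub>i\<in>I. b i \<otimes>\<^bsub>\<Lambda>\<^esub> Q i j) (g j)" using j by (simp add: \<gamma>'_def)
    also have "\<dots> = (\<Oplus>i\<in>I. (b i \<otimes>\<^bsub>\<Lambda>\<^esub> Q i j) (g j))"
      using bc Qc jJ finI by (intro finsum_novikov) auto
    also have "\<dots> = \<zero>" using bQ j by (intro K.add.finprod_one_eqI) auto
    finally show ?thesis by (simp add: \<gamma>_def monom_def)
  qed
  then show False using c(2) by blast
qed

lemma card_common_obasis_eq:
  assumes M: "Module.module \<Lambda> M"
    and x: "V.obasis M l x I lam" and x': "V.obasis M l' x I lam'"
    and w: "V.obasis M l w J kap" and w': "V.obasis M l' w J kap'"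
  shows "card {j \<in> J. \<exists>g\<in>\<Gamma>. kap j - g = s \<and> kap' j - g = t}
       = card {i \<in> I. \<exists>g\<in>\<Gamma>. lam i - g = s \<and> lam' i - g = t}"
  using card_common_obasis_le[OF M x x' w w'] card_common_obasis_le[OF M w w' x x'] by (rule antisym)

section \<open>Cosets and the counting of bars\<close>

abbreviation coset :: "real \<Rightarrow> real set" where "coset a \<equiv> \<Gamma> #>\<^bsub>real_add_group\<^esub> a"

lemma coset_eq_iff: "coset a = coset b \<longleftrightarrow> a - b \<in> \<Gamma>"
proof -
  have mem: "x \<in> coset y \<longleftrightarrow> x - y \<in> \<Gamma>" for x y
    by (auto simp: r_coset_def real_add_group_def algebra_simps intro: bexI[of _ "x - y"])
  show ?thesis
  proof
    assume "coset a = coset b"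
    then have "a \<in> coset b" using mem[of a a] by simp
    then show "a - b \<in> \<Gamma>" by (simp add: mem)
  next
    assume ab: "a - b \<in> \<Gamma>"
    have "x - a \<in> \<Gamma> \<longleftrightarrow> x - b \<in> \<Gamma>" for x
      using add_in_Gamma[OF _ ab, of "x - a"] diff_in_Gamma[OF _ ab, of "x - b"] by auto
    then show "coset a = coset b" by (auto simp: mem)
  qed
qed

text \<open>The barcode with the vectors forgotten: only real levels enter, and these are what the
  counting lemmas compare.\<close>

definition bars :: "nat \<Rightarrow> (nat \<Rightarrow> real) \<Rightarrow> nat \<Rightarrow> (nat \<Rightarrow> real) \<Rightarrow> (real set \<times> ereal) multiset" where
  "bars r mu m lam = image_mset (\<lambda>i. (coset (lam i), if i < r then ereal (mu i - lam i) else \<infinity>))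
     (mset_set {..<m})"

lemma count_bars: "count (bars r mu m lam) z
    = card {i \<in> {..<m}. (coset (lam i), if i < r then ereal (mu i - lam i) else \<infinity>) = z}"
  by (simp add: bars_def count_image_mset vimage_def) (auto intro!: arg_cong[where f = card])

text \<open>A common shift by an element of \<Gamma> does not alter a gap, so a bar of length
  \<open>t\<close> in the class of \<open>s\<close> is a pair of levels \<open>s\<close>,
  \<open>s + t\<close> up to such a shift. In this form \<open>card_common_obasis_eq\<close>
  applies.\<close>

lemma count_bars_finite:
  assumes "r \<le> m"
  shows "count (bars r mu m lam) (coset s, ereal t)
    = card {i \<in> {..<r}. \<exists>g\<in>\<Gamma>. lam i - g = s \<and> mu i - g = s + t}"
proof -
  have *: "(\<exists>g\<in>\<Gamma>. a - g = s \<and> b - g = s + t) \<longleftrightarrow> a - s \<in> \<Gamma> \<and> b - a = t" for a b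
    by (auto intro!: bexI[of _ "a - s"])
  show ?thesis unfolding count_bars *
    using assms by (intro arg_cong[where f = card]) (auto simp: coset_eq_iff split: if_splits)
qed

text \<open>Infinite bars are what remains of all \<open>lam i\<close> in the class of
  \<open>s\<close> once those with \<open>i < r\<close> are removed. The doubled condition puts both
  counts in the shape of \<open>card_common_obasis_eq\<close> with one filtration taken
  twice.\<close>

lemma count_bars_infinite:
  assumes "r \<le> m"
  shows "count (bars r mu m lam) (coset s, \<infinity>)
    = card {i \<in> {..<m}. \<exists>g\<in>\<Gamma>. lam i - g = s \<and> lam i - g = s}
      - card {i \<in> {..<r}. \<exists>g\<in>\<Gamma>. lam i - g = s \<and> lam i - g = s}"
proof -
  have *: "(\<exists>g\<in>\<Gamma>. a - g = s \<and> a - g = s) \<longleftrightarrow> a - s \<in> \<Gamma>" for a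
    by (auto intro!: bexI[of _ "a - s"])
  have "card {i \<in> {..<m}. lam i - s \<in> \<Gamma>} - card {i \<in> {..<r}. lam i - s \<in> \<Gamma>}
      = card ({i \<in> {..<m}. lam i - s \<in> \<Gamma>} - {i \<in> {..<r}. lam i - s \<in> \<Gamma>})"
    using assms by (intro card_Diff_subset [symmetric]) auto
  also have "\<dots> = count (bars r mu m lam) (coset s, \<infinity>)"
    unfolding count_bars by (intro arg_cong[where f = card]) (auto simp: coset_eq_iff split: if_splits)
  finally show ?thesis unfolding * ..
qed

text \<open>Finite bars are compared on the image, with the given and the quotient filtration. For
  infinite bars the given filtration is used alone, once on the image and once on all of
  \<open>N\<close>. Labels of any other kind have count zero on both sides.\<close>

lemma bars_unique:
  assumes M: "Module.module \<Lambda> M" and N: "Module.module \<Lambda> N" and A: "linear_map \<Lambda> M N A"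
    and sb: "V.singular_bases M lM N lN A r n y mu m x lam"
    and sb': "V.singular_bases M lM N lN A r' n' y' mu' m' x' lam'"
  shows "bars r mu m lam = bars r' mu' m' lam'"
proof (rule multiset_eqI)
  fix z :: "real set \<times> ereal"
  note im = V.obasis_image[OF M N A sb] and im' = V.obasis_image[OF M N A sb']
    and qn = V.obasis_quotient_norm[OF M N A sb] and qn' = V.obasis_quotient_norm[OF M N A sb']
    and imM = image_space_module[OF M N A]
  from sb have x: "V.obasis N lN x {..<m} lam" and r: "r \<le> m" by (auto simp: V.singular_bases_def)
  from sb' have x': "V.obasis N lN x' {..<m'} lam'" and r': "r' \<le> m'" by (auto simp: V.singular_bases_def)
  show "count (bars r mu m lam) z = count (bars r' mu' m' lam') z"
  proof (cases "\<exists>s. fst z = coset s")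
    case False
    then have "(coset (lam i), b) \<noteq> z" "(coset (lam' i), b) \<noteq> z" for i b by auto
    then show ?thesis unfolding count_bars by simp
  next
    case True
    then obtain s where s: "fst z = coset s" by blast
    show ?thesis
    proof (cases "snd z")
      case (real t)
      then have "z = (coset s, ereal t)" using s by (simp add: prod_eq_iff)
      then show ?thesis
        using card_common_obasis_eq[OF imM im' qn' im qn] by (simp add: count_bars_finite r r')
    next
      case PInf
      then have "z = (coset s, \<infinity>)" using s by (simp add: prod_eq_iff)
      then show ?thesis
        unfolding \<open>z = (coset s, \<infinity>)\<close> count_bars_infinite[OF r] count_bars_infinite[OF r']
        using card_common_obasis_eq[OF imM im' im' im im, of s s]
          card_common_obasis_eq[OF N x' x' x x, of s s] by simp
    next
      case MInf
      then have "(coset (lam i), if i < r then ereal (mu i - lam i) else \<infinity>) \<noteq> z"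
        "(coset (lam' i), if i < r' then ereal (mu' i - lam' i) else \<infinity>) \<noteq> z" for i by auto
      then show ?thesis unfolding count_bars by simp
    qed
  qed
qed

text \<open>The label \<infinity> is never a real gap, so a matching of equal labels sends finite
  bars to finite bars. Equal gaps then force the shift between the \<open>lam\<close> values to be
  the shift between the \<open>mu\<close> values as well.\<close>

lemma matching_of_bars:
  assumes eq: "bars r mu m lam = bars r' mu' m' lam'" and r: "r \<le> m" and r': "r' \<le> m'"
  obtains \<sigma> where "bij_betw \<sigma> {..<m} {..<m'}" "bij_betw \<sigma> {..<r} {..<r'}"
    "\<And>i. i < m \<Longrightarrow> lam' (\<sigma> i) - lam i \<in> \<Gamma>"
    "\<And>i. i < r \<Longrightarrow> mu' (\<sigma> i) - (lam' (\<sigma> i) - lam i) = mu i"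
proof -
  obtain \<sigma> where \<sigma>: "bij_betw \<sigma> {..<m} {..<m'}"
    and f: "\<And>i. i < m \<Longrightarrow> (coset (lam i), if i < r then ereal (mu i - lam i) else \<infinity>)
      = (coset (lam' (\<sigma> i)), if \<sigma> i < r' then ereal (mu' (\<sigma> i) - lam' (\<sigma> i)) else \<infinity>)"
    using eq unfolding bars_def by (rule image_mset_eq_imp_bij) blast
  have \<Gamma>: "lam' (\<sigma> i) - lam i \<in> \<Gamma>" if "i < m" for i
  proof -
    have "coset (lam' (\<sigma> i)) = coset (lam i)" using f[OF that] by simp
    then show ?thesis by (simp add: coset_eq_iff)
  qed
  have less: "i < r \<longleftrightarrow> \<sigma> i < r'" if "i < m" for i using f[OF that] by (auto split: if_splits)
  have "mu' (\<sigma> i) - (lam' (\<sigma> i) - lam i) = mu i" if "i < r" for i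
    using f[of i] less[of i] that r by simp
  moreover have "bij_betw \<sigma> {..<r} {..<r'}"
  proof (rule bij_betw_imageI)
    show "inj_on \<sigma> {..<r}"
      using \<sigma> r by (auto simp: bij_betw_def intro: inj_on_subset)
    show "\<sigma> ` {..<r} = {..<r'}"
    proof
      have "\<sigma> i < r'" if "i < r" for i using less[of i] that r by simp
      then show "\<sigma> ` {..<r} \<subseteq> {..<r'}" by auto
      show "{..<r'} \<subseteq> \<sigma> ` {..<r}"
      proof
        fix j assume j: "j \<in> {..<r'}"
        then have "j \<in> \<sigma> ` {..<m}" using \<sigma> r' by (auto simp: bij_betw_def)
        then show "j \<in> \<sigma> ` {..<r}" using j less by auto
      qed
    qed
  qed
  ultimately show thesis using that \<sigma> \<Gamma> by blast
qed

section \<open>Floer-type complexes, their cycles and their barcodes\<close>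

lemma floer_complexD:
  assumes "floer_complex K \<Gamma> C"
  shows chain_normed: "V.normed_module (chain_space C k) (filt C k)"
    and chain_module: "Module.module \<Lambda> (chain_space C k)"
    and bdry_linear: "linear_map \<Lambda> (chain_space C k) (chain_space C (k - 1)) (bdry C k)"
    and bdry_bdry: "x \<in> carrier (chain_space C k) \<Longrightarrow>
      bdry C (k - 1) (bdry C k x) = \<zero>\<^bsub>chain_space C (k - 2)\<^esub>"
    and chain_obasis: "\<exists>n e lam. V.obasis (chain_space C k) (filt C k) e {..<n::nat} lam"
proof -
  have os: "orthogonalizable_space K \<Gamma> (chain_space C k) (filt C k)"
    using assms by (auto simp: floer_complex_def)
  then show n: "V.normed_module (chain_space C k) (filt C k)"
    by (auto simp: orthogonalizable_space_def nonarch_normed_space_def V.normed_module_def)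
  then show "Module.module \<Lambda> (chain_space C k)" by (simp add: V.normed_module_def)
  obtain ws where "orthogonal_basis \<Lambda> (chain_space C k) (filt C k) ws"
    using os by (auto simp: orthogonalizable_space_def)
  from V.orthogonal_basis_imp_obasis[OF n this]
  show "\<exists>n e lam. V.obasis (chain_space C k) (filt C k) e {..<n::nat} lam" by blast
qed (use assms in \<open>auto simp: floer_complex_def\<close>)

lemma cycle_space_normed:
  assumes "floer_complex K \<Gamma> C"
  shows "V.normed_module (cycle_space C k) (filt C k)"
  unfolding cycle_space_def
  by (rule V.normed_module_kernel[OF chain_normed[OF assms] chain_module[OF assms] bdry_linear[OF assms]])

lemma cycle_space_module:
  "floer_complex K \<Gamma> C \<Longrightarrow> Module.module \<Lambda> (cycle_space C k)"
  using cycle_space_normed[of C k] by (simp add: V.normed_module_def)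

lemma carrier_cycle_space:
  "carrier (cycle_space C k)
    = {x \<in> carrier (chain_space C k). bdry C k x = \<zero>\<^bsub>chain_space C (k - 1)\<^esub>}"
  by (simp add: cycle_space_def kernel_space_def)

lemma bdry_linear_cycle:
  assumes C: "floer_complex K \<Gamma> C"
  shows "linear_map \<Lambda> (chain_space C (k + 1)) (cycle_space C k) (bdry C (k + 1))"
proof -
  have lin: "linear_map \<Lambda> (chain_space C (k + 1)) (chain_space C k) (bdry C (k + 1))"
    using bdry_linear[OF C, of "k + 1"] by simp
  show ?thesis
  proof (rule linear_mapI)
    fix x assume x: "x \<in> carrier (chain_space C (k + 1))"
    have "bdry C k (bdry C (k + 1) x) = \<zero>\<^bsub>chain_space C (k - 1)\<^esub>"
      using bdry_bdry[OF C x] by (simp add: algebra_simps)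
    then show "bdry C (k + 1) x \<in> carrier (cycle_space C k)"
      using linear_map_closed[OF lin x] by (simp add: carrier_cycle_space)
  qed (use linear_map_add[OF lin] linear_map_smult[OF lin] in
        \<open>auto simp: cycle_space_def kernel_space_def\<close>)
qed

text \<open>Decomposing the boundary map into the full chain space supplies an orthogonal basis of
  its kernel. This has to come first, because the barcode decomposes a map into the cycles and
  \<open>ex_svd\<close> asks for a basis of the target.\<close>

lemma cycle_obasis:
  assumes C: "floer_complex K \<Gamma> C"
  shows "\<exists>n e lam. V.obasis (cycle_space C k) (filt C k) e {..<n::nat} lam"
proof -
  note M = chain_module[OF C, of k] and N = chain_module[OF C, of "k - 1"] and A = bdry_linear[OF C, of k]
  obtain n e lam where e: "V.obasis (chain_space C k) (filt C k) e {..<n::nat} lam"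
    using chain_obasis[OF C] by blast
  obtain n' e' lam' where e': "V.obasis (chain_space C (k - 1)) (filt C (k - 1)) e' {..<n'::nat} lam'"
    using chain_obasis[OF C] by blast
  obtain ys xs where "is_svd \<Lambda> (chain_space C k) (filt C k) (chain_space C (k - 1)) (filt C (k - 1))
      (bdry C k) ys xs"
    using V.ex_svd[OF M N A e e'] by blast
  then have "\<exists>ws. orthogonal_basis \<Lambda> (cycle_space C k) (filt C k) ws"
    by (auto simp: is_svd_def Let_def cycle_space_def)
  then show ?thesis using V.orthogonal_basis_imp_obasis[OF cycle_space_normed[OF C]] by blast
qed

text \<open>The index is that of the barcode: the family \<open>y\<close> lives in degree
  \<open>k + 1\<close> and the family \<open>x\<close> in degree \<open>k\<close>.\<close>

abbreviation boundary_bases ::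
    "('k, 'v) filtered_complex \<Rightarrow> int \<Rightarrow> nat \<Rightarrow> nat \<Rightarrow> (nat \<Rightarrow> 'v) \<Rightarrow> (nat \<Rightarrow> real) \<Rightarrow>
     nat \<Rightarrow> (nat \<Rightarrow> 'v) \<Rightarrow> (nat \<Rightarrow> real) \<Rightarrow> bool" where
  "boundary_bases C k \<equiv> V.singular_bases (chain_space C (k + 1)) (filt C (k + 1))
     (cycle_space C k) (filt C k) (bdry C (k + 1))"

lemma ex_boundary_svd:
  assumes C: "floer_complex K \<Gamma> C"
  shows "\<exists>ys xs. is_svd \<Lambda> (chain_space C (k + 1)) (filt C (k + 1)) (cycle_space C k) (filt C k)
    (bdry C (k + 1)) ys xs"
proof -
  obtain n e lam where e: "V.obasis (chain_space C (k + 1)) (filt C (k + 1)) e {..<n::nat} lam"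
    using chain_obasis[OF C] by blast
  obtain n' e' lam' where e': "V.obasis (cycle_space C k) (filt C k) e' {..<n'::nat} lam'"
    using cycle_obasis[OF C] by blast
  show ?thesis
    by (rule V.ex_svd[OF chain_module[OF C] cycle_space_module[OF C] bdry_linear_cycle[OF C] e e'])
qed

text \<open>Existence of a decomposition guarantees that the \<open>SOME\<close> in
  \<open>verbose_barcode\<close> picks one; basis vectors have real levels, so the gaps can be
  computed in the reals.\<close>

lemma verbose_barcode_bars:
  assumes C: "floer_complex K \<Gamma> C"
  shows "\<exists>r n y mu m x lam. boundary_bases C k r n y mu m x lam \<and>
    verbose_barcode K \<Gamma> C k = bars r mu m lam"
proof -
  let ?svd = "is_svd \<Lambda> (chain_space C (k + 1)) (filt C (k + 1)) (cycle_space C k) (filt C k)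
    (bdry C (k + 1))"
  let ?r = "map_rank \<Lambda> (chain_space C (k + 1)) (cycle_space C k) (bdry C (k + 1))"
  obtain ys xs where svd: "(SOME (ys, xs). ?svd ys xs) = (ys, xs)" by fastforce
  obtain ys0 xs0 where "?svd ys0 xs0" using ex_boundary_svd[OF C] by blast
  then have "\<exists>p. case p of (ys, xs) \<Rightarrow> ?svd ys xs" by (intro exI[of _ "(ys0, xs0)"]) simp
  from someI_ex[OF this] have "?svd ys xs" unfolding svd by simp
  from V.is_svd_imp_singular_bases[OF chain_normed[OF C] cycle_space_normed[OF C] bdry_linear_cycle[OF C] this]
  have sb: "boundary_bases C k ?r (length ys) ((!) ys) (\<lambda>i. real_of_ereal (filt C (k + 1) (ys ! i)))
      (length xs) ((!) xs) (\<lambda>i. real_of_ereal (filt C k (xs ! i)))" .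
  then have y: "V.obasis (chain_space C (k + 1)) (filt C (k + 1)) ((!) ys) {..<length ys}
        (\<lambda>i. real_of_ereal (filt C (k + 1) (ys ! i)))"
    and x: "V.obasis (cycle_space C k) (filt C k) ((!) xs) {..<length xs}
        (\<lambda>i. real_of_ereal (filt C k (xs ! i)))"
    and r: "?r \<le> length ys"
    by (auto simp: V.singular_bases_def)
  have "filt C (k + 1) (ys ! i) - filt C k (xs ! i)
      = ereal (real_of_ereal (filt C (k + 1) (ys ! i)) - real_of_ereal (filt C k (xs ! i)))"
    if i: "i < ?r" "i < length xs" for i
  proof -
    have "i < length ys" using i r by simp
    then obtain a where "filt C (k + 1) (ys ! i) = ereal a"
      using V.obasis_norm_basis[OF chain_module[OF C] y, of i] by blast
    moreover obtain b where "filt C k (xs ! i) = ereal b"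
      using V.obasis_norm_basis[OF cycle_space_module[OF C] x, of i] i by blast
    ultimately show ?thesis by simp
  qed
  then have "verbose_barcode K \<Gamma> C k = bars ?r (\<lambda>i. real_of_ereal (filt C (k + 1) (ys ! i)))
      (length xs) (\<lambda>i. real_of_ereal (filt C k (xs ! i)))"
    unfolding verbose_barcode_def svd bars_of_svd_def bars_def prod.case Let_def
    by (intro image_mset_cong) auto
  then show ?thesis using sb by blast
qed

text \<open>Removes the choice: the barcode may be computed from any boundary bases, even ones whose
  gaps are not sorted.\<close>

lemma verbose_barcode_eq:
  assumes C: "floer_complex K \<Gamma> C" and sb: "boundary_bases C k r n y mu m x lam"
  shows "verbose_barcode K \<Gamma> C k = bars r mu m lam"
  using verbose_barcode_bars[OF C, of k]
    bars_unique[OF chain_module[OF C] cycle_space_module[OF C] bdry_linear_cycle[OF C] _ sb] by metis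

section \<open>Isomorphic complexes have equal barcodes\<close>

lemma isometry_singular_bases:
  assumes M: "Module.module \<Lambda> M" and N: "Module.module \<Lambda> N" and A: "linear_map \<Lambda> M N A"
    and M': "Module.module \<Lambda> M'" and N': "Module.module \<Lambda> N'"
    and \<phi>: "V.isometry_onto M lM M' lM' \<phi>" and \<psi>: "V.isometry_onto N lN N' lN' \<psi>"
    and comm: "\<And>v. v \<in> carrier M \<Longrightarrow> \<psi> (A v) = A' (\<phi> v)"
    and sb: "V.singular_bases M lM N lN A r n y mu m x lam"
  shows "V.singular_bases M' lM' N' lN' A' r n (\<lambda>i. \<phi> (y i)) mu m (\<lambda>i. \<psi> (x i)) lam"
proof -
  from sb have y: "V.obasis M lM y {..<n} mu" and x: "V.obasis N lN x {..<m} lam"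
    and r: "r \<le> n" "r \<le> m"
    and Ay: "\<And>i. i < r \<Longrightarrow> A (y i) = x i" "\<And>i. r \<le> i \<Longrightarrow> i < n \<Longrightarrow> A (y i) = \<zero>\<^bsub>N\<^esub>"
    by (auto simp: V.singular_bases_def)
  have yc: "y i \<in> carrier M" if "i < n" for i using V.obasis_closed[OF y] that by auto
  have \<psi>0: "\<psi> \<zero>\<^bsub>N\<^esub> = \<zero>\<^bsub>N'\<^esub>"
    using \<psi> by (intro linear_map_zero[OF N N']) (simp add: V.isometry_onto_def)
  have "A' (\<phi> (y i)) = \<psi> (x i)" if "i < r" for i
    using comm[OF yc, of i] Ay(1)[of i] that r by simp
  moreover have "A' (\<phi> (y i)) = \<zero>\<^bsub>N'\<^esub>" if "r \<le> i" "i < n" for i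
    using comm[OF yc, of i] Ay(2)[of i] that \<psi>0 by simp
  ultimately show ?thesis
    using V.obasis_transport[OF M M' y \<phi>] V.obasis_transport[OF N N' x \<psi>] r
    by (auto simp: V.singular_bases_def)
qed

lemma filtered_chain_iso_isometry:
  assumes "filtered_chain_iso K \<Gamma> C D \<Phi>"
  shows "V.isometry_onto (chain_space C k) (filt C k) (chain_space D k) (filt D k) (\<Phi> k)"
  using assms by (simp add: filtered_chain_iso_def V.isometry_onto_def)

lemma filtered_chain_iso_cycles:
  assumes C: "floer_complex K \<Gamma> C" and D: "floer_complex K \<Gamma> D"
    and iso: "filtered_chain_iso K \<Gamma> C D \<Phi>"
  shows "V.isometry_onto (cycle_space C k) (filt C k) (cycle_space D k) (filt D k) (\<Phi> k)"
proof -
  from iso have lin: "\<And>k. linear_map \<Lambda> (chain_space C k) (chain_space D k) (\<Phi> k)"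
    and bij: "\<And>k. bij_betw (\<Phi> k) (carrier (chain_space C k)) (carrier (chain_space D k))"
    and comm: "\<And>k x. x \<in> carrier (chain_space C k) \<Longrightarrow> \<Phi> (k - 1) (bdry C k x) = bdry D k (\<Phi> k x)"
    and filt: "\<And>k x. x \<in> carrier (chain_space C k) \<Longrightarrow> filt D k (\<Phi> k x) = filt C k x"
    by (auto simp: filtered_chain_iso_def)
  have zero: "\<Phi> j \<zero>\<^bsub>chain_space C j\<^esub> = \<zero>\<^bsub>chain_space D j\<^esub>" for j
    by (rule linear_map_zero[OF chain_module[OF C] chain_module[OF D] lin])
  have zc: "\<zero>\<^bsub>chain_space C j\<^esub> \<in> carrier (chain_space C j)" for j
  proof -
    interpret Module.module \<Lambda> "chain_space C j" by (rule chain_module[OF C])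
    show ?thesis by (rule M.zero_closed)
  qed
  \<comment> \<open>That nothing but cycles goes to cycles rests on injectivity of
    \<open>\<Phi> (k - 1)\<close>, one degree lower; surjectivity onto the cycles of
    \<open>D\<close> depends on it.\<close>
  have cycle_iff: "\<Phi> k x \<in> carrier (cycle_space D k) \<longleftrightarrow> x \<in> carrier (cycle_space C k)"
    if x: "x \<in> carrier (chain_space C k)" for x
  proof -
    have bx: "bdry C k x \<in> carrier (chain_space C (k - 1))"
      using linear_map_closed[OF bdry_linear[OF C] x] .
    have "\<Phi> k x \<in> carrier (cycle_space D k) \<longleftrightarrow> \<Phi> (k - 1) (bdry C k x) = \<Phi> (k - 1) \<zero>\<^bsub>chain_space C (k - 1)\<^esub>"
      using comm[OF x] linear_map_closed[OF lin x] by (simp add: carrier_cycle_space zero)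
    also have "\<dots> \<longleftrightarrow> bdry C k x = \<zero>\<^bsub>chain_space C (k - 1)\<^esub>"
      using inj_on_eq_iff[OF bij_betw_imp_inj_on[OF bij] bx zc] .
    finally show ?thesis using x by (simp add: carrier_cycle_space)
  qed
  have "linear_map \<Lambda> (cycle_space C k) (cycle_space D k) (\<Phi> k)"
  proof (rule linear_mapI)
    fix x assume "x \<in> carrier (cycle_space C k)"
    then show "\<Phi> k x \<in> carrier (cycle_space D k)" using cycle_iff by (simp add: carrier_cycle_space)
  qed (use linear_map_add[OF lin] linear_map_smult[OF lin] in
        \<open>auto simp: cycle_space_def kernel_space_def\<close>)
  moreover have "bij_betw (\<Phi> k) (carrier (cycle_space C k)) (carrier (cycle_space D k))"
  proof (rule bij_betw_imageI)
    show "inj_on (\<Phi> k) (carrier (cycle_space C k))"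
      by (rule inj_on_subset[OF bij_betw_imp_inj_on[OF bij]]) (auto simp: carrier_cycle_space)
    show "\<Phi> k ` carrier (cycle_space C k) = carrier (cycle_space D k)"
    proof
      show "\<Phi> k ` carrier (cycle_space C k) \<subseteq> carrier (cycle_space D k)"
        using cycle_iff by (auto simp: carrier_cycle_space)
      show "carrier (cycle_space D k) \<subseteq> \<Phi> k ` carrier (cycle_space C k)"
      proof
        fix z assume z: "z \<in> carrier (cycle_space D k)"
        then have "z \<in> \<Phi> k ` carrier (chain_space C k)"
          using bij_betw_imp_surj_on[OF bij] by (simp add: carrier_cycle_space)
        then obtain x where "x \<in> carrier (chain_space C k)" "z = \<Phi> k x" by blast
        then show "z \<in> \<Phi> k ` carrier (cycle_space C k)" using cycle_iff z by blast
      qed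
    qed
  qed
  ultimately show ?thesis using filt by (auto simp: V.isometry_onto_def carrier_cycle_space)
qed

lemma isomorphic_imp_barcodes_eq:
  assumes C: "floer_complex K \<Gamma> C" and D: "floer_complex K \<Gamma> D"
    and iso: "filtered_chain_iso K \<Gamma> C D \<Phi>"
  shows "verbose_barcode K \<Gamma> C k = verbose_barcode K \<Gamma> D k"
proof -
  obtain r n y mu m x lam where sb: "boundary_bases C k r n y mu m x lam"
    and bars: "verbose_barcode K \<Gamma> C k = bars r mu m lam"
    using verbose_barcode_bars[OF C] by blast
  have comm: "\<Phi> k (bdry C (k + 1) v) = bdry D (k + 1) (\<Phi> (k + 1) v)"
    if "v \<in> carrier (chain_space C (k + 1))" for v
  proof -
    have "\<Phi> (k + 1 - 1) (bdry C (k + 1) v) = bdry D (k + 1) (\<Phi> (k + 1) v)"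
      using iso that unfolding filtered_chain_iso_def by blast
    then show ?thesis by simp
  qed
  have "boundary_bases D k r n (\<lambda>i. \<Phi> (k + 1) (y i)) mu m (\<lambda>i. \<Phi> k (x i)) lam"
    by (rule isometry_singular_bases[OF chain_module[OF C] cycle_space_module[OF C] bdry_linear_cycle[OF C]
          chain_module[OF D] cycle_space_module[OF D] filtered_chain_iso_isometry[OF iso]
          filtered_chain_iso_cycles[OF C D iso] comm sb])
  then show ?thesis using bars verbose_barcode_eq[OF D] by simp
qed

section \<open>From equal barcodes to an isomorphism\<close>

lemma chain_obasis_adapted:
  assumes C: "floer_complex K \<Gamma> C"
    and low: "boundary_bases C (k - 1) r n y mu m x lam"
    and high: "boundary_bases C k r' n' y' mu' m' x' lam'"
  shows "V.obasis (chain_space C k) (filt C k) (case_sum y x') ({..<r} <+> {..<m'}) (case_sum mu lam')"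
proof -
  \<comment> \<open>Restricting the target to cycles leaves its zero unchanged, so the kernel of one
    boundary map is literally the target of the next.\<close>
  have "kernel_space (chain_space C k) (cycle_space C (k - 1)) (bdry C k) = cycle_space C k"
    by (simp add: cycle_space_def kernel_space_def)
  then have "V.obasis (kernel_space (chain_space C k) (cycle_space C (k - 1)) (bdry C k)) (filt C k)
      x' {..<m'} lam'"
    using high by (simp add: V.singular_bases_def)
  then show ?thesis
    using low bdry_linear_cycle[OF C, of "k - 1"]
    by (intro V.obasis_adapted[OF chain_module[OF C] cycle_space_module[OF C, of "k - 1"], where A = "bdry C k"])
       simp_all
qed

lemma barcodes_eq_imp_isomorphic:
  assumes C: "floer_complex K \<Gamma> C" and D: "floer_complex K \<Gamma> D"
    and eq: "\<And>k. verbose_barcode K \<Gamma> C k = verbose_barcode K \<Gamma> D k"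
  shows "\<exists>\<Phi>. filtered_chain_iso K \<Gamma> C D \<Phi>"
proof -
  obtain r n y mu m x lam
    where sbC: "\<And>k. boundary_bases C k (r k) (n k) (y k) (mu k) (m k) (x k) (lam k)"
      and barsC: "\<And>k. verbose_barcode K \<Gamma> C k = bars (r k) (mu k) (m k) (lam k)"
    using verbose_barcode_bars[OF C] by metis
  obtain r' n' y' mu' m' x' lam'
    where sbD: "\<And>k. boundary_bases D k (r' k) (n' k) (y' k) (mu' k) (m' k) (x' k) (lam' k)"
      and barsD: "\<And>k. verbose_barcode K \<Gamma> D k = bars (r' k) (mu' k) (m' k) (lam' k)"
    using verbose_barcode_bars[OF D] by metis
  have rm: "r k \<le> m k" "r k \<le> n k" "r' k \<le> m' k" "r' k \<le> n' k" for k
    using sbC[of k] sbD[of k] by (auto simp: V.singular_bases_def)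
  have "\<exists>\<sigma>. bij_betw \<sigma> {..<m k} {..<m' k} \<and> bij_betw \<sigma> {..<r k} {..<r' k} \<and>
      (\<forall>i<m k. lam' k (\<sigma> i) - lam k i \<in> \<Gamma>) \<and>
      (\<forall>i<r k. mu' k (\<sigma> i) - (lam' k (\<sigma> i) - lam k i) = mu k i)" for k
  proof -
    have "bars (r k) (mu k) (m k) (lam k) = bars (r' k) (mu' k) (m' k) (lam' k)"
      using eq[of k] barsC barsD by simp
    from matching_of_bars[OF this rm(1) rm(3)] show ?thesis by metis
  qed
  then obtain \<sigma> where \<sigma>m: "\<And>k. bij_betw (\<sigma> k) {..<m k} {..<m' k}"
    and \<sigma>r: "\<And>k. bij_betw (\<sigma> k) {..<r k} {..<r' k}"
    and \<sigma>\<Gamma>: "\<And>k i. i < m k \<Longrightarrow> lam' k (\<sigma> k i) - lam k i \<in> \<Gamma>"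
    and \<sigma>mu: "\<And>k i. i < r k \<Longrightarrow> mu' k (\<sigma> k i) - (lam' k (\<sigma> k i) - lam k i) = mu k i"
    by metis
  \<comment> \<open>The shift that moves the bar of \<open>D\<close> matched with \<open>i\<close>
    onto the bar of \<open>C\<close>; the matching puts it in \<Gamma>, so T^g is a scalar.\<close>
  define g where "g = (\<lambda>k i. lam' k (\<sigma> k i) - lam k i)"
  define u where "u = (\<lambda>k i. monom \<one> (g k i))"
  have uc: "u k i \<in> carrier \<Lambda>" if "i < m k" for k i
    unfolding u_def g_def using \<sigma>\<Gamma>[OF that] by (intro monom_closed) auto
  have uv: "novikov_val K (u k i) = ereal (g k i)" if "i < m k" for k i
    unfolding u_def using \<sigma>\<Gamma>[OF that] by (intro val_monom) (auto simp: g_def)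
  define I where "I = (\<lambda>k. {..<r (k - 1)} <+> {..<m k})"
  define e where "e = (\<lambda>k. case_sum (y (k - 1)) (x k))"
  define L where "L = (\<lambda>k. case_sum (mu (k - 1)) (lam k))"
  \<comment> \<open>In degree \<open>k\<close> a vector of \<open>y'\<close> carries the scalar
    \<open>u (k - 1)\<close> of its partner in \<open>x'\<close>, one degree lower. Thus the
    boundary map takes scaled vectors to scaled vectors.\<close>
  define f where "f = (\<lambda>k. case_sum (\<lambda>i. u (k - 1) i \<odot>\<^bsub>chain_space D k\<^esub> y' (k - 1) (\<sigma> (k - 1) i))
    (\<lambda>j. u k j \<odot>\<^bsub>chain_space D k\<^esub> x' k (\<sigma> k j)))"
  have e: "V.obasis (chain_space C k) (filt C k) (e k) (I k) (L k)" for k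
    unfolding e_def I_def L_def by (rule chain_obasis_adapted[OF C sbC sbC])
  have f: "V.obasis (chain_space D k) (filt D k) (f k) (I k) (L k)" for k
  proof -
    let ?h = "map_sum (\<sigma> (k - 1)) (\<sigma> k)"
    let ?e = "case_sum (y' (k - 1)) (x' k)" and ?L = "case_sum (mu' (k - 1)) (lam' k)"
    let ?u = "case_sum (u (k - 1)) (u k)" and ?g = "case_sum (g (k - 1)) (g k)"
    have bij: "bij_betw ?h (I k) ({..<r' (k - 1)} <+> {..<m' k})"
      unfolding I_def by (rule bij_betw_map_sum[OF \<sigma>r \<sigma>m])
    have "V.obasis (chain_space D k) (filt D k) ?e ({..<r' (k - 1)} <+> {..<m' k}) ?L"
      by (rule chain_obasis_adapted[OF D sbD sbD])
    from V.obasis_reindex[OF chain_module[OF D] this bij]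
    have *: "V.obasis (chain_space D k) (filt D k) (\<lambda>i. ?e (?h i)) (I k) (\<lambda>i. ?L (?h i))" .
    have less: "i < m (k - 1)" if "i < r (k - 1)" for i using that rm(1)[of "k - 1"] by simp
    have "V.obasis (chain_space D k) (filt D k)
        (\<lambda>i. ?u i \<odot>\<^bsub>chain_space D k\<^esub> ?e (?h i)) (I k) (\<lambda>i. ?L (?h i) - ?g i)"
      by (rule V.obasis_scale[OF chain_module[OF D] *]) (auto simp: I_def uc uv less)
    then show ?thesis
      by (rule V.obasis_cong[OF chain_module[OF D]])
         (auto simp: I_def f_def L_def g_def \<sigma>mu)
  qed
  have "\<exists>\<phi>. V.isometry_onto (chain_space C k) (filt C k) (chain_space D k) (filt D k) \<phi> \<and>
      (\<forall>i\<in>I k. \<phi> (e k i) = f k i)" for k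
    by (rule V.obasis_isometry[OF chain_module[OF C] chain_module[OF D] e f])
  then obtain \<Phi> where \<Phi>: "\<And>k. V.isometry_onto (chain_space C k) (filt C k) (chain_space D k) (filt D k) (\<Phi> k)"
    and \<Phi>e: "\<And>k i. i \<in> I k \<Longrightarrow> \<Phi> k (e k i) = f k i"
    by metis
  have lin: "linear_map \<Lambda> (chain_space C k) (chain_space D k) (\<Phi> k)" for k
    using \<Phi>[of k] by (simp add: V.isometry_onto_def)
  have bdC: "bdry C k (y (k - 1) i) = x (k - 1) i" if "i < r (k - 1)" for k i
    using sbC[of "k - 1"] that by (simp add: V.singular_bases_def)
  have bdD: "bdry D k (y' (k - 1) i) = x' (k - 1) i" if "i < r' (k - 1)" for k i
    using sbD[of "k - 1"] that by (simp add: V.singular_bases_def)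
  have y'c: "y' (k - 1) i \<in> carrier (chain_space D k)" if "i < r' (k - 1)" for k i
    using sbD[of "k - 1"] that rm(4)[of "k - 1"] by (auto simp: V.singular_bases_def dest!: V.obasis_closed)
  have x_cycle: "x k i \<in> carrier (cycle_space C k)" if "i < m k" for k i
    using sbC[of k] that by (auto simp: V.singular_bases_def dest!: V.obasis_closed)
  have x'_cycle: "x' k i \<in> carrier (cycle_space D k)" if "i < m' k" for k i
    using sbD[of k] that by (auto simp: V.singular_bases_def dest!: V.obasis_closed)
  \<comment> \<open>On the left summand the boundary of a basis vector is itself a basis vector of
    degree \<open>k - 1\<close>, where \<open>\<Phi>\<close> is known; on the right summand both
    sides vanish.\<close>
  have basis_comm: "\<Phi> (k - 1) (bdry C k (e k i)) = bdry D k (f k i)" if i: "i \<in> I k" for k i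
  proof (cases i)
    case (Inl j)
    have j: "j < r (k - 1)" "j < m (k - 1)" using i Inl rm(1)[of "k - 1"] by (auto simp: I_def)
    have \<sigma>j: "\<sigma> (k - 1) j < r' (k - 1)" using bij_betwE[OF \<sigma>r, of "k - 1"] j by auto
    have "\<Phi> (k - 1) (bdry C k (e k i)) = \<Phi> (k - 1) (e (k - 1) (Inr j))"
      using Inl j bdC by (simp add: e_def)
    also have "\<dots> = f (k - 1) (Inr j)" using j by (intro \<Phi>e) (auto simp: I_def)
    also have "\<dots> = bdry D k (f k i)"
      using Inl linear_map_smult[OF bdry_linear[OF D] uc[OF j(2)] y'c[OF \<sigma>j]] bdD[OF \<sigma>j]
      by (simp add: f_def)
    finally show ?thesis .
  next
    case (Inr j)
    have j: "j < m k" using i Inr by (auto simp: I_def)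
    have \<sigma>j: "\<sigma> k j < m' k" using bij_betwE[OF \<sigma>m, of k] j by auto
    interpret D1: Module.module \<Lambda> "chain_space D (k - 1)" by (rule chain_module[OF D])
    have "\<Phi> (k - 1) (bdry C k (e k i)) = \<Phi> (k - 1) \<zero>\<^bsub>chain_space C (k - 1)\<^esub>"
      using Inr x_cycle[OF j] by (simp add: e_def carrier_cycle_space)
    also have "\<dots> = \<zero>\<^bsub>chain_space D (k - 1)\<^esub>"
      by (rule linear_map_zero[OF chain_module[OF C] chain_module[OF D] lin])
    also have "\<dots> = u k j \<odot>\<^bsub>chain_space D (k - 1)\<^esub> \<zero>\<^bsub>chain_space D (k - 1)\<^esub>"
      using uc[OF j] by simp
    also have "\<dots> = bdry D k (f k i)"
      using Inr x'_cycle[OF \<sigma>j] linear_map_smult[OF bdry_linear[OF D] uc[OF j]]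
      by (simp add: f_def carrier_cycle_space)
    finally show ?thesis .
  qed
  have comm: "\<Phi> (k - 1) (bdry C k v) = bdry D k (\<Phi> k v)" if v: "v \<in> carrier (chain_space C k)" for k v
  proof -
    note ec = V.obasis_closed[OF e, of k] and fin = V.obasis_finite[OF e, of k]
      and fc = V.obasis_closed[OF f, of k]
    interpret D1: Module.module \<Lambda> "chain_space D (k - 1)" by (rule chain_module[OF D])
    obtain a where a: "a \<in> I k \<rightarrow> carrier \<Lambda>" "v = lc (chain_space C k) a (e k) (I k)"
      using V.obasis_span[OF e v] by blast
    have bc: "(\<lambda>i. bdry C k (e k i)) \<in> I k \<rightarrow> carrier (chain_space C (k - 1))"
      using ec linear_map_closed[OF bdry_linear[OF C]] by auto
    have "\<Phi> (k - 1) (bdry C k v)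
        = \<Phi> (k - 1) (lc (chain_space C (k - 1)) a (\<lambda>i. bdry C k (e k i)) (I k))"
      unfolding a(2) using linear_map_lc[OF chain_module[OF C] chain_module[OF C] bdry_linear[OF C] fin a(1) ec]
      by simp
    also have "\<dots> = lc (chain_space D (k - 1)) a (\<lambda>i. \<Phi> (k - 1) (bdry C k (e k i))) (I k)"
      by (rule linear_map_lc[OF chain_module[OF C] chain_module[OF D] lin fin a(1) bc])
    also have "\<dots> = lc (chain_space D (k - 1)) a (\<lambda>i. bdry D k (f k i)) (I k)"
      using a(1) fc linear_map_closed[OF bdry_linear[OF D]] basis_comm
      by (intro D1.lc_cong) auto
    also have "\<dots> = bdry D k (lc (chain_space D k) a (f k) (I k))"
      by (rule linear_map_lc[OF chain_module[OF D] chain_module[OF D] bdry_linear[OF D] fin a(1) fc, symmetric])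
    also have "lc (chain_space D k) a (f k) (I k) = lc (chain_space D k) a (\<lambda>i. \<Phi> k (e k i)) (I k)"
    proof -
      interpret Dk: Module.module \<Lambda> "chain_space D k" by (rule chain_module[OF D])
      show ?thesis using a(1) fc \<Phi>e ec linear_map_closed[OF lin] by (intro Dk.lc_cong) auto
    qed
    also have "\<dots> = \<Phi> k v"
      unfolding a(2) by (rule linear_map_lc[OF chain_module[OF C] chain_module[OF D] lin fin a(1) ec, symmetric])
    finally show ?thesis .
  qed
  have "filtered_chain_iso K \<Gamma> C D \<Phi>"
    using \<Phi> comm by (simp add: filtered_chain_iso_def V.isometry_onto_def)
  then show ?thesis by blast
qed

end

theorem theoremA:
  fixes K :: "('k, 'z) ring_scheme"
    and \<Gamma> :: "real set"
    and C :: "('k, 'v) filtered_complex"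
    and D :: "('k, 'w) filtered_complex"
  assumes "field K"
    and "subgroup \<Gamma> real_add_group"
    and "floer_complex K \<Gamma> C"
    and "floer_complex K \<Gamma> D"
  shows "filtered_chain_isomorphic K \<Gamma> C D \<longleftrightarrow>
    (\<forall>k. verbose_barcode K \<Gamma> C k = verbose_barcode K \<Gamma> D k)"
proof -
  \<comment> \<open>Any degree would do: the locale \<open>module\<close> includes
    \<open>cring\<close>, so a chain space certifies the ring axioms of \<Lambda>.\<close>
  have "Module.module (novikov K \<Gamma>) (chain_space C 0)"
    using assms(3) by (simp add: floer_complex_def orthogonalizable_space_def nonarch_normed_space_def)
  then have "cring (novikov K \<Gamma>)" by (rule module.axioms)
  then interpret novikov_field K \<Gamma>
    using assms(1,2) by (intro novikov_field.intro novikov_field_axioms.intro)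
  show ?thesis
    using isomorphic_imp_barcodes_eq[OF assms(3,4)] barcodes_eq_imp_isomorphic[OF assms(3,4)]
    by (auto simp: filtered_chain_isomorphic_def)
qed

end
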